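(* Let $\mathbb{L}_1$ be the specific compact space constructed in the context (a continuous image of a zero-dimensional RN compact space $\mathbb{L}_0$ which is not itself RN compact). Then the Banach space $C(\mathbb{L}_1)$ is not isomorphic to any $C(K)$ where $K$ is almost totally disconnected.
   Context: General notions. A compact space is Radon-Nikodým (RN) compact if it is homeomorphic to a weak$^*$ compact subset of a dual Banach space with the Radon-Nikodým property (i.e. a dual space for which the Radon-Nikodým theorem holds for vector measures with values in it). $C(K)$ is the Banach space of real-valued continuous functions on the compact space $K$; isomorphic means linearly homeomorphic. A compact space is almost totally disconnected if it is (homeomorphic to) a compact set $E\subset[0,1]^I$, for some set $I$, such that for every $x\in E$ the set $\{i\in I: x_i\in(0,1)\}$ is countable. Notation. $\Delta=2^{\mathbb{N}}$ is the Cantor set of infinite 0-1 sequences with its product topology, $T=2^{<\omega}$ is the countable set of finite 0-1 sequences, $t^\frown s$ is concatenation, and for $t,s\in T\cup\Delta$, $t<s$ means that there is $k$ with $t_k<s_k$ and $t_i=s_i$ for $i<k$. For $s,t\in T$ let $\Gamma_s^t:\Delta\to\Delta$ be the continuous function with $\Gamma_s^t(z)=t^\frown(0,0,\ldots)$ if $z<s$, $\Gamma_s^t(s^\frown\lambda)=t^\frown\lambda$ for $\lambda\in\Delta$, and $\Gamma_s^t(z)=t^\frown(1,1,\ldots)$ if $z>s$. Let $q:\Delta\to[0,1]$, $q(t_1,t_2,\ldots)=\sum_{k\ge1}t_k2^{-k}$. Basic space. A basic space is a compact scattered space $M$ which is a disjoint union $M=\bigcup_{t\in T}A_t\cup B\cup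 C$ such that: (1) all points of $A=\bigcup_{t\in T}A_t$ are isolated in $M$; (2) for every $x\in B$ there is an infinite set $C_x\subset A$ such that $\overline{C_x}=C_x\cup\{x\}$ and $\overline{C_x}$ is open in $M$; (3) there is a function $\psi:B\to T^T$ such that, given any family $\{X_s^t: s,t\in T\}$ of subsets of $A$ with $A_t=\bigcup_{s}X_s^t$ for every $t$, there exists $x\in B$ such that $C_x\cap X^t_{\psi(x)[t]}$ is infinite for all $t\in T$, where $\psi(x)[t]$ is the value of $\psi(x)$ at $t$. Basic spaces exist in ZFC; fix one, together with the sets $C_x$ and the function $\psi$. Construction. Let $L=(A\times\Delta)\cup B\cup C$ be the compact space obtained from $M$ by replacing each point of $A$ by a copy of $\Delta$: basic neighborhoods of $(a,t)$ are $\{a\}\times U$ with $U$ a neighborhood of $t$ in $\Delta$, and basic neighborhoods of $x\in B\cup C$ are $((U\cap A)\times\Delta)\cup(U\setminus A)$ with $U$ a neighborhood of $x$ in $M$. For $x\in B$ let $g_x:L\setminus\{x\}\to\Delta$ be the continuous function with $g_x(y)=(0,0,\ldots)$ for $y\notin C_x\times\Delta$, $y\ne x$, and $g_x(a,z)=\Gamma^t_{\psi(x)[t]}(z)$ for $a\in A_t\cap C_x$, $z\in\Delta$; let $f_x=q\circ g_x:L\setminus\{x\}\to[0,1]$. Put $\mathbb{L}_0=\{[u,v]\in L\times\Delta^B: g_x(u)=v_x \text{ for all } x\in B\setminus\{u\}\}$, $\mathbb{L}_1=\{[u,v]\in L\times[0,1]^B: f_x(u)=v_x \text{ for all } x\in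 B\setminus\{u\}\}$, and $\pi:\mathbb{L}_0\to\mathbb{L}_1$, $\pi[u,v]=[u,(q(v_x))_{x\in B}]$. Then $\pi$ is a continuous surjection, $\mathbb{L}_0$ is a zero-dimensional RN compact space, and $\mathbb{L}_1$ is compact but not RN compact. *)

theory Defs
  imports "HOL-Analysis.Analysis"
begin

section \<open>Finite and infinite 0-1 sequences\<close>

text \<open>
  The digits 0 and 1 are \<^const>\<open>False\<close> and \<^const>\<open>True\<close>; finite sequences are
  of type \<^typ>\<open>bool list\<close> and infinite ones of type \<^typ>\<open>nat \<Rightarrow> bool\<close>.
  Sequences are indexed from 0 here, whereas the usual index set is
  $\{1,2,\ldots\}$; this accounts for \<^term>\<open>Suc k\<close> in the map \<open>dyadic\<close> below.
\<close>

type_synonym cantor = "nat \<Rightarrow> bool"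

definition cantor_topology :: "cantor topology" where
  "cantor_topology = product_topology (\<lambda>_. discrete_topology UNIV) UNIV"

definition concat_seq :: "bool list \<Rightarrow> cantor \<Rightarrow> cantor" where
  "concat_seq t z = (\<lambda>n. if n < length t then t ! n else z (n - length t))"

definition cantor_less_fin :: "cantor \<Rightarrow> bool list \<Rightarrow> bool" where
  "cantor_less_fin z s \<longleftrightarrow> (\<exists>k<length s. z k < s ! k \<and> (\<forall>i<k. z i = s ! i))"

definition fin_less_cantor :: "bool list \<Rightarrow> cantor \<Rightarrow> bool" where
  "fin_less_cantor s z \<longleftrightarrow> (\<exists>k<length s. s ! k < z k \<and> (\<forall>i<k. s ! i = z i))"

text \<open>
  In the last case of the following definition \<open>z\<close> extends \<open>s\<close>; see
  \<open>Gamma_concat\<close> below.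
\<close>

definition Gamma :: "bool list \<Rightarrow> bool list \<Rightarrow> cantor \<Rightarrow> cantor" where
  "Gamma s t z =
     (if cantor_less_fin z s then concat_seq t (\<lambda>_. False)
      else if fin_less_cantor s z then concat_seq t (\<lambda>_. True)
      else concat_seq t (\<lambda>n. z (n + length s)))"

lemma Gamma_concat: "Gamma s t (concat_seq s w) = concat_seq t w"
  by (auto simp: Gamma_def cantor_less_fin_def fin_less_cantor_def concat_seq_def)

lemma cantor_trichotomy:
  "cantor_less_fin z s \<or> fin_less_cantor s z \<or> (\<exists>w. z = concat_seq s w)"
proof (cases "\<exists>k<length s. z k \<noteq> s ! k")
  case True
  define k where "k = (LEAST k. k < length s \<and> z k \<noteq> s ! k)"
  have k: "k < length s" "z k \<noteq> s ! k"
    using LeastI_ex[OF True] by (auto simp: k_def)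
  moreover have "z i = s ! i" if "i < k" for i
    using not_less_Least[of i "\<lambda>k. k < length s \<and> z k \<noteq> s ! k"] that k(1)
    by (auto simp: k_def)
  ultimately show ?thesis
    by (cases "z k") (auto simp: cantor_less_fin_def fin_less_cantor_def)
next
  case False
  then have "z = concat_seq s (\<lambda>n. z (n + length s))"
    by (auto simp: concat_seq_def fun_eq_iff)
  then show ?thesis by blast
qed

definition dyadic :: "cantor \<Rightarrow> real" where
  "dyadic z = (\<Sum>k. of_bool (z k) * (1 / 2) ^ Suc k)"

section \<open>Basic spaces\<close>

definition scattered_space :: "'a topology \<Rightarrow> bool" where
  "scattered_space X \<longleftrightarrow>
     (\<forall>S. S \<subseteq> topspace X \<and> S \<noteq> {} \<longrightarrow> (\<exists>x\<in>S. openin (subtopology X S) {x}))"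

text \<open>
  Compact spaces are understood to be Hausdorff. The family \<open>X\<^sub>s\<^sup>t\<close> is
  written \<open>X s t\<close>, and \<open>\<psi> x t\<close> is the value of the function \<open>\<psi>(x)\<close> at \<open>t\<close>.
\<close>

locale basic_space =
  fixes M :: "'m topology"
    and A :: "bool list \<Rightarrow> 'm set"
    and B C :: "'m set"
    and Cx :: "'m \<Rightarrow> 'm set"
    and \<psi> :: "'m \<Rightarrow> bool list \<Rightarrow> bool list"
  assumes compact: "compact_space M"
    and Hausdorff: "Hausdorff_space M"
    and scattered: "scattered_space M"
    and points: "topspace M = (\<Union>t. A t) \<union> B \<union> C"
    and disjoint_A: "disjoint_family A"
    and disjoint_AB: "(\<Union>t. A t) \<inter> B = {}"
    and disjoint_AC: "(\<Union>t. A t) \<inter> C = {}"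
    and disjoint_BC: "B \<inter> C = {}"
    and isolated: "\<And>a. a \<in> (\<Union>t. A t) \<Longrightarrow> openin M {a}"
    and Cx_subset: "\<And>x. x \<in> B \<Longrightarrow> Cx x \<subseteq> (\<Union>t. A t)"
    and Cx_infinite: "\<And>x. x \<in> B \<Longrightarrow> infinite (Cx x)"
    and Cx_closure: "\<And>x. x \<in> B \<Longrightarrow> M closure_of (Cx x) = Cx x \<union> {x}"
    and Cx_clopen: "\<And>x. x \<in> B \<Longrightarrow> openin M (M closure_of (Cx x))"
    and guess: "\<And>X :: bool list \<Rightarrow> bool list \<Rightarrow> 'm set.
        (\<And>s t. X s t \<subseteq> (\<Union>t. A t)) \<Longrightarrow> (\<And>t. A t = (\<Union>s. X s t)) \<Longrightarrow>
        \<exists>x\<in>B. \<forall>t. infinite (Cx x \<inter> X (\<psi> x t) t)"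

section \<open>The spaces \<open>L\<close> and \<open>\<bbbL>\<^sub>1\<close>\<close>

text \<open>
  The pair \<open>(a, z)\<close> with \<open>a\<close> in \<open>A\<close> is the point \<open>Inl (a, z)\<close> of \<open>L\<close>; a point \<open>x\<close> of
  \<open>B \<union> C\<close> is the point \<open>Inr x\<close>. In the next three definitions \<open>A\<close> is the
  union of the sets \<open>A\<^sub>t\<close> and \<open>D\<close> stands for \<open>B \<union> C\<close>.
\<close>

type_synonym 'm lpoint = "('m \<times> cantor) + 'm"

definition L_points :: "'m set \<Rightarrow> 'm set \<Rightarrow> 'm lpoint set" where
  "L_points A D = Inl ` (A \<times> UNIV) \<union> Inr ` D"

definition L_open :: "'m topology \<Rightarrow> 'm set \<Rightarrow> 'm set \<Rightarrow> 'm lpoint set \<Rightarrow> bool" where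
  "L_open M A D W \<longleftrightarrow> W \<subseteq> L_points A D \<and>
     (\<forall>a z. Inl (a, z) \<in> W \<longrightarrow>
        (\<exists>U. openin cantor_topology U \<and> z \<in> U \<and> Inl ` ({a} \<times> U) \<subseteq> W)) \<and>
     (\<forall>x. Inr x \<in> W \<longrightarrow>
        (\<exists>U. openin M U \<and> x \<in> U \<and> Inl ` ((U \<inter> A) \<times> UNIV) \<union> Inr ` (U - A) \<subseteq> W))"

definition L_topology :: "'m topology \<Rightarrow> 'm set \<Rightarrow> 'm set \<Rightarrow> 'm lpoint topology" where
  "L_topology M A D = topology (L_open M A D)"

lemma istopology_L_open: "istopology (L_open M A D)"
  unfolding istopology_def
proof (intro conjI allI impI)
  fix S T assume S: "L_open M A D S" and T: "L_open M A D T"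
  show "L_open M A D (S \<inter> T)"
    unfolding L_open_def
  proof (intro conjI allI impI)
    show "S \<inter> T \<subseteq> L_points A D" using S by (auto simp: L_open_def)
  next
    fix a z assume z: "Inl (a, z) \<in> S \<inter> T"
    obtain U where U: "openin cantor_topology U" "z \<in> U" "Inl ` ({a} \<times> U) \<subseteq> S"
      using S z unfolding L_open_def by blast
    obtain V where V: "openin cantor_topology V" "z \<in> V" "Inl ` ({a} \<times> V) \<subseteq> T"
      using T z unfolding L_open_def by blast
    show "\<exists>U. openin cantor_topology U \<and> z \<in> U \<and> Inl ` ({a} \<times> U) \<subseteq> S \<inter> T"
      using U V by (intro exI[of _ "U \<inter> V"]) (auto intro: openin_Int)
  next
    fix x assume x: "Inr x \<in> S \<inter> T"
    obtain U where U: "openin M U" "x \<in> U" "Inl ` ((U \<inter> A) \<times> UNIV) \<union> Inr ` (U - A) \<subseteq> S"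
      using S x unfolding L_open_def by blast
    obtain V where V: "openin M V" "x \<in> V" "Inl ` ((V \<inter> A) \<times> UNIV) \<union> Inr ` (V - A) \<subseteq> T"
      using T x unfolding L_open_def by blast
    show "\<exists>U. openin M U \<and> x \<in> U \<and> Inl ` ((U \<inter> A) \<times> UNIV) \<union> Inr ` (U - A) \<subseteq> S \<inter> T"
      using U V by (intro exI[of _ "U \<inter> V"]) (auto intro: openin_Int)
  qed
next
  fix K assume K: "\<forall>S\<in>K. L_open M A D S"
  show "L_open M A D (\<Union>K)"
    unfolding L_open_def
  proof (intro conjI allI impI)
    show "\<Union>K \<subseteq> L_points A D" using K by (auto simp: L_open_def)
  next
    fix a z assume "Inl (a, z) \<in> \<Union>K"
    then obtain S where S: "S \<in> K" "Inl (a, z) \<in> S" by (rule UnionE)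
    have "L_open M A D S" using K S(1) by (rule bspec)
    with S(2) obtain U where U:
      "openin cantor_topology U" "z \<in> U" "Inl ` ({a} \<times> U) \<subseteq> S"
      unfolding L_open_def by blast
    have "Inl ` ({a} \<times> U) \<subseteq> \<Union>K" by (rule subset_trans[OF U(3) Union_upper[OF S(1)]])
    with U(1,2) show "\<exists>U. openin cantor_topology U \<and> z \<in> U \<and> Inl ` ({a} \<times> U) \<subseteq> \<Union>K"
      by (intro exI[of _ U] conjI)
  next
    fix x assume "Inr x \<in> \<Union>K"
    then obtain S where S: "S \<in> K" "Inr x \<in> S" by (rule UnionE)
    have "L_open M A D S" using K S(1) by (rule bspec)
    with S(2) obtain U where U:
      "openin M U" "x \<in> U" "Inl ` ((U \<inter> A) \<times> UNIV) \<union> Inr ` (U - A) \<subseteq> S"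
      unfolding L_open_def by blast
    have "Inl ` ((U \<inter> A) \<times> UNIV) \<union> Inr ` (U - A) \<subseteq> \<Union>K"
      by (rule subset_trans[OF U(3) Union_upper[OF S(1)]])
    with U(1,2) show
      "\<exists>U. openin M U \<and> x \<in> U \<and> Inl ` ((U \<inter> A) \<times> UNIV) \<union> Inr ` (U - A) \<subseteq> \<Union>K"
      by (intro exI[of _ U] conjI)
  qed
qed

lemma openin_L_topology: "openin (L_topology M A D) = L_open M A D"
  unfolding L_topology_def by (rule topology_inverse'[OF istopology_L_open])

lemma topspace_L_topology:
  assumes "topspace M = A \<union> D" and "A \<inter> D = {}"
  shows "topspace (L_topology M A D) = L_points A D"
proof (rule antisym)
  have "L_open M A D (topspace (L_topology M A D))"
    using openin_topspace[of "L_topology M A D"] by (simp add: openin_L_topology)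
  then show "topspace (L_topology M A D) \<subseteq> L_points A D"
    by (simp add: L_open_def)
next
  have "topspace cantor_topology = UNIV"
    by (simp add: cantor_topology_def)
  then have cantor: "openin cantor_topology UNIV"
    using openin_topspace[of cantor_topology] by simp
  have "L_open M A D (L_points A D)"
    unfolding L_open_def
  proof (intro conjI allI impI)
    show "\<exists>U. openin cantor_topology U \<and> z \<in> U \<and> Inl ` ({a} \<times> U) \<subseteq> L_points A D"
      if "Inl (a, z) \<in> L_points A D" for a z
    proof (intro exI[of _ UNIV] conjI)
      show "Inl ` ({a} \<times> UNIV) \<subseteq> L_points A D"
        using that by (auto simp: L_points_def)
    qed (use cantor in simp_all)
    show "\<exists>U. openin M U \<and> x \<in> U \<and>
        Inl ` ((U \<inter> A) \<times> UNIV) \<union> Inr ` (U - A) \<subseteq> L_points A D"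
      if "Inr x \<in> L_points A D" for x
    proof (intro exI[of _ "topspace M"] conjI)
      show "x \<in> topspace M"
        using that assms by (auto simp: L_points_def)
      show "Inl ` ((topspace M \<inter> A) \<times> UNIV) \<union> Inr ` (topspace M - A) \<subseteq> L_points A D"
        using assms by (auto simp: L_points_def)
    qed simp
  qed simp
  then have "openin (L_topology M A D) (L_points A D)"
    by (simp add: openin_L_topology)
  then show "L_points A D \<subseteq> topspace (L_topology M A D)"
    by (rule openin_subset)
qed

text \<open>
  The value of \<open>g\<^sub>x\<close> at the point \<open>Inr x\<close> itself is a dummy; \<open>g\<^sub>x\<close> is only
  used on the complement of that point.
\<close>

definition g_map ::
  "(bool list \<Rightarrow> 'm set) \<Rightarrow> ('m \<Rightarrow> 'm set) \<Rightarrow> ('m \<Rightarrow> bool list \<Rightarrow> bool list) \<Rightarrow> 'm \<Rightarrow> 'm lpoint \<Rightarrow> cantor"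
where
  "g_map A Cx \<psi> x u =
     (case u of
        Inl (a, z) \<Rightarrow>
          if a \<in> Cx x then (let t = (THE t. a \<in> A t) in Gamma (\<psi> x t) t z) else (\<lambda>_. False)
      | Inr y \<Rightarrow> (\<lambda>_. False))"

definition f_map ::
  "(bool list \<Rightarrow> 'm set) \<Rightarrow> ('m \<Rightarrow> 'm set) \<Rightarrow> ('m \<Rightarrow> bool list \<Rightarrow> bool list) \<Rightarrow> 'm \<Rightarrow> 'm lpoint \<Rightarrow> real"
where
  "f_map A Cx \<psi> x u = dyadic (g_map A Cx \<psi> x u)"

definition L1_space ::
  "'m topology \<Rightarrow> (bool list \<Rightarrow> 'm set) \<Rightarrow> 'm set \<Rightarrow> 'm set \<Rightarrow> ('m \<Rightarrow> 'm set) \<Rightarrow>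
   ('m \<Rightarrow> bool list \<Rightarrow> bool list) \<Rightarrow> ('m lpoint \<times> ('m \<Rightarrow> real)) topology"
where
  "L1_space M A B C Cx \<psi> =
     subtopology
       (prod_topology (L_topology M (\<Union>t. A t) (B \<union> C))
          (product_topology (\<lambda>_. top_of_set {0..1}) B))
       {(u, v). u \<in> L_points (\<Union>t. A t) (B \<union> C) \<and> v \<in> (\<Pi>\<^sub>E x\<in>B. {0..1}) \<and>
          (\<forall>x\<in>B. u \<noteq> Inr x \<longrightarrow> f_map A Cx \<psi> x u = v x)}"

section \<open>Almost totally disconnected spaces and isomorphic function spaces\<close>

text \<open>
  The index set \<open>I\<close> ranges over the sets of elements of the type \<open>'i\<close>. As \<open>'i\<close>
  does not occur in the type of \<open>K\<close>, it is passed as a type argument.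
\<close>

definition almost_totally_disconnected :: "'i itself \<Rightarrow> 'k topology \<Rightarrow> bool" where
  "almost_totally_disconnected (_ :: 'i itself) K \<longleftrightarrow>
     (\<exists>(I :: 'i set) (E :: ('i \<Rightarrow> real) set).
        compactin (product_topology (\<lambda>_. top_of_set {0..1}) I) E \<and>
        K homeomorphic_space subtopology (product_topology (\<lambda>_. top_of_set {0..1}) I) E \<and>
        (\<forall>x\<in>E. countable {i \<in> I. x i \<in> {0<..<1}}))"

text \<open>
  For compact \<open>X\<close>, \<open>C_space X\<close> is the space of all real continuous functions on \<open>X\<close>
  with the supremum metric; functions are made \<^const>\<open>undefined\<close> off \<^term>\<open>topspace X\<close>,
  so the vector space operations have to be restricted to \<^term>\<open>topspace X\<close>.
\<close>

abbreviation C_space :: "'a topology \<Rightarrow> ('a \<Rightarrow> real) metric" where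
  "C_space X \<equiv> cfunspace X euclidean_metric"

definition C_linear :: "'a topology \<Rightarrow> 'b topology \<Rightarrow> (('a \<Rightarrow> real) \<Rightarrow> ('b \<Rightarrow> real)) \<Rightarrow> bool" where
  "C_linear X Y T \<longleftrightarrow>
     (\<forall>f\<in>mspace (C_space X). \<forall>g\<in>mspace (C_space X). \<forall>a b.
        T (\<lambda>x\<in>topspace X. a * f x + b * g x) = (\<lambda>y\<in>topspace Y. a * T f y + b * T g y))"

definition C_isomorphic :: "'a topology \<Rightarrow> 'b topology \<Rightarrow> bool" where
  "C_isomorphic X Y \<longleftrightarrow>
     (\<exists>T. C_linear X Y T \<and>
        homeomorphic_map (mtopology_of (C_space X)) (mtopology_of (C_space Y)) T)"

end

(*
Let X be the space in question and suppose that T is an isomorphism from C(X) onto C(K), with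
inverse S. Write delta_h for the pseudometric sup |h(x) - h(y)| given by a family of functions h.

1. On X, and for each e > 0, the functions in C(X) fall into countably many classes such that X is
a countable union of sets of delta_H-diameter e, for every countable subset H of one class: a
modulus of continuity of h on all fibres over M determines its class. Functionals are
approximated by finite combinations of point evaluations at those sets, so the same holds for the
functionals f -> (T f)(y), y in K, hence for the coordinates of K in [0,1]^I with a fixed e.

2. A Cantor scheme turns this into fragmentability of K by the coordinates of one class up to e.
As each point of K has only countably many coordinates in (0,1), Alster's argument splits the
classes further, so that each point of K has only finitely many coordinates in [2e, 1 - 2e] in
each class. Hence the coordinates, truncated near 0 and 1, and their products satisfy the
conclusion of step 1 on K for all e simultaneously.

3. Back on X, via S: for a in A there is a cylinder s = s(a) on which the images h = S g of all
products g of the first |t| classes, where a is in A_t, vary by at most 4^-|t|. The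
guessing property yields x in B such that, in the limit along C_x, these h vary by at most 4^-|t|
on each dyadic interval of length 2^-|t| of the copy of [0,1] over x. Adding up, h takes the same
value at both ends of that copy, so by Stone-Weierstrass C(X) does not separate them.
*)

theory Submission
  imports Defs
begin

section \<open>Countable unions of sets of small oscillation\<close>

text \<open>The isomorphism respects neither the fibres nor products of functions, so the only thing
  that can be carried through it is a statement about countable decompositions, and only for one
  tolerance: the modulus that defines a class depends on the tolerance. Almost total
  disconnectedness of \<open>K\<close> is what turns this single tolerance into all tolerances, at
  the price of truncating the coordinates. Products are formed on \<open>K\<close> before
  \<open>S\<close> is applied because \<open>S\<close> is not multiplicative, while
  Stone-Weierstrass needs an algebra. Countable subfamilies are the natural limit of the
  decomposition statement, since every member contributes its own exceptional sets. The guessing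
  property, however, needs one cylinder per point \<open>a\<close> for a whole, possibly uncountable
  class at once. Fragmentability bridges this gap: a binary tree has only countably many nodes, so a
  failure for the class already shows up in a countable subfamily. The rate 4^-|t| is chosen to beat
  the 2^|t| dyadic intervals over which errors are added.\<close>

definition countably_small :: "'a set \<Rightarrow> 'j set \<Rightarrow> ('j \<Rightarrow> 'a \<Rightarrow> real) \<Rightarrow> real \<Rightarrow> bool" where
  "countably_small Y J F \<epsilon> \<longleftrightarrow>
     (\<exists>W :: nat \<Rightarrow> 'a set. Y \<subseteq> (\<Union>n. W n) \<and>
        (\<forall>n. \<forall>x\<in>W n \<inter> Y. \<forall>y\<in>W n \<inter> Y. \<forall>i\<in>J. \<bar>F i x - F i y\<bar> \<le> \<epsilon>))"

lemma countably_smallE: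
  assumes "countably_small Y J F \<epsilon>"
  obtains W :: "nat \<Rightarrow> 'a set" where "Y \<subseteq> (\<Union>n. W n)"
    "\<And>n x y i. x \<in> W n \<Longrightarrow> y \<in> W n \<Longrightarrow> x \<in> Y \<Longrightarrow> y \<in> Y \<Longrightarrow> i \<in> J \<Longrightarrow> \<bar>F i x - F i y\<bar> \<le> \<epsilon>"
proof -
  from assms obtain W :: "nat \<Rightarrow> 'a set" where W: "Y \<subseteq> (\<Union>n. W n) \<and>
      (\<forall>n. \<forall>x\<in>W n \<inter> Y. \<forall>y\<in>W n \<inter> Y. \<forall>i\<in>J. \<bar>F i x - F i y\<bar> \<le> \<epsilon>)"
    unfolding countably_small_def by (rule exE)
  show thesis
    by (rule that[of W]) (use W in auto)
qed

lemma countably_small_cong: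
  assumes "\<And>i y. i \<in> J \<Longrightarrow> y \<in> Y \<Longrightarrow> F i y = G i y"
  shows "countably_small Y J F \<epsilon> \<longleftrightarrow> countably_small Y J G \<epsilon>"
  unfolding countably_small_def using assms by auto

lemma countably_smallI:
  assumes "countable \<W>" "Y \<subseteq> \<Union>\<W>"
    and "\<And>W x y i. W \<in> \<W> \<Longrightarrow> x \<in> W \<Longrightarrow> y \<in> W \<Longrightarrow> x \<in> Y \<Longrightarrow> y \<in> Y \<Longrightarrow> i \<in> J
           \<Longrightarrow> \<bar>F i x - F i y\<bar> \<le> \<epsilon>"
  shows "countably_small Y J F \<epsilon>"
proof (cases "\<W> = {}")
  case True
  then show ?thesis using assms(2) by (auto simp: countably_small_def)
next
  case False
  then have r: "range (from_nat_into \<W>) = \<W>"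
    using assms(1) by (simp add: range_from_nat_into)
  then have "from_nat_into \<W> n \<in> \<W>" for n by blast
  then show ?thesis
    unfolding countably_small_def using assms(2) r
    by (intro exI[of _ "from_nat_into \<W>"]) (auto intro: assms(3))
qed

lemma countably_small_mono:
  assumes "countably_small Y J F \<epsilon>" "Y' \<subseteq> Y" "J' \<subseteq> J" "\<epsilon> \<le> \<epsilon>'"
  shows "countably_small Y' J' F \<epsilon>'"
proof (rule countably_smallE[OF assms(1)])
  fix W :: "nat \<Rightarrow> 'a set"
  assume W: "Y \<subseteq> (\<Union>n. W n)"
    "\<And>n x y i. x \<in> W n \<Longrightarrow> y \<in> W n \<Longrightarrow> x \<in> Y \<Longrightarrow> y \<in> Y \<Longrightarrow> i \<in> J \<Longrightarrow> \<bar>F i x - F i y\<bar> \<le> \<epsilon>"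
  show ?thesis
  proof (rule countably_smallI[of "range W"])
    fix V x y i assume "V \<in> range W" "x \<in> V" "y \<in> V" "x \<in> Y'" "y \<in> Y'" "i \<in> J'"
    then have "\<bar>F i x - F i y\<bar> \<le> \<epsilon>"
      using assms(2,3) by (auto intro!: W(2))
    then show "\<bar>F i x - F i y\<bar> \<le> \<epsilon>'" using assms(4) by simp
  qed (use W(1) assms(2) in auto)
qed

lemma countably_small_Union:
  assumes "countable \<Y>" "Y \<subseteq> \<Union>\<Y>" and "\<And>Z. Z \<in> \<Y> \<Longrightarrow> countably_small Z J F \<epsilon>"
  shows "countably_small Y J F \<epsilon>"
proof -
  have "\<forall>Z\<in>\<Y>. \<exists>W :: nat \<Rightarrow> 'a set. Z \<subseteq> (\<Union>n. W n) \<and>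
        (\<forall>n. \<forall>x\<in>W n \<inter> Z. \<forall>y\<in>W n \<inter> Z. \<forall>i\<in>J. \<bar>F i x - F i y\<bar> \<le> \<epsilon>)"
    using assms(3) unfolding countably_small_def by blast
  then have "\<exists>W :: 'a set \<Rightarrow> nat \<Rightarrow> 'a set. \<forall>Z\<in>\<Y>. Z \<subseteq> (\<Union>n. W Z n) \<and>
        (\<forall>n. \<forall>x\<in>W Z n \<inter> Z. \<forall>y\<in>W Z n \<inter> Z. \<forall>i\<in>J. \<bar>F i x - F i y\<bar> \<le> \<epsilon>)"
    by (rule bchoice)
  then obtain W :: "'a set \<Rightarrow> nat \<Rightarrow> 'a set" where W: "\<forall>Z\<in>\<Y>. Z \<subseteq> (\<Union>n. W Z n) \<and>
        (\<forall>n. \<forall>x\<in>W Z n \<inter> Z. \<forall>y\<in>W Z n \<inter> Z. \<forall>i\<in>J. \<bar>F i x - F i y\<bar> \<le> \<epsilon>)"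
    by (rule exE)
  show ?thesis
  proof (rule countably_smallI)
    show "countable (\<Union>Z\<in>\<Y>. range (\<lambda>n. W Z n \<inter> Z))"
      using assms(1) by auto
    show "Y \<subseteq> \<Union>(\<Union>Z\<in>\<Y>. range (\<lambda>n. W Z n \<inter> Z))"
    proof
      fix y assume "y \<in> Y"
      then obtain Z where Z: "Z \<in> \<Y>" "y \<in> Z" using assms(2) by blast
      then obtain n where "y \<in> W Z n" using W by blast
      then show "y \<in> \<Union>(\<Union>Z\<in>\<Y>. range (\<lambda>n. W Z n \<inter> Z))" using Z by blast
    qed
  qed (use W in auto)
qed

lemma countably_small_index_Un:
  assumes "countably_small Y J F \<epsilon>" "countably_small Y J' F \<epsilon>"
  shows "countably_small Y (J \<union> J') F \<epsilon>"
proof -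
  obtain W :: "nat \<Rightarrow> 'a set" where W: "Y \<subseteq> (\<Union>n. W n)"
    "\<And>n x y i. x \<in> W n \<Longrightarrow> y \<in> W n \<Longrightarrow> x \<in> Y \<Longrightarrow> y \<in> Y \<Longrightarrow> i \<in> J \<Longrightarrow> \<bar>F i x - F i y\<bar> \<le> \<epsilon>"
    by (rule countably_smallE[OF assms(1)], rule that) auto
  obtain W' :: "nat \<Rightarrow> 'a set" where W': "Y \<subseteq> (\<Union>n. W' n)"
    "\<And>n x y i. x \<in> W' n \<Longrightarrow> y \<in> W' n \<Longrightarrow> x \<in> Y \<Longrightarrow> y \<in> Y \<Longrightarrow> i \<in> J' \<Longrightarrow> \<bar>F i x - F i y\<bar> \<le> \<epsilon>"
    by (rule countably_smallE[OF assms(2)], rule that) auto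
  show ?thesis
  proof (rule countably_smallI)
    show "countable (range (\<lambda>(m, n). W m \<inter> W' n))" by simp
    show "Y \<subseteq> \<Union>(range (\<lambda>(m, n). W m \<inter> W' n))" using W(1) W'(1) by fastforce
  qed (use W(2) W'(2) in auto)
qed

lemma countably_small_index_finite_UN:
  assumes "finite N" "\<And>n. n \<in> N \<Longrightarrow> countably_small Y (J n) F \<epsilon>" "0 \<le> \<epsilon>"
  shows "countably_small Y (\<Union>n\<in>N. J n) F \<epsilon>"
  using assms(1,2)
proof (induction N)
  case empty
  show ?case by (rule countably_smallI[of "{Y}"]) auto
next
  case (insert n N)
  then have "countably_small Y (J n \<union> (\<Union>n\<in>N. J n)) F \<epsilon>"
    by (intro countably_small_index_Un) auto
  then show ?case by simp
qed

section \<open>Bounded functionals on spaces of continuous functions\<close>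

lemma compact_space_continuous_bounded:
  assumes "compact_space X" "continuous_map X euclideanreal f"
  obtains b where "0 \<le> b" "\<And>x. x \<in> topspace X \<Longrightarrow> \<bar>f x\<bar> \<le> b"
proof -
  have "compact (f ` topspace X)"
    using image_compactin[of X "topspace X" euclideanreal f] assms by (simp add: compact_space_def)
  then obtain b where "\<And>y. y \<in> f ` topspace X \<Longrightarrow> norm y \<le> b"
    using compact_imp_bounded bounded_iff by metis
  then show ?thesis using that[of "max b 0"] by fastforce
qed

text \<open>Functionals act on total functions that are continuous on \<open>X\<close>, not on
  elements of \<open>C_space X\<close>, which keeps restrictions out of the algebra. The bound with
  \<open>b = 0\<close> makes values off \<open>topspace X\<close> irrelevant.\<close>

locale bounded_functional =
  fixes X :: "'a topology" and c :: real and \<mu> :: "('a \<Rightarrow> real) \<Rightarrow> real"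
  assumes linear: "\<And>f g a b. continuous_map X euclideanreal f \<Longrightarrow> continuous_map X euclideanreal g \<Longrightarrow>
      \<mu> (\<lambda>x. a * f x + b * g x) = a * \<mu> f + b * \<mu> g"
    and bounded: "\<And>f b. continuous_map X euclideanreal f \<Longrightarrow> 0 \<le> b \<Longrightarrow>
      (\<And>x. x \<in> topspace X \<Longrightarrow> \<bar>f x\<bar> \<le> b) \<Longrightarrow> \<bar>\<mu> f\<bar> \<le> c * b"
    and bound_nonneg: "0 \<le> c"
begin

lemma zero: "\<mu> (\<lambda>x. 0) = 0"
  using linear[of "\<lambda>x. 0" "\<lambda>x. 0" 0 0] by simp

lemma add:
  assumes "continuous_map X euclideanreal f" "continuous_map X euclideanreal g"
  shows "\<mu> (\<lambda>x. f x + g x) = \<mu> f + \<mu> g"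
  using linear[OF assms, of 1 1] by simp

lemma scale:
  assumes "continuous_map X euclideanreal f"
  shows "\<mu> (\<lambda>x. a * f x) = a * \<mu> f"
  using linear[OF assms assms, of a 0] by simp

lemma minus:
  assumes "continuous_map X euclideanreal f"
  shows "\<mu> (\<lambda>x. - f x) = - \<mu> f"
  using scale[OF assms, of "-1"] by simp

lemma diff:
  assumes "continuous_map X euclideanreal f" "continuous_map X euclideanreal g"
  shows "\<mu> (\<lambda>x. f x - g x) = \<mu> f - \<mu> g"
  using linear[OF assms, of 1 "-1"] by simp

lemma cong:
  assumes "continuous_map X euclideanreal f" "continuous_map X euclideanreal g"
    and "\<And>x. x \<in> topspace X \<Longrightarrow> f x = g x"
  shows "\<mu> f = \<mu> g"
  using bounded[of "\<lambda>x. f x - g x" 0] diff[OF assms(1,2)] assms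
  by (auto intro: continuous_map_diff)

lemma sum:
  assumes "finite S" "\<And>i. i \<in> S \<Longrightarrow> continuous_map X euclideanreal (g i)"
  shows "\<mu> (\<lambda>x. \<Sum>i\<in>S. a i * g i x) = (\<Sum>i\<in>S. a i * \<mu> (g i))"
  using assms
proof (induction S)
  case empty
  then show ?case by (simp add: zero)
next
  case (insert i S)
  then have "\<mu> (\<lambda>x. a i * g i x + 1 * (\<Sum>i\<in>S. a i * g i x)) =
      a i * \<mu> (g i) + 1 * \<mu> (\<lambda>x. \<Sum>i\<in>S. a i * g i x)"
    by (intro linear) (auto intro!: continuous_intros continuous_map_sum continuous_map_real_mult)
  with insert show ?case by simp
qed

text \<open>For nonnegative \<open>f\<close> this is |\<mu>|(\<open>f\<close>), the integral of
  \<open>f\<close> against the variation measure of \<open>\<mu>\<close>. Additivity and scaling on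
  nonnegative functions are derived from the supremum, so no measure is constructed.\<close>

definition tv :: "('a \<Rightarrow> real) \<Rightarrow> real" where
  "tv f = (SUP g\<in>{g. continuous_map X euclideanreal g \<and> (\<forall>x\<in>topspace X. \<bar>g x\<bar> \<le> f x)}. \<mu> g)"

context
  assumes compact: "compact_space X"
begin

lemma le_tv:
  assumes f: "continuous_map X euclideanreal f" and g: "continuous_map X euclideanreal g"
    and le: "\<And>x. x \<in> topspace X \<Longrightarrow> \<bar>g x\<bar> \<le> f x"
  shows "\<mu> g \<le> tv f"
proof -
  obtain b where b: "0 \<le> b" "\<And>x. x \<in> topspace X \<Longrightarrow> \<bar>f x\<bar> \<le> b"
    using compact_space_continuous_bounded[OF compact f] by blast
  have "\<mu> g' \<le> c * b" if "continuous_map X euclideanreal g'" "\<forall>x\<in>topspace X. \<bar>g' x\<bar> \<le> f x" for g'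
  proof -
    have "\<bar>\<mu> g'\<bar> \<le> c * b"
      using that b by (intro bounded) fastforce+
    then show ?thesis by simp
  qed
  then have "bdd_above (\<mu> ` {g. continuous_map X euclideanreal g \<and> (\<forall>x\<in>topspace X. \<bar>g x\<bar> \<le> f x)})"
    by (intro bdd_aboveI[of _ "c * b"]) blast
  then show ?thesis
    unfolding tv_def using g le by (intro cSUP_upper) auto
qed

lemma tv_least:
  assumes "\<And>x. x \<in> topspace X \<Longrightarrow> 0 \<le> f x"
    and "\<And>g. continuous_map X euclideanreal g \<Longrightarrow> (\<And>x. x \<in> topspace X \<Longrightarrow> \<bar>g x\<bar> \<le> f x) \<Longrightarrow> \<mu> g \<le> K"
  shows "tv f \<le> K"
  unfolding tv_def
proof (rule cSUP_least)
  have "(\<lambda>x. 0) \<in> {g. continuous_map X euclideanreal g \<and> (\<forall>x\<in>topspace X. \<bar>g x\<bar> \<le> f x)}"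
    using assms(1) by simp
  then show "{g. continuous_map X euclideanreal g \<and> (\<forall>x\<in>topspace X. \<bar>g x\<bar> \<le> f x)} \<noteq> {}"
    by blast
qed (use assms(2) in blast)

lemma tv_nonneg:
  assumes "continuous_map X euclideanreal f" "\<And>x. x \<in> topspace X \<Longrightarrow> 0 \<le> f x"
  shows "0 \<le> tv f"
  using le_tv[OF assms(1), of "\<lambda>x. 0"] assms(2) by (simp add: zero)

lemma abs_le_tv:
  assumes f: "continuous_map X euclideanreal f" and g: "continuous_map X euclideanreal g"
    and "\<And>x. x \<in> topspace X \<Longrightarrow> \<bar>g x\<bar> \<le> f x"
  shows "\<bar>\<mu> g\<bar> \<le> tv f"
  using le_tv[OF f g] le_tv[OF f, of "\<lambda>x. - g x"] assms minus[OF g]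
  by (auto intro: continuous_map_minus)

lemma tv_le_bound:
  assumes "0 \<le> b" "\<And>x. x \<in> topspace X \<Longrightarrow> 0 \<le> f x" "\<And>x. x \<in> topspace X \<Longrightarrow> f x \<le> b"
  shows "tv f \<le> c * b"
proof (rule tv_least)
  fix g assume g: "continuous_map X euclideanreal g" "\<And>x. x \<in> topspace X \<Longrightarrow> \<bar>g x\<bar> \<le> f x"
  have "\<bar>\<mu> g\<bar> \<le> c * b"
    by (rule bounded) (use g assms in \<open>auto intro: order_trans\<close>)
  then show "\<mu> g \<le> c * b" by simp
qed (use assms in auto)

text \<open>Competitors for \<open>f\<close> and for \<open>g\<close> add up to a competitor for the
  sum; the two suprema are taken one after the other.\<close>

lemma tv_superadditive:
  assumes f: "continuous_map X euclideanreal f" and g: "continuous_map X euclideanreal g"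
    and pos: "\<And>x. x \<in> topspace X \<Longrightarrow> 0 \<le> f x" "\<And>x. x \<in> topspace X \<Longrightarrow> 0 \<le> g x"
  shows "tv f + tv g \<le> tv (\<lambda>x. f x + g x)"
proof -
  have fg: "continuous_map X euclideanreal (\<lambda>x. f x + g x)"
    using f g by (intro continuous_intros)
  have "tv f \<le> tv (\<lambda>x. f x + g x) - tv g"
  proof (rule tv_least)
    fix f' assume f': "continuous_map X euclideanreal f'" "\<And>x. x \<in> topspace X \<Longrightarrow> \<bar>f' x\<bar> \<le> f x"
    have "tv g \<le> tv (\<lambda>x. f x + g x) - \<mu> f'"
    proof (rule tv_least)
      fix g' assume g': "continuous_map X euclideanreal g'" "\<And>x. x \<in> topspace X \<Longrightarrow> \<bar>g' x\<bar> \<le> g x"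
      have "\<mu> (\<lambda>x. f' x + g' x) \<le> tv (\<lambda>x. f x + g x)"
      proof (rule le_tv[OF fg])
        show "continuous_map X euclideanreal (\<lambda>x. f' x + g' x)"
          using f' g' by (intro continuous_intros)
        show "\<bar>f' x + g' x\<bar> \<le> f x + g x" if "x \<in> topspace X" for x
          using f'(2)[OF that] g'(2)[OF that] by linarith
      qed
      then show "\<mu> g' \<le> tv (\<lambda>x. f x + g x) - \<mu> f'"
        using add[OF f'(1) g'(1)] by simp
    qed (use pos in auto)
    then show "\<mu> f' \<le> tv (\<lambda>x. f x + g x) - tv g" by simp
  qed (use pos in auto)
  then show ?thesis by simp
qed

text \<open>Riesz decomposition: \<open>h\<close> with \<open>\<bar>h\<bar> \<le> f + g\<close> is split by truncating it at \<open>\<plusminus>f\<close>.\<close>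

lemma tv_subadditive:
  assumes f: "continuous_map X euclideanreal f" and g: "continuous_map X euclideanreal g"
    and pos: "\<And>x. x \<in> topspace X \<Longrightarrow> 0 \<le> f x" "\<And>x. x \<in> topspace X \<Longrightarrow> 0 \<le> g x"
  shows "tv (\<lambda>x. f x + g x) \<le> tv f + tv g"
proof (rule tv_least)
  fix h assume h: "continuous_map X euclideanreal h" "\<And>x. x \<in> topspace X \<Longrightarrow> \<bar>h x\<bar> \<le> f x + g x"
  define h1 where "h1 = (\<lambda>x. max (- f x) (min (h x) (f x)))"
  have h1: "continuous_map X euclideanreal h1"
    unfolding h1_def using f h(1) by (intro continuous_intros continuous_map_real_max continuous_map_real_min)
  have h2: "continuous_map X euclideanreal (\<lambda>x. h x - h1 x)"
    using h1 h(1) by (intro continuous_intros)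
  have "\<mu> h1 \<le> tv f"
    by (rule le_tv[OF f h1]) (use pos(1) in \<open>force simp: h1_def\<close>)
  moreover have "\<mu> (\<lambda>x. h x - h1 x) \<le> tv g"
  proof (rule le_tv[OF g h2])
    show "\<bar>h x - h1 x\<bar> \<le> g x" if "x \<in> topspace X" for x
      using h(2)[OF that] pos(1)[OF that] pos(2)[OF that] by (auto simp: h1_def max_def min_def)
  qed
  ultimately show "\<mu> h \<le> tv f + tv g"
    using diff[OF h(1) h1] by simp
qed (use pos in fastforce)

lemma tv_scale_le:
  assumes f: "continuous_map X euclideanreal f" and "0 < r"
    and pos: "\<And>x. x \<in> topspace X \<Longrightarrow> 0 \<le> f x"
  shows "tv (\<lambda>x. r * f x) \<le> r * tv f"
proof (rule tv_least)
  fix g assume g: "continuous_map X euclideanreal g" "\<And>x. x \<in> topspace X \<Longrightarrow> \<bar>g x\<bar> \<le> r * f x"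
  have g': "continuous_map X euclideanreal (\<lambda>x. (1 / r) * g x)"
    using g(1) by (intro continuous_map_real_mult) auto
  have "\<mu> (\<lambda>x. (1 / r) * g x) \<le> tv f"
  proof (rule le_tv[OF f g'])
    show "\<bar>1 / r * g x\<bar> \<le> f x" if "x \<in> topspace X" for x
      using g(2)[OF that] \<open>0 < r\<close> by (simp add: abs_mult field_simps)
  qed
  then show "\<mu> g \<le> r * tv f"
    using scale[OF g(1), of "1 / r"] \<open>0 < r\<close> by (simp add: pos_divide_le_eq mult.commute)
qed (use assms in auto)

lemma tv_sum_le:
  assumes "finite S" "\<And>i. i \<in> S \<Longrightarrow> continuous_map X euclideanreal (g i)"
    and "\<And>i x. i \<in> S \<Longrightarrow> x \<in> topspace X \<Longrightarrow> 0 \<le> g i x"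
  shows "tv (\<lambda>x. \<Sum>i\<in>S. g i x) \<le> (\<Sum>i\<in>S. tv (g i))"
  using assms
proof (induction S)
  case empty
  show ?case using tv_le_bound[of 0 "\<lambda>x. 0"] by simp
next
  case (insert i S)
  have "tv (\<lambda>x. g i x + (\<Sum>i\<in>S. g i x)) \<le> tv (g i) + tv (\<lambda>x. \<Sum>i\<in>S. g i x)"
    by (rule tv_subadditive) (use insert in \<open>auto intro!: continuous_map_sum sum_nonneg\<close>)
  also have "\<dots> \<le> tv (g i) + (\<Sum>i\<in>S. tv (g i))"
    using insert by simp
  finally show ?case using insert by simp
qed

text \<open>
  This replaces the Riesz representation theorem: the numbers \<open>e j\<close> play the role of the
  measures of the sets \<open>W j - (W 0 \<union> \<dots> \<union> W (j - 1))\<close>. The functions \<open>u j\<close> are almost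
  minimal among the functions that are 1 on \<open>W 0 \<union> \<dots> \<union> W j\<close>.
\<close>

lemma approximate_by_point_evaluations:
  fixes W :: "nat \<Rightarrow> 'a set" and F :: "'j \<Rightarrow> 'a \<Rightarrow> real"
  assumes W: "topspace X \<subseteq> (\<Union>j. W j)"
    and w: "\<And>j. w j \<in> topspace X" "\<And>j. W j \<inter> topspace X \<noteq> {} \<Longrightarrow> w j \<in> W j"
    and osc: "\<And>i j x y. i \<in> J \<Longrightarrow> x \<in> W j \<Longrightarrow> y \<in> W j \<Longrightarrow> x \<in> topspace X \<Longrightarrow> y \<in> topspace X
        \<Longrightarrow> \<bar>F i x - F i y\<bar> \<le> \<epsilon>"
    and F: "\<And>i. i \<in> J \<Longrightarrow> continuous_map X euclideanreal (F i)"
    and b: "\<And>i x. i \<in> J \<Longrightarrow> x \<in> topspace X \<Longrightarrow> \<bar>F i x\<bar> \<le> b" and "0 < b" and "0 < \<epsilon>"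
  shows "\<exists>m e. \<forall>i\<in>J. \<bar>\<mu> (F i) - (\<Sum>j<m. F i (w j) * e j)\<bar> \<le> (c + 1) * \<epsilon>"
proof -
  \<comment> \<open>Stage \<open>j\<close> will cost \<open>2 * b * \<delta> j\<close>, and these
    costs add up to at most \<open>\<epsilon> / 2\<close>.\<close>
  define \<delta> where "\<delta> j = \<epsilon> / (8 * b) * (1 / 2) ^ j" for j :: nat
  have \<delta>: "0 < \<delta> j" for j using \<open>0 < b\<close> \<open>0 < \<epsilon>\<close> by (simp add: \<delta>_def)
  define P where "P j = (\<Union>l\<in>{..j}. W l)" for j
  define \<U> where "\<U> j = {u. continuous_map X euclideanreal u \<and> (\<forall>x\<in>topspace X. 0 \<le> u x \<and> u x \<le> 1) \<and>
    (\<forall>x\<in>topspace X \<inter> P j. u x = 1)}" for j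
  have bdd: "bdd_below (tv ` \<U> j)" for j
    by (rule bdd_belowI[of _ 0]) (auto simp: \<U>_def intro!: tv_nonneg)
  have "\<exists>u\<in>\<U> j. tv u \<le> (INF u\<in>\<U> j. tv u) + \<delta> j" for j
  proof -
    have "(\<lambda>x. 1) \<in> \<U> j" by (simp add: \<U>_def)
    then have "tv ` \<U> j \<noteq> {}" by blast
    moreover have "(INF u\<in>\<U> j. tv u) < (INF u\<in>\<U> j. tv u) + \<delta> j" using \<delta> by simp
    ultimately obtain r where "r \<in> tv ` \<U> j" "r < (INF u\<in>\<U> j. tv u) + \<delta> j"
      by (rule cInf_lessD[THEN bexE])
    then show ?thesis by (auto intro: less_imp_le)
  qed
  then obtain u where u: "\<And>j. u j \<in> \<U> j" "\<And>j. tv (u j) \<le> (INF u\<in>\<U> j. tv u) + \<delta> j" by metis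
  have u1: "continuous_map X euclideanreal (u j)" for j using u(1)[of j] by (simp add: \<U>_def)
  have u2: "0 \<le> u j x" "u j x \<le> 1" if "x \<in> topspace X" for j x
    using u(1)[of j] that by (auto simp: \<U>_def)
  have u3: "u j x = 1" if "x \<in> topspace X" "x \<in> P j" for j x
    using u(1)[of j] that by (auto simp: \<U>_def)
  \<comment> \<open>Almost minimality in use: \<open>u j - f\<close> still competes with
    \<open>u j\<close>, so superadditivity leaves at most \<open>\<delta> j\<close> for
    \<open>f\<close>. This stands in for regularity of the variation measure.\<close>
  have small: "tv f \<le> \<delta> j" if f: "continuous_map X euclideanreal f"
    "\<And>x. x \<in> topspace X \<Longrightarrow> 0 \<le> f x" "\<And>x. x \<in> topspace X \<Longrightarrow> f x \<le> u j x"
    "\<And>x. x \<in> topspace X \<inter> P j \<Longrightarrow> f x = 0" for f j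
  proof -
    have d: "continuous_map X euclideanreal (\<lambda>x. u j x - f x)"
      using u1 f(1) by (intro continuous_intros)
    have "u j x - f x \<le> 1" if "x \<in> topspace X" for x
      using f(2)[OF that] u2[OF that, of j] by simp
    then have "(\<lambda>x. u j x - f x) \<in> \<U> j"
      using d f u3 by (auto simp: \<U>_def)
    then have "(INF u\<in>\<U> j. tv u) \<le> tv (\<lambda>x. u j x - f x)"
      using bdd by (intro cINF_lower)
    moreover have "tv (\<lambda>x. u j x - f x) + tv f \<le> tv (\<lambda>x. (u j x - f x) + f x)"
      by (rule tv_superadditive[OF d f(1)]) (use f in auto)
    ultimately show ?thesis using u(2)[of j] by simp
  qed
  \<comment> \<open>Running maxima of the \<open>u j\<close>. They increase to 1 at every point, so
    by compactness one of them is nearly 1 everywhere.\<close>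
  define v where "v = rec_nat (\<lambda>x. 0) (\<lambda>j vj x. max (vj x) (u j x))"
  have v0: "v 0 = (\<lambda>x. 0)" and vS: "v (Suc j) = (\<lambda>x. max (v j x) (u j x))" for j
    by (simp_all add: v_def)
  have v1: "continuous_map X euclideanreal (v j)" for j
    by (induction j) (auto simp: v0 vS intro!: continuous_map_real_max u1)
  have v2: "0 \<le> v j x \<and> v j x \<le> 1" if "x \<in> topspace X" for j x
    by (induction j) (use u2[OF that] in \<open>auto simp: v0 vS max_def\<close>)
  have v3: "v j x = 1" if "x \<in> topspace X" "x \<in> W l" "l < j" for j l x
    using that(3)
  proof (induction j)
    case (Suc j)
    have "v j x \<le> 1" "u j x \<le> 1" using v2 u2 that by auto
    moreover have "u j x = 1 \<or> v j x = 1"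
    proof (cases "l = j")
      case True
      then show ?thesis using u3[of x j] that by (auto simp: P_def)
    qed (use Suc in auto)
    ultimately show ?case by (auto simp: vS)
  qed simp
  have v4: "v j x \<le> v k x" if "j \<le> k" for j k x
    by (rule lift_Suc_mono_le[OF _ that, of "\<lambda>j. v j x"]) (simp add: vS)
  \<comment> \<open>Makes \<open>c * (b * \<eta>)\<close>, the cost of stopping at stage
    \<open>m\<close>, at most \<open>\<epsilon> / 2\<close>.\<close>
  define \<eta> where "\<eta> = \<epsilon> / (2 * b * (c + 1))"
  have \<eta>: "0 < \<eta>" using \<open>0 < b\<close> \<open>0 < \<epsilon>\<close> bound_nonneg by (simp add: \<eta>_def)
  obtain m where m: "\<And>x. x \<in> topspace X \<Longrightarrow> 1 - \<eta> < v m x"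
  proof -
    define O' where "O' j = {x \<in> topspace X. v j x \<in> {1 - \<eta><..}}" for j
    have op: "openin X (O' j)" for j
      unfolding O'_def by (rule openin_continuous_map_preimage[OF v1]) simp
    have "\<exists>j. x \<in> O' j" if "x \<in> topspace X" for x
    proof -
      obtain l where "x \<in> W l" using W \<open>x \<in> topspace X\<close> by blast
      then have "v (Suc l) x = 1" using v3 that by blast
      then have "x \<in> O' (Suc l)" using \<eta> that by (simp add: O'_def)
      then show ?thesis ..
    qed
    then have "topspace X \<subseteq> \<Union>(range O')" by blast
    then obtain \<F> where F: "finite \<F>" "\<F> \<subseteq> range O'" "topspace X \<subseteq> \<Union>\<F>"
      using compact[unfolded compact_space_alt, rule_format, of "range O'"] op by blast
    then obtain S where S: "finite S" "\<F> = O' ` S"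
      using finite_subset_image by metis
    obtain m where "\<And>j. j \<in> S \<Longrightarrow> j \<le> m"
      using S(1) finite_nat_set_iff_bounded_le by auto
    then have "1 - \<eta> < v m x" if "x \<in> topspace X" for x
    proof -
      obtain j where "j \<in> S" "x \<in> O' j" using F(3) S(2) \<open>x \<in> topspace X\<close> by blast
      then show ?thesis using v4[of j m x] \<open>\<And>j. j \<in> S \<Longrightarrow> j \<le> m\<close>[of j] by (auto simp: O'_def)
    qed
    then show ?thesis using that by blast
  qed
  \<comment> \<open>The increments act as indicator functions of the disjointed sets: they sum to
    \<open>v m\<close>, are dominated by the \<open>u j\<close>, and vanish on the earlier
    \<open>W l\<close>.\<close>
  define e where "e j x = v (Suc j) x - v j x" for j x
  have e1: "continuous_map X euclideanreal (e j)" for j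
    unfolding e_def using v1 by (intro continuous_intros)
  have e2: "0 \<le> e j x" for j x by (simp add: e_def vS)
  have e3: "e j x \<le> u j x" if "x \<in> topspace X" for j x
    using v2[OF that, of j] u2[OF that, of j] by (simp add: e_def vS max_def)
  have e4: "e j x = 0" if "x \<in> topspace X" "x \<in> W l" "l < j" for j l x
    using v3[OF that(1,2), of j] v3[OF that(1,2), of "Suc j"] that(3) by (simp add: e_def)
  have e5: "(\<Sum>j<k. e j x) = v k x" for k x
    by (induction k) (simp_all add: v0 e_def)
  have "\<bar>\<mu> (F i) - (\<Sum>j<m. F i (w j) * \<mu> (e j))\<bar> \<le> (c + 1) * \<epsilon>" if i: "i \<in> J" for i
  proof -
    \<comment> \<open>The part of the oscillation that exceeds \<open>\<epsilon>\<close>. It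
      vanishes on \<open>W j\<close> by \<open>osc\<close> and on the earlier \<open>W l\<close>
      because \<open>e j\<close> does, so \<open>small\<close> applies to it after division by
      \<open>2 * b\<close>.\<close>
    define k where "k j x = max 0 (\<bar>F i x - F i (w j)\<bar> - \<epsilon>) * e j x" for j x
    note Fi = F[OF i]
    have k1: "continuous_map X euclideanreal (k j)" for j
      unfolding k_def using Fi e1
      by (intro continuous_map_real_mult continuous_map_real_max continuous_map_real_abs continuous_intros)
         auto
    have k2: "0 \<le> k j x" for j x using e2 by (simp add: k_def)
    have k3: "k j x = 0" if x: "x \<in> topspace X \<inter> P j" for j x
    proof -
      obtain l where l: "l \<le> j" "x \<in> W l" using x by (auto simp: P_def)
      show ?thesis
      proof (cases "l = j")
        case True
        then have "w j \<in> W j" using w(2)[of j] l that by blast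
        then have "\<bar>F i x - F i (w j)\<bar> \<le> \<epsilon>"
          using osc[OF i, of x j "w j"] l True that w(1) by blast
        then show ?thesis by (simp add: k_def)
      qed (use e4[of x l j] l that in \<open>auto simp: k_def\<close>)
    qed
    have k4: "k j x \<le> 2 * b * u j x" if "x \<in> topspace X" for j x
    proof -
      have "max 0 (\<bar>F i x - F i (w j)\<bar> - \<epsilon>) \<le> 2 * b"
        using b[OF i that] b[OF i w(1), of j] \<open>0 < b\<close> \<open>0 < \<epsilon>\<close> by auto
      then show ?thesis
        unfolding k_def using e2[of j x] e3[OF that, of j] u2(1)[OF that, of j] \<open>0 < b\<close>
        by (intro mult_mono) auto
    qed
    have k5: "tv (k j) \<le> 2 * b * \<delta> j" for j
    proof -
      have *: "continuous_map X euclideanreal (\<lambda>x. 1 / (2 * b) * k j x)"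
        using k1 by (intro continuous_map_real_mult) auto
      have "tv (\<lambda>x. 1 / (2 * b) * k j x) \<le> \<delta> j"
      proof (rule small[OF *])
        show "1 / (2 * b) * k j x \<le> u j x" if "x \<in> topspace X" for x
          using k4[OF that, of j] \<open>0 < b\<close> by (simp add: field_simps)
      qed (use k2 k3 \<open>0 < b\<close> in auto)
      moreover have "tv (\<lambda>x. 2 * b * (1 / (2 * b) * k j x)) \<le> 2 * b * tv (\<lambda>x. 1 / (2 * b) * k j x)"
        by (rule tv_scale_le[OF *]) (use k2 \<open>0 < b\<close> in auto)
      moreover have "(\<lambda>x. 2 * b * (1 / (2 * b) * k j x)) = k j"
        using \<open>0 < b\<close> by (simp add: fun_eq_iff)
      moreover have "2 * b * tv (\<lambda>x. 1 / (2 * b) * k j x) \<le> 2 * b * \<delta> j"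
        using calculation(1) \<open>0 < b\<close> by (intro mult_left_mono) auto
      ultimately show ?thesis by simp
    qed
    define R where "R x = (\<Sum>j<m. (F i x - F i (w j)) * e j x)" for x
    have R1: "continuous_map X euclideanreal R"
      unfolding R_def using Fi e1
      by (intro continuous_map_sum continuous_map_real_mult continuous_intros) auto
    have k6: "continuous_map X euclideanreal (\<lambda>x. \<Sum>j<m. k j x)"
      using k1 by (intro continuous_map_sum) auto
    have k7: "continuous_map X euclideanreal (\<lambda>x. \<epsilon> + (\<Sum>j<m. k j x))"
      using continuous_map_add[OF _ k6, of "\<lambda>x. \<epsilon>"] by simp
    have "\<bar>\<mu> R\<bar> \<le> tv (\<lambda>x. \<epsilon> + (\<Sum>j<m. k j x))"
    proof (rule abs_le_tv[OF k7 R1])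
      fix x assume x: "x \<in> topspace X"
      have "\<bar>R x\<bar> \<le> (\<Sum>j<m. \<bar>(F i x - F i (w j)) * e j x\<bar>)"
        unfolding R_def by (rule sum_abs)
      also have "\<dots> \<le> (\<Sum>j<m. \<epsilon> * e j x + k j x)"
      proof (rule sum_mono)
        fix j
        have "\<bar>F i x - F i (w j)\<bar> * e j x \<le> (\<epsilon> + max 0 (\<bar>F i x - F i (w j)\<bar> - \<epsilon>)) * e j x"
          by (rule mult_right_mono) (use e2 in auto)
        then show "\<bar>(F i x - F i (w j)) * e j x\<bar> \<le> \<epsilon> * e j x + k j x"
          using e2[of j x] by (simp add: abs_mult k_def distrib_right)
      qed
      also have "\<dots> = \<epsilon> * v m x + (\<Sum>j<m. k j x)"
        by (simp add: sum.distrib flip: sum_distrib_left e5)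
      also have "\<dots> \<le> \<epsilon> * 1 + (\<Sum>j<m. k j x)"
        using v2[OF x] \<open>0 < \<epsilon>\<close> by (intro add_right_mono mult_left_mono) auto
      finally show "\<bar>R x\<bar> \<le> \<epsilon> + (\<Sum>j<m. k j x)" by simp
    qed
    also have "\<dots> \<le> tv (\<lambda>x. \<epsilon>) + tv (\<lambda>x. \<Sum>j<m. k j x)"
      by (rule tv_subadditive) (use k6 k2 \<open>0 < \<epsilon>\<close> in \<open>auto intro: sum_nonneg\<close>)
    also have "\<dots> \<le> c * \<epsilon> + (\<Sum>j<m. 2 * b * \<delta> j)"
    proof (rule add_mono)
      show "tv (\<lambda>x. \<epsilon>) \<le> c * \<epsilon>"
        by (rule tv_le_bound) (use \<open>0 < \<epsilon>\<close> in auto)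
      have "tv (\<lambda>x. \<Sum>j<m. k j x) \<le> (\<Sum>j<m. tv (k j))"
        by (rule tv_sum_le) (use k1 k2 in auto)
      also have "\<dots> \<le> (\<Sum>j<m. 2 * b * \<delta> j)" by (rule sum_mono) (rule k5)
      finally show "tv (\<lambda>x. \<Sum>j<m. k j x) \<le> (\<Sum>j<m. 2 * b * \<delta> j)" .
    qed
    also have "(\<Sum>j<m. 2 * b * \<delta> j) = \<epsilon> / 4 * (\<Sum>j<m. (1 / 2) ^ j)"
      using \<open>0 < b\<close> by (simp add: \<delta>_def sum_distrib_left)
    also have "(\<Sum>j<m. (1 / 2 :: real) ^ j) \<le> 2"
      by (subst geometric_sum) (auto simp: field_simps)
    finally have R2: "\<bar>\<mu> R\<bar> \<le> c * \<epsilon> + \<epsilon> / 2" using \<open>0 < \<epsilon>\<close> by simp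
    \<comment> \<open>\<open>F i\<close> is \<open>Q + R\<close> plus the combination of the
      \<open>e j\<close>: \<open>R\<close> is the error of replacing \<open>F i x\<close> by
      \<open>F i (w j)\<close>, and \<open>Q\<close> is the loss from using \<open>v m\<close>
      instead of 1.\<close>
    define Q where "Q x = F i x * (1 - v m x)" for x
    have Q1: "continuous_map X euclideanreal Q"
      unfolding Q_def using Fi v1 by (intro continuous_map_real_mult continuous_intros) auto
    have "\<bar>\<mu> Q\<bar> \<le> c * (b * \<eta>)"
    proof (rule bounded[OF Q1])
      fix x assume x: "x \<in> topspace X"
      show "\<bar>Q x\<bar> \<le> b * \<eta>"
        unfolding Q_def abs_mult using b[OF i x] m[OF x] v2[OF x, of m] \<open>0 < b\<close>
        by (intro mult_mono) auto
    qed (use \<eta> \<open>0 < b\<close> in auto)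
    also have "b * \<eta> = \<epsilon> / (2 * (c + 1))"
      using \<open>0 < b\<close> by (simp add: \<eta>_def)
    also have "c * (\<epsilon> / (2 * (c + 1))) = c / (c + 1) * (\<epsilon> / 2)"
      by simp
    also have "\<dots> \<le> 1 * (\<epsilon> / 2)"
      using bound_nonneg \<open>0 < \<epsilon>\<close> by (intro mult_right_mono) auto
    finally have Q2: "\<bar>\<mu> Q\<bar> \<le> \<epsilon> / 2" by simp
    have E1: "continuous_map X euclideanreal (\<lambda>x. \<Sum>j<m. F i (w j) * e j x)"
      using e1 by (intro continuous_map_sum continuous_map_real_mult) auto
    have "F i x = (Q x + R x) + (\<Sum>j<m. F i (w j) * e j x)" for x
    proof -
      have "F i x * v m x = (\<Sum>j<m. F i x * e j x)" by (simp add: sum_distrib_left flip: e5)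
      then show ?thesis
        by (simp add: Q_def R_def left_diff_distrib sum_subtractf algebra_simps)
    qed
    then have "\<mu> (F i) = \<mu> (\<lambda>x. (Q x + R x) + (\<Sum>j<m. F i (w j) * e j x))"
      using cong[OF Fi continuous_map_add[OF continuous_map_add[OF Q1 R1] E1]] by blast
    also have "\<dots> = \<mu> Q + \<mu> R + (\<Sum>j<m. F i (w j) * \<mu> (e j))"
      using add[OF continuous_map_add[OF Q1 R1] E1] add[OF Q1 R1] sum[of "{..<m}" e "\<lambda>j. F i (w j)"] e1
      by simp
    finally show ?thesis using Q2 R2 by (simp add: distrib_right)
  qed
  then show ?thesis by (intro exI[of _ m] exI[of _ "\<lambda>j. \<mu> (e j)"] ballI)
qed

end

end

text \<open>The evaluation points \<open>w j\<close> are the same for all \<open>y\<close>, so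
  \<open>y\<close> enters the approximation only through finitely many coefficients. With rational
  coefficients there are countably many combinations, and the points sharing one of them form a set
  of small oscillation. Each such point is within \<open>(c + 2) * \<epsilon>\<close> of the
  combination, one \<open>\<epsilon>\<close> being spent on rounding.\<close>

lemma countably_small_functionals:
  fixes F :: "'j \<Rightarrow> 'a \<Rightarrow> real" and \<mu> :: "'y \<Rightarrow> ('a \<Rightarrow> real) \<Rightarrow> real"
  assumes X: "compact_space X" and \<mu>: "\<And>y. y \<in> Y \<Longrightarrow> bounded_functional X c (\<mu> y)"
    and small: "countably_small (topspace X) J F \<epsilon>" and "0 < \<epsilon>"
    and F: "\<And>i. i \<in> J \<Longrightarrow> continuous_map X euclideanreal (F i)"
    and b: "\<And>i x. i \<in> J \<Longrightarrow> x \<in> topspace X \<Longrightarrow> \<bar>F i x\<bar> \<le> b"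
  shows "countably_small Y J (\<lambda>i y. \<mu> y (F i)) (2 * (c + 2) * \<epsilon>)"
proof (cases "Y = {}")
  case True
  then show ?thesis by (auto simp: countably_small_def)
next
  case Y: False
  then have "0 \<le> c" using \<mu> bounded_functional.bound_nonneg by blast
  show ?thesis
  proof (cases "topspace X = {}")
    case True
    have "\<mu> y (F i) = 0" if "y \<in> Y" "i \<in> J" for y i
      using bounded_functional.bounded[OF \<mu>[OF that(1)] F[OF that(2)], of 0] True by simp
    then show ?thesis using \<open>0 < \<epsilon>\<close> \<open>0 \<le> c\<close> by (intro countably_smallI[of "{Y}"]) auto
  next
    case False
    define b' where "b' = max b 1"
    have b': "0 < b'" "\<And>i x. i \<in> J \<Longrightarrow> x \<in> topspace X \<Longrightarrow> \<bar>F i x\<bar> \<le> b'"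
      using b by (auto simp: b'_def intro: le_max_iff_disj[THEN iffD2])
    obtain W :: "nat \<Rightarrow> 'a set" where W: "topspace X \<subseteq> (\<Union>n. W n)"
      "\<And>n x y i. x \<in> W n \<Longrightarrow> y \<in> W n \<Longrightarrow> x \<in> topspace X \<Longrightarrow> y \<in> topspace X \<Longrightarrow> i \<in> J \<Longrightarrow> \<bar>F i x - F i y\<bar> \<le> \<epsilon>"
      by (rule countably_smallE[OF small], rule that) auto
    have "\<exists>w. w \<in> topspace X \<and> (W j \<inter> topspace X \<noteq> {} \<longrightarrow> w \<in> W j)" for j
      using False by blast
    then obtain w where w: "\<And>j. w j \<in> topspace X" "\<And>j. W j \<inter> topspace X \<noteq> {} \<Longrightarrow> w j \<in> W j"
      by metis
    define ev where "ev qs i = (\<Sum>j<length qs. F i (w j) * of_rat (qs ! j))" for qs :: "rat list" and i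
    define V where "V qs = {y. \<forall>i\<in>J. \<bar>\<mu> y (F i) - ev qs i\<bar> \<le> (c + 2) * \<epsilon>}" for qs
    have "\<exists>qs. y \<in> V qs" if y: "y \<in> Y" for y
    proof -
      interpret bounded_functional X c "\<mu> y" by (rule \<mu>[OF y])
      have "\<exists>m e. \<forall>i\<in>J. \<bar>\<mu> y (F i) - (\<Sum>j<m. F i (w j) * e j)\<bar> \<le> (c + 1) * \<epsilon>"
        by (rule approximate_by_point_evaluations[OF X W(1) w _ F b'(2) b'(1) \<open>0 < \<epsilon>\<close>]) (use W(2) in auto)
      then obtain m e where e: "\<And>i. i \<in> J \<Longrightarrow> \<bar>\<mu> y (F i) - (\<Sum>j<m. F i (w j) * e j)\<bar> \<le> (c + 1) * \<epsilon>"
        by blast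
      define \<eta> where "\<eta> = \<epsilon> / (b' * (real m + 1))"
      have "0 < \<eta>" using \<open>0 < \<epsilon>\<close> b' by (simp add: \<eta>_def)
      have "b' * \<eta> = \<epsilon> / (real m + 1)" using b'(1) by (simp add: \<eta>_def)
      have "\<exists>q. \<bar>e j - of_rat q\<bar> < \<eta>" for j
        using of_rat_dense[of "e j" "e j + \<eta>"] \<open>0 < \<eta>\<close> by (smt (verit))
      then obtain q where q: "\<And>j. \<bar>e j - of_rat (q j)\<bar> < \<eta>" by metis
      have "\<bar>\<mu> y (F i) - ev (map q [0..<m]) i\<bar> \<le> (c + 2) * \<epsilon>" if i: "i \<in> J" for i
      proof -
        have "\<bar>(\<Sum>j<m. F i (w j) * e j) - ev (map q [0..<m]) i\<bar> = \<bar>\<Sum>j<m. F i (w j) * (e j - of_rat (q j))\<bar>"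
          by (simp add: ev_def sum_subtractf right_diff_distrib)
        also have "\<dots> \<le> (\<Sum>j<m. \<bar>F i (w j) * (e j - of_rat (q j))\<bar>)" by (rule sum_abs)
        also have "\<dots> \<le> (\<Sum>j<m. b' * \<eta>)"
          unfolding abs_mult using b'(2)[OF i w(1)] q b'(1)
          by (intro sum_mono mult_mono) (auto intro: less_imp_le)
        also have "\<dots> = real m / (real m + 1) * \<epsilon>"
          using \<open>b' * \<eta> = \<epsilon> / (real m + 1)\<close> by simp
        also have "\<dots> \<le> 1 * \<epsilon>" using \<open>0 < \<epsilon>\<close> by (intro mult_right_mono) auto
        finally show ?thesis using e[OF i] by (simp add: distrib_right)
      qed
      then show ?thesis by (auto simp: V_def)
    qed
    show ?thesis
    proof (rule countably_smallI)
      show "countable (range V)" by simp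
      show "Y \<subseteq> \<Union>(range V)" using \<open>\<And>y. y \<in> Y \<Longrightarrow> \<exists>qs. y \<in> V qs\<close> by blast
      fix S y y' i assume "S \<in> range V" "y \<in> S" "y' \<in> S" "i \<in> J"
      then obtain qs where "\<bar>\<mu> y (F i) - ev qs i\<bar> \<le> (c + 2) * \<epsilon>" "\<bar>\<mu> y' (F i) - ev qs i\<bar> \<le> (c + 2) * \<epsilon>"
        by (auto simp: V_def)
      then show "\<bar>\<mu> y (F i) - \<mu> y' (F i)\<bar> \<le> 2 * (c + 2) * \<epsilon>"
        unfolding mult.assoc by linarith
    qed
  qed
qed

section \<open>Fragmentation\<close>

lemma no_inj_branches_nat: "\<not> inj (f :: (nat \<Rightarrow> bool) \<Rightarrow> nat)"
proof
  assume "inj f"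
  define d where "d n = (\<not> inv f n n)" for n
  have "inv f (f d) = d" using \<open>inj f\<close> by simp
  then have "inv f (f d) (f d) = d (f d)" by simp
  then show False by (simp add: d_def)
qed

text \<open>
  A Cantor scheme: if there is no such \<open>U\<close>, countably many of the functions separate
  the branches of a binary tree by more than \<open>\<epsilon>\<close>.
\<close>

lemma countably_small_imp_fragmented:
  fixes F :: "'j \<Rightarrow> 'a \<Rightarrow> real"
  assumes X: "compact_space X" and Y: "closedin X Y" "Y \<noteq> {}"
    and F: "\<And>i. i \<in> J \<Longrightarrow> continuous_map X euclideanreal (F i)"
    and small: "\<And>J'. countable J' \<Longrightarrow> J' \<subseteq> J \<Longrightarrow> countably_small (topspace X) J' F \<epsilon>"
  shows "\<exists>U. openin X U \<and> U \<inter> Y \<noteq> {} \<and> (\<forall>i\<in>J. \<forall>x\<in>U \<inter> Y. \<forall>y\<in>U \<inter> Y. \<bar>F i x - F i y\<bar> \<le> \<epsilon>)"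
proof (rule ccontr)
  assume neg: "\<not> ?thesis"
  \<comment> \<open>Two thresholds more than \<open>\<epsilon>\<close> apart are recorded, not two
    values: weak inequalities with them define closed sets and still separate by more than
    \<open>\<epsilon>\<close>.\<close>
  have "\<exists>i r r'. i \<in> J \<and> \<epsilon> < r' - r \<and> (\<exists>x\<in>U \<inter> Y. F i x < r) \<and> (\<exists>y\<in>U \<inter> Y. r' < F i y)"
    if U: "openin X U" "U \<inter> Y \<noteq> {}" for U
  proof -
    have "\<exists>i\<in>J. \<exists>x\<in>U \<inter> Y. \<exists>y\<in>U \<inter> Y. \<epsilon> < F i y - F i x"
    proof -
      obtain i x y where "i \<in> J" "x \<in> U \<inter> Y" "y \<in> U \<inter> Y" "\<not> \<bar>F i x - F i y\<bar> \<le> \<epsilon>"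
        using neg U by blast
      moreover then have "\<epsilon> < F i y - F i x \<or> \<epsilon> < F i x - F i y" by linarith
      ultimately show ?thesis by blast
    qed
    then obtain i x y where xy: "i \<in> J" "x \<in> U \<inter> Y" "y \<in> U \<inter> Y" "\<epsilon> < F i y - F i x" by blast
    define d where "d = (F i y - F i x - \<epsilon>) / 3"
    have d: "0 < d" "3 * d = F i y - F i x - \<epsilon>" using xy by (simp_all add: d_def)
    show ?thesis
    proof (rule exI[of _ i], rule exI[of _ "F i x + d"], rule exI[of _ "F i y - d"], intro conjI)
      show "\<epsilon> < (F i y - d) - (F i x + d)" using d by linarith
      show "\<exists>x'\<in>U \<inter> Y. F i x' < F i x + d" using xy d by (intro bexI[of _ x]) auto
      show "\<exists>y'\<in>U \<inter> Y. F i y - d < F i y'" using xy d by (intro bexI[of _ y]) auto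
    qed (use xy in auto)
  qed
  then have "\<exists>I R R'. \<forall>U. openin X U \<longrightarrow> U \<inter> Y \<noteq> {} \<longrightarrow> I U \<in> J \<and> \<epsilon> < R' U - R U \<and>
      (\<exists>x\<in>U \<inter> Y. F (I U) x < R U) \<and> (\<exists>y\<in>U \<inter> Y. R' U < F (I U) y)"
    by metis
  then obtain I R R' where split: "\<And>U. openin X U \<Longrightarrow> U \<inter> Y \<noteq> {} \<Longrightarrow> I U \<in> J \<and> \<epsilon> < R' U - R U \<and>
      (\<exists>x\<in>U \<inter> Y. F (I U) x < R U) \<and> (\<exists>y\<in>U \<inter> Y. R' U < F (I U) y)"
    by blast
  \<comment> \<open>Nodes are lists with the latest decision at the head, so
    \<open>pre \<beta> n\<close> will be the reversed initial segment of the branch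
    \<open>\<beta>\<close>.\<close>
  define V where "V = rec_list (topspace X) (\<lambda>b (s :: bool list) U.
    if b then U \<inter> {x \<in> topspace X. F (I U) x \<in> {R' U<..}} else U \<inter> {x \<in> topspace X. F (I U) x \<in> {..<R U}})"
  have V0: "V [] = topspace X" by (simp add: V_def)
  have V1: "V (b # s) = (if b then V s \<inter> {x \<in> topspace X. F (I (V s)) x \<in> {R' (V s)<..}}
      else V s \<inter> {x \<in> topspace X. F (I (V s)) x \<in> {..<R (V s)}})" for b s
    by (simp add: V_def)
  have V: "openin X (V s) \<and> V s \<inter> Y \<noteq> {}" for s
  proof (induction s)
    case Nil
    then show ?case using Y closedin_subset by (fastforce simp: V0)
  next
    case (Cons b s)
    note sp = split[OF Cons[THEN conjunct1] Cons[THEN conjunct2]]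
    then have c: "continuous_map X euclideanreal (F (I (V s)))" using F by blast
    have op: "openin X {x \<in> topspace X. F (I (V s)) x \<in> S}" if "open S" for S
      by (rule openin_continuous_map_preimage[OF c]) (use that in simp)
    from op[of "{R' (V s)<..}"] op[of "{..<R (V s)}"]
    have "openin X (V (b # s))" unfolding V1 using Cons by (cases b) (simp_all add: openin_Int)
    moreover have "V (b # s) \<inter> Y \<noteq> {}"
      using sp Y closedin_subset by (cases b) (fastforce simp: V1)+
    ultimately show ?case by blast
  qed
  note VI = split[OF V[THEN conjunct1] V[THEN conjunct2]]
  define pre where "pre \<beta> = rec_nat [] (\<lambda>n s. \<beta> n # s)" for \<beta> :: "nat \<Rightarrow> bool"
  have pre0: "pre \<beta> 0 = []" and preS: "pre \<beta> (Suc n) = \<beta> n # pre \<beta> n" for \<beta> n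
    by (simp_all add: pre_def)
  \<comment> \<open>Closed relaxation of the decision at level \<open>k\<close>. The open sets
    \<open>V (pre \<beta> n)\<close> provide nonempty finite intersections, the sets
    \<open>D \<beta> k\<close> closedness, and so every branch has a point.\<close>
  define D where "D \<beta> k = (let U = V (pre \<beta> k) in
     {x \<in> topspace X. F (I U) x \<in> (if \<beta> k then {R' U..} else {..R U})})" for \<beta> k
  have D: "closedin X (D \<beta> k)" for \<beta> k
    unfolding D_def Let_def using VI F by (intro closedin_continuous_map_preimage[of X euclideanreal]) auto
  have VD: "V (pre \<beta> n) \<subseteq> D \<beta> k" if "k < n" for \<beta> k n
    using that by (induction n) (auto simp: preS V1 D_def Let_def less_Suc_eq)
  have "\<exists>y\<in>Y. \<forall>k. y \<in> D \<beta> k" for \<beta>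
  proof -
    have "(\<Inter>n. Y \<inter> (\<Inter>k\<in>{..<n}. D \<beta> k)) \<noteq> {}"
    proof (rule compact_space_imp_nest[OF X])
      show "closedin X (Y \<inter> (\<Inter>k\<in>{..<n}. D \<beta> k))" for n
        by (cases n) (use Y D in \<open>auto intro!: closedin_Int closedin_Inter\<close>)
      show "Y \<inter> (\<Inter>k\<in>{..<n}. D \<beta> k) \<noteq> {}" for n
        using V[of "pre \<beta> n"] VD[of _ n \<beta>] by blast
      show "decseq (\<lambda>n. Y \<inter> (\<Inter>k\<in>{..<n}. D \<beta> k))"
        by (auto simp: decseq_def)
    qed
    then show ?thesis by blast
  qed
  then obtain p where p: "\<And>\<beta>. p \<beta> \<in> Y" "\<And>\<beta> k. p \<beta> \<in> D \<beta> k" by metis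
  \<comment> \<open>One function per node: this is why a hypothesis on countable subsets of
    \<open>J\<close> suffices.\<close>
  have "countable (range (\<lambda>s. I (V s)))" by simp
  moreover have "range (\<lambda>s. I (V s)) \<subseteq> J" using VI by blast
  ultimately have sm: "countably_small (topspace X) (range (\<lambda>s. I (V s))) F \<epsilon>" by (rule small)
  obtain W :: "nat \<Rightarrow> 'a set" where W: "topspace X \<subseteq> (\<Union>n. W n)"
    "\<And>n x y i. x \<in> W n \<Longrightarrow> y \<in> W n \<Longrightarrow> x \<in> topspace X \<Longrightarrow> y \<in> topspace X \<Longrightarrow> i \<in> range (\<lambda>s. I (V s))
      \<Longrightarrow> \<bar>F i x - F i y\<bar> \<le> \<epsilon>"
    by (rule countably_smallE[OF sm], rule that) auto
  have pX: "p \<beta> \<in> topspace X" for \<beta> using p(1) Y(1) closedin_subset by blast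
  then have "\<exists>n. p \<beta> \<in> W n" for \<beta> using W(1) by blast
  then obtain n where n: "\<And>\<beta>. p \<beta> \<in> W (n \<beta>)" by metis
  obtain \<beta> \<gamma> where bc: "\<beta> \<noteq> \<gamma>" "n \<beta> = n \<gamma>" using no_inj_branches_nat[of n] by (auto simp: inj_def)
  then have "\<exists>k. \<beta> k \<noteq> \<gamma> k" by auto
  define k where "k = (LEAST k. \<beta> k \<noteq> \<gamma> k)"
  have k: "\<beta> k \<noteq> \<gamma> k" unfolding k_def using \<open>\<exists>k. \<beta> k \<noteq> \<gamma> k\<close> by (rule LeastI_ex)
  have "pre \<beta> j = pre \<gamma> j" if "j \<le> k" for j
    using that
  proof (induction j)
    case (Suc j)
    then have "\<beta> j = \<gamma> j" using not_less_Least[of j "\<lambda>k. \<beta> k \<noteq> \<gamma> k"] by (auto simp: k_def)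
    with Suc show ?case by (simp add: preS)
  qed (simp add: pre0)
  then have eq: "pre \<beta> k = pre \<gamma> k" by simp
  \<comment> \<open>The last common node: its function is at most \<open>R U\<close> at one of the
    two points and at least \<open>R' U\<close> at the other, although both lie in the same set
    \<open>W n\<close>.\<close>
  define U where "U = V (pre \<beta> k)"
  have "\<epsilon> < R' U - R U" using VI by (simp add: U_def)
  moreover have "\<bar>F (I U) (p \<beta>) - F (I U) (p \<gamma>)\<bar> \<le> \<epsilon>"
    using W(2)[of "p \<beta>" "n \<beta>" "p \<gamma>" "I U"] n[of \<beta>] n[of \<gamma>] bc(2) pX by (simp add: U_def)
  ultimately show False
    using p(2)[of \<beta> k] p(2)[of \<gamma> k] k eq by (auto simp: D_def Let_def U_def split: if_splits)
qed

section \<open>Finite-to-one colourings\<close>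

unbundle cardinal_syntax

section \<open>Cardinality of closures under countable-valued operations\<close>

lemma countable_ordLeq_infinite:
  assumes "countable A" "infinite B"
  shows "|A| \<le>o |B|"
proof -
  have "|A| \<le>o |UNIV :: nat set|"
    using assms(1) by (auto simp: countable_def intro: card_of_ordLeqI)
  moreover have "|UNIV :: nat set| \<le>o |B|"
    using assms(2) infinite_iff_card_of_nat by blast
  ultimately show ?thesis by (rule ordLeq_transitive)
qed

lemma card_of_Un_ordLeq_infinite':
  assumes "infinite C" "|A| \<le>o |C|" "|B| \<le>o |C|"
  shows "|A \<union> B| \<le>o |C|"
proof -
  have "|\<Union>i\<in>UNIV. if i then A else B| \<le>o |C|"
  proof (rule card_of_UNION_ordLeq_infinite[OF assms(1)])
    show "|UNIV :: bool set| \<le>o |C|" by (rule countable_ordLeq_infinite[OF _ assms(1)]) simp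
  qed (use assms in simp)
  then show ?thesis by (simp add: UNIV_bool Un_commute)
qed

lemma card_of_lists_ordLeq_infinite:
  assumes "infinite B" "|A| \<le>o |B|"
  shows "|lists A| \<le>o |B|"
proof -
  have n: "|{l \<in> lists A. length l = n}| \<le>o |B|" for n
  proof (induction n)
    case 0
    have "{l \<in> lists A. length l = 0} = {[]}" by auto
    then show ?case using countable_ordLeq_infinite[OF _ assms(1), of "{[]}"] by simp
  next
    case (Suc n)
    have "{l \<in> lists A. length l = Suc n} \<subseteq> (\<Union>x\<in>A. (#) x ` {l \<in> lists A. length l = n})"
    proof
      fix l assume "l \<in> {l \<in> lists A. length l = Suc n}"
      then obtain x l' where "l = x # l'" "x \<in> A" "l' \<in> {l \<in> lists A. length l = n}"
        by (cases l) auto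
      then show "l \<in> (\<Union>x\<in>A. (#) x ` {l \<in> lists A. length l = n})" by blast
    qed
    moreover have "|\<Union>x\<in>A. (#) x ` {l \<in> lists A. length l = n}| \<le>o |B|"
      by (intro card_of_UNION_ordLeq_infinite[OF assms] ballI ordLeq_transitive[OF card_of_image Suc])
    ultimately show ?case by (rule ordLeq_transitive[OF card_of_mono1])
  qed
  have "lists A = (\<Union>n. {l \<in> lists A. length l = n})" by auto
  moreover have "|\<Union>n. {l \<in> lists A. length l = n}| \<le>o |B|"
    by (rule card_of_UNION_ordLeq_infinite[OF assms(1)])
       (use assms(1) infinite_iff_card_of_nat n in auto)
  ultimately show ?thesis by simp
qed

text \<open>\<open>g l\<close> is the countable set of elements forbidden after the finite sequence
  \<open>l\<close>. Closed sets take the place of elementary submodels: an element outside a closed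
  set is legal after every sequence from it.\<close>

definition closed_under :: "('i list \<Rightarrow> 'i set) \<Rightarrow> 'i set \<Rightarrow> bool" where
  "closed_under g Z \<longleftrightarrow> (\<forall>l\<in>lists Z. g l \<subseteq> Z)"

definition closure_under :: "('i list \<Rightarrow> 'i set) \<Rightarrow> 'i set \<Rightarrow> 'i set" where
  "closure_under g Y = \<Inter>{Z. Y \<subseteq> Z \<and> closed_under g Z}"

lemma closure_under_superset: "Y \<subseteq> closure_under g Y"
  by (auto simp: closure_under_def)

lemma closed_under_closure: "closed_under g (closure_under g Y)"
  unfolding closed_under_def
proof
  fix l assume l: "l \<in> lists (closure_under g Y)"
  have "g l \<subseteq> Z" if Z: "Y \<subseteq> Z" "closed_under g Z" for Z
  proof -
    have "closure_under g Y \<subseteq> Z" using Z by (auto simp: closure_under_def)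
    then have "l \<in> lists Z" using l lists_mono by blast
    then show ?thesis using Z(2) by (simp add: closed_under_def)
  qed
  then show "g l \<subseteq> closure_under g Y" by (auto simp: closure_under_def)
qed

lemma closure_under_least: "Y \<subseteq> Z \<Longrightarrow> closed_under g Z \<Longrightarrow> closure_under g Y \<subseteq> Z"
  by (auto simp: closure_under_def)

lemma closure_under_mono: "Y \<subseteq> Y' \<Longrightarrow> closure_under g Y \<subseteq> closure_under g Y'"
  by (auto simp: closure_under_def)

text \<open>The arguments of \<open>g\<close> are finite lists, so a list from the union of the
  increasing stages already lies in one of them, and countably many stages reach the
  closure.\<close>

lemma card_of_closure_under:
  assumes g: "\<And>l. countable (g l)" and B: "infinite B" "|Y| \<le>o |B|"
  shows "|closure_under g Y| \<le>o |B|"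
proof -
  define L where "L = rec_nat Y (\<lambda>n Z. Z \<union> (\<Union>l\<in>lists Z. g l))"
  have L0: "L 0 = Y" and LS: "L (Suc n) = L n \<union> (\<Union>l\<in>lists (L n). g l)" for n
    by (simp_all add: L_def)
  have card: "|L n| \<le>o |B|" for n
  proof (induction n)
    case (Suc n)
    have "|\<Union>l\<in>lists (L n). g l| \<le>o |B|"
      by (intro card_of_UNION_ordLeq_infinite[OF B(1)] card_of_lists_ordLeq_infinite[OF B(1) Suc]
          ballI countable_ordLeq_infinite[OF g B(1)])
    with Suc show ?case unfolding LS by (intro card_of_Un_ordLeq_infinite'[OF B(1)])
  qed (simp add: L0 B)
  have mono: "L m \<subseteq> L n" if "m \<le> n" for m n
    using lift_Suc_mono_le[OF _ that, of L] by (simp add: LS)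
  have "closed_under g (\<Union>n. L n)"
    unfolding closed_under_def
  proof
    fix l assume "l \<in> lists (\<Union>n. L n)"
    then have "\<exists>n. l \<in> lists (L n)"
    proof (induction l)
      case (Cons x l)
      then obtain m n where "x \<in> L m" "l \<in> lists (L n)" by auto
      then have "x # l \<in> lists (L (max m n))"
        using mono[of m "max m n"] mono[of n "max m n"] lists_mono[of "L n" "L (max m n)"] by auto
      then show ?case by blast
    qed simp
    then obtain n where "l \<in> lists (L n)" by blast
    then have "g l \<subseteq> L (Suc n)" by (auto simp: LS)
    then show "g l \<subseteq> (\<Union>n. L n)" by blast
  qed
  then have "closure_under g Y \<subseteq> (\<Union>n. L n)"
    by (intro closure_under_least) (use L0 in blast)
  moreover have "|\<Union>n. L n| \<le>o |B|"
    by (rule card_of_UNION_ordLeq_infinite[OF B(1)]) (use B(1) infinite_iff_card_of_nat card in auto)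
  ultimately show ?thesis by (rule ordLeq_transitive[OF card_of_mono1])
qed

text \<open>For infinite \<open>Y\<close> the closure is no larger than \<open>Y\<close>. For finite
  \<open>Y\<close> it can be infinite but is countable, and the strict inequality comes from
  uncountability of \<open>Z\<close>.\<close>

lemma card_of_closure_under_less:
  assumes g: "\<And>l. countable (g l)" and Z: "\<not> countable Z" and Y: "|Y| <o |Z|"
  shows "|closure_under g (insert z Y)| <o |Z|"
proof (cases "finite Y")
  case True
  then have "|closure_under g (insert z Y)| \<le>o |UNIV :: nat set|"
    by (intro card_of_closure_under[OF g] countable_ordLeq_infinite) (auto intro: countable_finite)
  moreover have "|UNIV :: nat set| <o |Z|"
  proof (rule ccontr)
    assume "\<not> ?thesis"
    then have "|Z| \<le>o |UNIV :: nat set|"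
      using not_ordLeq_iff_ordLess[OF card_of_Well_order card_of_Well_order] by blast
    then show False using Z unfolding card_of_ordLeq[symmetric] by (auto intro: countableI)
  qed
  ultimately show ?thesis by (rule ordLeq_ordLess_trans)
next
  case False
  then have "|insert z Y| \<le>o |Y|"
    using card_of_Un_ordLeq_infinite'[OF False countable_ordLeq_infinite[OF _ False] card_of_mono1[OF subset_refl], of "{z}"]
    by simp
  then have "|closure_under g (insert z Y)| \<le>o |Y|"
    by (intro card_of_closure_under[OF g False])
  then show ?thesis using Y by (rule ordLeq_ordLess_trans)
qed

text \<open>
  By induction on the cardinality of the closed set \<open>Z\<close>, which is written as the union of an
  increasing family of smaller closed sets. An element of \<open>P\<close> that is new in one of them is
  a legal answer to all earlier elements of \<open>P\<close>, so only finitely many steps contribute.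
\<close>

lemma finite_to_one_colouring_aux:
  assumes g: "\<And>l. countable (g l)" and Z: "closed_under g Z"
  shows "\<exists>\<kappa> :: 'i \<Rightarrow> nat. \<forall>P. (\<nexists>f. \<forall>k :: nat. f k \<in> P \<and> f k \<notin> g (map f [0..<k])) \<longrightarrow>
      (\<forall>n. finite {i \<in> P \<inter> Z. \<kappa> i = n})"
  using Z
proof (induction Z rule: wf_induct_rule[OF wf_inv_image[OF wf_ordLess, of card_of]])
  case (1 Z)
  show ?case
  proof (cases "countable Z")
    case True
    have "finite {i \<in> P \<inter> Z. to_nat_on Z i = n}" for P n
    proof (rule finite_subset)
      show "{i \<in> P \<inter> Z. to_nat_on Z i = n} \<subseteq> {from_nat_into Z n}"
        using from_nat_into_to_nat_on[OF True] by auto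
    qed simp
    then show ?thesis by blast
  next
    case False
    \<comment> \<open>The cardinal order on \<open>Z\<close>: the predecessors of a point are fewer
      than the elements of \<open>Z\<close>, which brings each \<open>E z\<close> under the
      induction hypothesis.\<close>
    define r where "r = |Z|"
    have F: "Field r = Z" by (simp add: r_def Field_card_of)
    have wo: "Well_order r" by (simp add: r_def card_of_Well_order)
    then have refl: "refl_on Z r" and tr: "trans r" and asym: "antisym r" and tot: "total_on Z r" and wf: "wf (r - Id)"
      using F by (auto simp: well_order_on_def linear_order_on_def partial_order_on_def preorder_on_def)
    define E where "E z = closure_under g (insert z (underS r z))" for z
    have clE: "closed_under g (E z)" for z by (simp add: E_def closed_under_closure)
    have zE: "z \<in> E z" for z using closure_under_superset by (fastforce simp: E_def)
    have EZ: "E z \<subseteq> Z" if "z \<in> Z" for z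
      unfolding E_def using that 1(2) F by (intro closure_under_least) (auto simp: underS_def Field_def)
    have mono: "E w \<subseteq> E z" if "(w, z) \<in> r" for w z
      unfolding E_def
      by (rule closure_under_mono)
         (use that tr asym in \<open>auto simp: underS_def dest: transD antisymD\<close>)
    have "|E z| <o |Z|" if "z \<in> Z" for z
      unfolding E_def
      by (rule card_of_closure_under_less[OF g False])
         (use card_of_underS[of r z] that F in \<open>simp add: r_def card_of_Card_order\<close>)
    then have "\<exists>\<kappa> :: 'i \<Rightarrow> nat. \<forall>P. (\<nexists>f. \<forall>k :: nat. f k \<in> P \<and> f k \<notin> g (map f [0..<k])) \<longrightarrow>
        (\<forall>n. finite {i \<in> P \<inter> E z. \<kappa> i = n})" if "z \<in> Z" for z
      using 1(1)[OF _ clE] that by (auto simp: in_inv_image)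
    then obtain \<kappa> :: "'i \<Rightarrow> 'i \<Rightarrow> nat" where \<kappa>: "\<And>z P n. z \<in> Z \<Longrightarrow>
        (\<nexists>f. \<forall>k :: nat. f k \<in> P \<and> f k \<notin> g (map f [0..<k])) \<Longrightarrow> finite {i \<in> P \<inter> E z. \<kappa> z i = n}"
      by metis
    have min: "\<exists>z\<in>S. \<forall>w\<in>S. (z, w) \<in> r" if S: "S \<subseteq> Z" "S \<noteq> {}" for S
    proof -
      obtain z where z: "z \<in> S" "\<And>w. (w, z) \<in> r - Id \<Longrightarrow> w \<notin> S"
        using wf S(2) by (metis wfE_min ex_in_conv)
      have "(z, w) \<in> r" if "w \<in> S" for w
      proof (cases "w = z")
        case True
        then show ?thesis using refl z(1) S(1) by (auto simp: refl_on_def)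
      next
        case False
        then have "(w, z) \<in> r \<or> (z, w) \<in> r"
          using tot z(1) S(1) that unfolding total_on_def by blast
        then show ?thesis using z(2) that False by blast
      qed
      then show ?thesis using z(1) by blast
    qed
    have "\<exists>z\<in>{z \<in> Z. i \<in> E z}. \<forall>w\<in>{z \<in> Z. i \<in> E z}. (z, w) \<in> r" if "i \<in> Z" for i
      using min[of "{z \<in> Z. i \<in> E z}"] that zE by blast
    \<comment> \<open>\<open>rk i\<close> is the first stage containing \<open>i\<close>; the final
      colour of \<open>i\<close> is the one it has in that stage.\<close>
    then obtain rk where rk: "\<And>i. i \<in> Z \<Longrightarrow> rk i \<in> Z" "\<And>i. i \<in> Z \<Longrightarrow> i \<in> E (rk i)"
      "\<And>i z. i \<in> Z \<Longrightarrow> z \<in> Z \<Longrightarrow> i \<in> E z \<Longrightarrow> (rk i, z) \<in> r"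
      by (metis (no_types, lifting) mem_Collect_eq)
    have "finite {i \<in> P \<inter> Z. \<kappa> (rk i) i = n}"
      if P: "\<nexists>f. \<forall>k :: nat. f k \<in> P \<and> f k \<notin> g (map f [0..<k])" for P n
    proof -
      have "finite (rk ` (P \<inter> Z))"
      proof (rule ccontr)
        assume inf: "infinite (rk ` (P \<inter> Z))"
        define R where "R = rk ` (P \<inter> Z)"
        have RZ: "R \<subseteq> Z" using rk(1) by (auto simp: R_def)
        \<comment> \<open>Removing the minimum of an infinite set leaves an infinite set above it;
          iterating gives a strictly increasing sequence of stages.\<close>
        have step: "\<exists>z\<in>S. infinite {w \<in> S. (z, w) \<in> r \<and> z \<noteq> w}" if "S \<subseteq> R" "infinite S" for S
        proof -
          have "S \<subseteq> Z" "S \<noteq> {}" using RZ that by auto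
          then obtain z where z: "z \<in> S" "\<forall>w\<in>S. (z, w) \<in> r" using min by blast
          then have "{w \<in> S. (z, w) \<in> r \<and> z \<noteq> w} = S - {z}" by auto
          then show ?thesis using that(2) z(1) by (intro bexI[of _ z]) simp_all
        qed
        have "\<exists>Zs. \<forall>n :: nat. (Zs n \<in> R \<and> infinite {w \<in> R. (Zs n, w) \<in> r \<and> Zs n \<noteq> w}) \<and>
            ((Zs n, Zs (Suc n)) \<in> r \<and> Zs n \<noteq> Zs (Suc n))"
        proof (rule dependent_nat_choice)
          show "\<exists>z. z \<in> R \<and> infinite {w \<in> R. (z, w) \<in> r \<and> z \<noteq> w}"
            using step[of R] inf by (auto simp: R_def)
        next
          fix z assume z: "z \<in> R \<and> infinite {w \<in> R. (z, w) \<in> r \<and> z \<noteq> w}"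
          then obtain w where w: "w \<in> {w \<in> R. (z, w) \<in> r \<and> z \<noteq> w}"
            "infinite {v \<in> {w \<in> R. (z, w) \<in> r \<and> z \<noteq> w}. (w, v) \<in> r \<and> w \<noteq> v}"
            using step[of "{w \<in> R. (z, w) \<in> r \<and> z \<noteq> w}"] by blast
          then have "infinite {v \<in> R. (w, v) \<in> r \<and> w \<noteq> v}"
            by (rule_tac infinite_super[OF _ w(2)]) auto
          then show "\<exists>w. (w \<in> R \<and> infinite {v \<in> R. (w, v) \<in> r \<and> w \<noteq> v}) \<and> (z, w) \<in> r \<and> z \<noteq> w"
            using w(1) by blast
        qed
        then obtain Zs where Zs: "\<And>n :: nat. Zs n \<in> R" "\<And>n. (Zs n, Zs (Suc n)) \<in> r" "\<And>n. Zs n \<noteq> Zs (Suc n)"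
          by blast
        have le: "(Zs m, Zs n) \<in> r" if "m \<le> n" for m n
          using that
        proof (induction n)
          case 0
          then show ?case using Zs(1) RZ refl by (auto simp: refl_on_def)
        next
          case (Suc n)
          show ?case
          proof (cases "m = Suc n")
            case True
            then show ?thesis using Zs(1) RZ refl by (auto simp: refl_on_def)
          next
            case False
            then have "(Zs m, Zs n) \<in> r" using Suc by simp
            then show ?thesis using Zs(2) by (rule transD[OF tr])
          qed
        qed
        have "\<exists>i. i \<in> P \<inter> Z \<and> rk i = Zs n" for n using Zs(1)[of n] by (auto simp: R_def)
        then obtain h where h: "\<And>n. h n \<in> P \<inter> Z" "\<And>n. rk (h n) = Zs n" by metis
        \<comment> \<open>Shifted by one: for \<open>j < k\<close> the first stage of
          \<open>f j\<close> is \<open>Zs (Suc j)\<close>, not after \<open>Zs k\<close>, so all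
          earlier terms lie in the closed set \<open>E (Zs k)\<close>, whereas \<open>f k\<close>
          enters strictly later.\<close>
        define f where "f k = h (Suc k)" for k
        have "f k \<notin> g (map f [0..<k])" for k
        proof
          assume "f k \<in> g (map f [0..<k])"
          moreover have "map f [0..<k] \<in> lists (E (Zs k))"
          proof -
            have "f j \<in> E (Zs k)" if "j < k" for j
              using mono[OF le[of "Suc j" k]] rk(2)[of "f j"] h that by (auto simp: f_def)
            then show ?thesis by (auto simp: in_lists_conv_set)
          qed
          ultimately have "f k \<in> E (Zs k)" using clE by (auto simp: closed_under_def)
          then have "(Zs (Suc k), Zs k) \<in> r"
            using rk(3)[of "f k" "Zs k"] h Zs(1) RZ by (auto simp: f_def)
          then show False using Zs(2,3)[of k] asym by (auto dest: antisymD)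
        qed
        moreover have "f k \<in> P" for k using h(1) by (auto simp: f_def)
        ultimately show False using P by blast
      qed
      moreover have "finite {i \<in> P \<inter> E z. \<kappa> z i = n}" if "z \<in> rk ` (P \<inter> Z)" for z
        using \<kappa>[OF _ P] that rk(1) by blast
      moreover have "{i \<in> P \<inter> Z. \<kappa> (rk i) i = n} \<subseteq> (\<Union>z\<in>rk ` (P \<inter> Z). {i \<in> P \<inter> E z. \<kappa> z i = n})"
        using rk(2) by blast
      ultimately show ?thesis using finite_subset by blast
    qed
    then show ?thesis by (intro exI[of _ "\<lambda>i. \<kappa> (rk i) i"]) blast
  qed
qed

lemma finite_to_one_colouring:
  assumes "\<And>l. countable (g l)"
  shows "\<exists>\<kappa> :: 'i \<Rightarrow> nat. \<forall>P. (\<nexists>f. \<forall>k :: nat. f k \<in> P \<and> f k \<notin> g (map f [0..<k])) \<longrightarrow>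
      (\<forall>n. finite {i \<in> P. \<kappa> i = n})"
  using finite_to_one_colouring_aux[of g UNIV, OF assms] by (simp add: closed_under_def)

unbundle no cardinal_syntax

text \<open>
  Alster's argument for scattered Corson compact spaces. A set \<open>E\<close> is good if there are
  countable sets \<open>g [i\<^sub>1, \<dots>, i\<^sub>k]\<close> such that no point of \<open>E\<close> lies in all the sets \<open>V i\<^sub>1, V i\<^sub>2, \<dots>\<close>
  of a sequence that avoids \<open>g\<close>. In an open set in which all functions vary by at most \<open>\<delta>\<close>,
  only countably many \<open>V i\<close> contain points of the rest of the space.
\<close>

lemma fragmented_colouring:
  fixes F :: "'j \<Rightarrow> 'a \<Rightarrow> real"
  assumes X: "compact_space X" "Hausdorff_space X"
    and F: "\<And>i. i \<in> J \<Longrightarrow> continuous_map X euclideanreal (F i)"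
    and ctbl: "\<And>y. y \<in> topspace X \<Longrightarrow> countable {i \<in> J. F i y \<notin> {0, 1}}"
    and frag: "\<And>Y. closedin X Y \<Longrightarrow> Y \<noteq> {} \<Longrightarrow>
      \<exists>U. openin X U \<and> U \<inter> Y \<noteq> {} \<and> (\<forall>i\<in>J. \<forall>x\<in>U \<inter> Y. \<forall>y\<in>U \<inter> Y. \<bar>F i x - F i y\<bar> \<le> \<delta>)"
    and "0 < \<delta>"
  obtains \<kappa> :: "'j \<Rightarrow> nat" where
    "\<And>y n. y \<in> topspace X \<Longrightarrow> finite {i \<in> J. \<kappa> i = n \<and> F i y \<in> {2 * \<delta>..1 - 2 * \<delta>}}"
proof -
  define V where "V i = {y \<in> topspace X. F i y \<in> {2 * \<delta>..1 - 2 * \<delta>}}" for i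
  define good where "good E \<longleftrightarrow> (\<exists>g. (\<forall>l. countable (g l)) \<and>
    \<not> (\<exists>f y. y \<in> E \<and> (\<forall>k :: nat. f k \<in> J \<and> y \<in> V (f k) \<and> f k \<notin> g (map f [0..<k]))))" for E
  have good_mono: "good E'" if "good E" "E' \<subseteq> E" for E E'
    using that unfolding good_def by blast
  have good_Un: "good (E \<union> E')" if EE': "good E" "good E'" for E E'
  proof -
    obtain g where g: "\<And>l. countable (g l)"
      "\<And>f y. y \<in> E \<Longrightarrow> (\<forall>k :: nat. f k \<in> J \<and> y \<in> V (f k) \<and> f k \<notin> g (map f [0..<k])) \<Longrightarrow> False"
      using EE'(1) unfolding good_def by blast
    obtain g' where g': "\<And>l. countable (g' l)"
      "\<And>f y. y \<in> E' \<Longrightarrow> (\<forall>k :: nat. f k \<in> J \<and> y \<in> V (f k) \<and> f k \<notin> g' (map f [0..<k])) \<Longrightarrow> False"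
      using EE'(2) unfolding good_def by blast
    show ?thesis
      unfolding good_def
    proof (intro exI[of _ "\<lambda>l. g l \<union> g' l"] conjI notI allI)
      show "countable (g l \<union> g' l)" for l using g(1) g'(1) by simp
    next
      assume "\<exists>f y. y \<in> E \<union> E' \<and> (\<forall>k :: nat. f k \<in> J \<and> y \<in> V (f k) \<and>
        f k \<notin> g (map f [0..<k]) \<union> g' (map f [0..<k]))"
      then obtain f y where "y \<in> E \<union> E'" "\<forall>k :: nat. f k \<in> J \<and> y \<in> V (f k) \<and>
        f k \<notin> g (map f [0..<k]) \<union> g' (map f [0..<k])" by blast
      then show False using g(2)[of y f] g'(2)[of y f] by blast
    qed
  qed
  have good_Union: "good (\<Union>\<F>)" if "finite \<F>" "\<And>E. E \<in> \<F> \<Longrightarrow> good E" for \<F>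
    using that
  proof (induction \<F>)
    case empty
    have "good {}" unfolding good_def by (intro exI[of _ "\<lambda>_. {}"]) auto
    then show ?case by simp
  qed (auto intro: good_Un)
  \<comment> \<open>A sequence avoiding the new \<open>g\<close> starts with some \<open>i\<close>
    outside \<open>c\<close>; from then on the sets belonging to \<open>E \<inter> V i\<close> are
    in force. So the empty list gets \<open>c\<close>, and the head of a nonempty list selects which
    \<open>G i\<close> to follow.\<close>
  have good_step: "good E" if c: "countable c" "\<And>i. i \<in> J - c \<Longrightarrow> good (E \<inter> V i)" for E c
  proof -
    have "\<exists>g. (\<forall>l. countable (g l)) \<and> (i \<in> J - c \<longrightarrow> \<not> (\<exists>f y. y \<in> E \<inter> V i \<and>
        (\<forall>k :: nat. f k \<in> J \<and> y \<in> V (f k) \<and> f k \<notin> g (map f [0..<k]))))" for i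
      using c(2)[of i] unfolding good_def by (cases "i \<in> J - c") (auto intro: exI[of _ "\<lambda>_. {}"])
    then obtain G where G: "\<And>i l. countable (G i l)" "\<And>i f y. i \<in> J - c \<Longrightarrow> y \<in> E \<inter> V i \<Longrightarrow>
        (\<forall>k :: nat. f k \<in> J \<and> y \<in> V (f k) \<and> f k \<notin> G i (map f [0..<k])) \<Longrightarrow> False"
      by metis
    show ?thesis
      unfolding good_def
    proof (intro exI[of _ "\<lambda>l. case l of [] \<Rightarrow> c | i # l' \<Rightarrow> G i l'"] conjI notI allI)
      show "countable (case l of [] \<Rightarrow> c | i # l' \<Rightarrow> G i l')" for l
        using c(1) G(1) by (cases l) auto
    next
      assume "\<exists>f y. y \<in> E \<and> (\<forall>k :: nat. f k \<in> J \<and> y \<in> V (f k) \<and>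
        f k \<notin> (case map f [0..<k] of [] \<Rightarrow> c | i # l' \<Rightarrow> G i l'))"
      then obtain f y where y: "y \<in> E" and f: "\<And>k :: nat. f k \<in> J \<and> y \<in> V (f k) \<and>
        f k \<notin> (case map f [0..<k] of [] \<Rightarrow> c | i # l' \<Rightarrow> G i l')" by blast
      have "f (Suc k) \<notin> G (f 0) (map (\<lambda>k. f (Suc k)) [0..<k])" for k
        using f[of "Suc k"] by (simp add: map_upt_Suc del: upt_Suc)
      moreover have "f 0 \<in> J - c" "y \<in> V (f 0)" using f[of 0] by auto
      ultimately show False using G(2)[of "f 0" y "\<lambda>k. f (Suc k)"] f y by blast
    qed
  qed
  define O' where "O' = \<Union>{U. openin X U \<and> good U}"
  have O': "openin X O'" by (auto simp: O'_def)
  have compact_good: "good E" if E: "closedin X E" "E \<subseteq> O'" for E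
  proof -
    have "compactin X E" using closedin_compact_space[OF X(1)] E(1) by blast
    then obtain \<F> where "finite \<F>" "\<F> \<subseteq> {U. openin X U \<and> good U}" "E \<subseteq> \<Union>\<F>"
      using E(2) compactinD[of X E "{U. openin X U \<and> good U}"] by (auto simp: O'_def)
    then show ?thesis using good_Union good_mono by (metis mem_Collect_eq subsetD)
  qed
  have "topspace X - O' = {}"
  proof (rule ccontr)
    assume ne: "topspace X - O' \<noteq> {}"
    have "closedin X (topspace X - O')" using O' by blast
    from frag[OF this ne] obtain U where U: "openin X U" "U \<inter> (topspace X - O') \<noteq> {}"
      "\<And>i x y. i \<in> J \<Longrightarrow> x \<in> U \<inter> (topspace X - O') \<Longrightarrow> y \<in> U \<inter> (topspace X - O') \<Longrightarrow> \<bar>F i x - F i y\<bar> \<le> \<delta>"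
      by blast
    then obtain p where p: "p \<in> U \<inter> (topspace X - O')" by blast
    have "neighbourhood_base_of (closedin X) X"
      using compact_Hausdorff_imp_regular_space[OF X] by (simp add: neighbourhood_base_of_closedin)
    then have "\<forall>W x. openin X W \<and> x \<in> W \<longrightarrow> (\<exists>U V. openin X U \<and> closedin X V \<and> x \<in> U \<and> U \<subseteq> V \<and> V \<subseteq> W)"
      unfolding neighbourhood_base_of .
    from this[rule_format, of U p] obtain U' E
      where E: "openin X U'" "closedin X E" "p \<in> U'" "U' \<subseteq> E" "E \<subseteq> U"
      using U(1) p by blast
    \<comment> \<open>At \<open>p\<close> such a function is 0 or 1, so on \<open>U\<close> outside
      \<open>O'\<close> it stays within \<open>\<delta>\<close> of that value and misses
      \<open>V i\<close>, where it is at least \<open>2 * \<delta>\<close> away. Hence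
      \<open>E \<inter> V i\<close> is a closed set inside \<open>O'\<close>. The other indices are
      countably many by \<open>ctbl\<close>.\<close>
    have EV: "good (E \<inter> V i)" if i: "i \<in> J - {i \<in> J. F i p \<notin> {0, 1}}" for i
    proof (rule compact_good)
      have "closedin X (V i)"
        unfolding V_def using i F by (intro closedin_continuous_map_preimage[of X euclideanreal]) auto
      then show "closedin X (E \<inter> V i)" using E(2) by blast
      show "E \<inter> V i \<subseteq> O'"
      proof (rule ccontr)
        assume "\<not> E \<inter> V i \<subseteq> O'"
        then obtain y where y: "y \<in> E" "y \<in> V i" "y \<notin> O'" by blast
        then have "\<bar>F i y - F i p\<bar> \<le> \<delta>" using U(3)[of i y p] i E(5) p by (auto simp: V_def)
        then show False using i y(2) \<open>0 < \<delta>\<close> by (auto simp: V_def)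
      qed
    qed
    have "countable {i \<in> J. F i p \<notin> {0, 1}}" using p by (intro ctbl) simp
    then have "good E" by (rule good_step) (rule EV)
    then have "good U'" using E(4) by (rule good_mono)
    then have "U' \<subseteq> O'" using E(1) by (auto simp: O'_def)
    then show False using p E(3) by blast
  qed
  then have "good (topspace X)" using compact_good by blast
  then obtain g where g: "\<forall>l. countable (g l)"
    "\<not> (\<exists>f y. y \<in> topspace X \<and> (\<forall>k :: nat. f k \<in> J \<and> y \<in> V (f k) \<and> f k \<notin> g (map f [0..<k])))"
    unfolding good_def by (elim exE conjE)
  have "\<exists>\<kappa> :: 'j \<Rightarrow> nat. \<forall>P. (\<nexists>f. \<forall>k :: nat. f k \<in> P \<and> f k \<notin> g (map f [0..<k])) \<longrightarrow>
      (\<forall>n. finite {i \<in> P. \<kappa> i = n})"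
    by (rule finite_to_one_colouring) (use g(1) in blast)
  then obtain \<kappa> :: "'j \<Rightarrow> nat" where \<kappa>: "\<forall>P. (\<nexists>f. \<forall>k :: nat. f k \<in> P \<and> f k \<notin> g (map f [0..<k])) \<longrightarrow>
      (\<forall>n. finite {i \<in> P. \<kappa> i = n})" ..
  show ?thesis
  proof (rule that)
    fix y n assume y: "y \<in> topspace X"
    have "\<nexists>f. \<forall>k :: nat. f k \<in> {i \<in> J. y \<in> V i} \<and> f k \<notin> g (map f [0..<k])"
    proof
      assume "\<exists>f. \<forall>k :: nat. f k \<in> {i \<in> J. y \<in> V i} \<and> f k \<notin> g (map f [0..<k])"
      then obtain f where "\<forall>k :: nat. f k \<in> {i \<in> J. y \<in> V i} \<and> f k \<notin> g (map f [0..<k])" ..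
      then have "\<forall>k. f k \<in> J \<and> y \<in> V (f k) \<and> f k \<notin> g (map f [0..<k])" by simp
      then show False using g(2) y by blast
    qed
    from \<kappa>[rule_format, OF this, of n] show "finite {i \<in> J. \<kappa> i = n \<and> F i y \<in> {2 * \<delta>..1 - 2 * \<delta>}}"
      by (rule rev_finite_subset) (use y in \<open>auto simp: V_def\<close>)
  qed
qed

lemma bounded_functional_mono:
  assumes "bounded_functional X c \<mu>" "c \<le> c'"
  shows "bounded_functional X c' \<mu>"
proof -
  interpret bounded_functional X c \<mu> by fact
  show ?thesis
  proof
    fix f b assume "continuous_map X euclideanreal f" "0 \<le> b" "\<And>x. x \<in> topspace X \<Longrightarrow> \<bar>f x\<bar> \<le> b"
    then have "\<bar>\<mu> f\<bar> \<le> c * b" by (rule bounded)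
    also have "\<dots> \<le> c' * b" using assms(2) \<open>0 \<le> b\<close> by (rule mult_right_mono)
    finally show "\<bar>\<mu> f\<bar> \<le> c' * b" .
  qed (use linear bound_nonneg assms(2) in auto)
qed

section \<open>Isomorphisms between function spaces\<close>

lemma mspace_C_space:
  assumes "compact_space X"
  shows "mspace (C_space X) = {f \<in> extensional (topspace X). continuous_map X euclideanreal f}"
  using compactin_mspace_cfunspace[of X euclidean_metric] assms
  by (auto simp: compact_space_def simp del: mspace_cfunspace)

declare mspace_cfunspace [simp del]

lemma restrict_in_C_space:
  assumes "compact_space X" "continuous_map X euclideanreal f"
  shows "restrict f (topspace X) \<in> mspace (C_space X)"
  using assms by (simp add: mspace_C_space)

text \<open>Continuity at the zero function gives a radius \<open>\<delta>\<close> in the supremum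
  metric, and scaling turns it into the bound \<open>2 / \<delta>\<close> for all evaluations
  simultaneously.\<close>

lemma C_linear_continuous_bounded:
  assumes X: "compact_space X" and Y: "compact_space Y" and T: "C_linear X Y T"
    and cont: "continuous_map (mtopology_of (C_space X)) (mtopology_of (C_space Y)) T"
  shows "\<exists>c. \<forall>y\<in>topspace Y. bounded_functional X c (\<lambda>f. T (restrict f (topspace X)) y)"
proof -
  interpret Metric_space12 "mspace (C_space X)" "mdist (C_space X)" "mspace (C_space Y)" "mdist (C_space Y)"
    by (simp add: Metric_space12_def Metric_space_mspace_mdist)
  have cont': "continuous_map M1.mtopology M2.mtopology T"
    using cont by (simp add: mtopology_of_def)
  have TC: "T f \<in> mspace (C_space Y)" if "f \<in> mspace (C_space X)" for f
    using cont' that by (auto simp: continuous_map_def)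
  define z where "z = restrict (\<lambda>x. 0 :: real) (topspace X)"
  have z: "z \<in> mspace (C_space X)" unfolding z_def by (rule restrict_in_C_space[OF X]) simp
  have lin: "T (\<lambda>x\<in>topspace X. a * f x + b * g x) = (\<lambda>y\<in>topspace Y. a * T f y + b * T g y)"
    if "f \<in> mspace (C_space X)" "g \<in> mspace (C_space X)" for f g a b
    using T that unfolding C_linear_def by blast
  have Tz: "T z y = 0" if "y \<in> topspace Y" for y
    using lin[OF z z, of 0 0] that by (simp add: z_def)
  obtain \<delta> where \<delta>: "0 < \<delta>" "\<And>f. f \<in> mspace (C_space X) \<Longrightarrow> mdist (C_space X) z f < \<delta> \<Longrightarrow>
      mdist (C_space Y) (T z) (T f) < 1"
    using cont' z unfolding M1.metric_continuous_map[OF M2.Metric_space_axioms] by (meson zero_less_one)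
  have bound: "\<bar>T f y\<bar> \<le> 2 / \<delta> * b"
    if f: "f \<in> mspace (C_space X)" and b: "0 \<le> b" "\<And>x. x \<in> topspace X \<Longrightarrow> \<bar>f x\<bar> \<le> b"
      and y: "y \<in> topspace Y" for f b y
  proof -
    \<comment> \<open>\<open>s\<close> stays strictly above \<open>b\<close> because
      \<open>b\<close> may be 0; the scaling \<open>a\<close> with
      \<open>a * s = \<delta> / 2\<close> keeps the function inside the
      \<open>\<delta>\<close>-ball.\<close>
    have "\<delta> / 2 * \<bar>T f y\<bar> \<le> s" if s: "b < s" for s
    proof -
      define a where "a = \<delta> / (2 * s)"
      have a: "0 < a" using \<delta>(1) b(1) s by (simp add: a_def)
      define f' where "f' = (\<lambda>x\<in>topspace X. a * f x + 0 * f x)"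
      have "continuous_map X euclideanreal (\<lambda>x. a * f x + 0 * f x)"
        using f X by (auto simp: mspace_C_space intro: continuous_map_real_mult)
      then have f': "f' \<in> mspace (C_space X)" unfolding f'_def by (rule restrict_in_C_space[OF X])
      have "mdist (C_space X) z f' \<le> a * b"
      proof (rule mdist_cfunspace_le)
        show "mdist euclidean_metric (z x) (f' x) \<le> a * b" if "x \<in> topspace X" for x
          using b(2)[OF that] a that by (simp add: z_def f'_def dist_real_def abs_mult)
      qed (use a b in simp)
      also have "a * b \<le> a * s" using a s by (intro mult_left_mono) auto
      also have "a * s < a * s + \<delta> / 2" using \<delta>(1) by simp
      also have "a * s + \<delta> / 2 = \<delta>" using b(1) s by (simp add: a_def)
      finally have "mdist (C_space Y) (T z) (T f') < 1" using \<delta>(2) f' by blast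
      then have "mdist euclidean_metric (T z y) (T f' y) \<le> 1"
        using mdist_cfunspace_imp_mdist_le[OF TC[OF z] TC[OF f'] _ y, of 1] by simp
      then have "\<bar>T f' y\<bar> \<le> 1" using Tz[OF y] by (simp add: dist_real_def)
      moreover have "T f' y = a * T f y" using lin[OF f f, of a 0] y by (simp add: f'_def)
      ultimately have "a * \<bar>T f y\<bar> \<le> 1" using a by (simp add: abs_mult)
      then show ?thesis using b(1) s by (simp add: a_def field_simps)
    qed
    then have "\<delta> / 2 * \<bar>T f y\<bar> \<le> b" by (rule dense_ge)
    then show ?thesis using \<delta>(1) by (simp add: field_simps)
  qed
  show ?thesis
  proof (intro exI[of _ "2 / \<delta>"] ballI bounded_functional.intro)
    fix y f g a b assume y: "y \<in> topspace Y" and fg: "continuous_map X euclideanreal f" "continuous_map X euclideanreal g"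
    have "(\<lambda>x\<in>topspace X. a * f x + b * g x) =
        (\<lambda>x\<in>topspace X. a * restrict f (topspace X) x + b * restrict g (topspace X) x)"
      by auto
    then show "T (\<lambda>x\<in>topspace X. a * f x + b * g x) y =
        a * T (restrict f (topspace X)) y + b * T (restrict g (topspace X)) y"
      using lin[OF restrict_in_C_space[OF X fg(1)] restrict_in_C_space[OF X fg(2)], of a b] y by simp
  next
    fix y f b assume "y \<in> topspace Y" "continuous_map X euclideanreal f" "0 \<le> b"
      "\<And>x. x \<in> topspace X \<Longrightarrow> \<bar>f x\<bar> \<le> b"
    then show "\<bar>T (restrict f (topspace X)) y\<bar> \<le> 2 / \<delta> * b"
      by (intro bound restrict_in_C_space[OF X]) auto
  qed (use \<delta>(1) in simp)
qed

text \<open>Turns the isomorphism into operators on total functions, by restricting the argument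
  first, with one norm bound for both directions. The inverse identities therefore hold pointwise on
  the two spaces.\<close>

lemma C_isomorphicE:
  assumes iso: "C_isomorphic X Y" and X: "compact_space X" and Y: "compact_space Y"
  obtains T S c where
    "\<And>y. y \<in> topspace Y \<Longrightarrow> bounded_functional X c (\<lambda>f. T f y)"
    "\<And>x. x \<in> topspace X \<Longrightarrow> bounded_functional Y c (\<lambda>g. S g x)"
    "\<And>f. continuous_map X euclideanreal f \<Longrightarrow> continuous_map Y euclideanreal (T f)"
    "\<And>g. continuous_map Y euclideanreal g \<Longrightarrow> continuous_map X euclideanreal (S g)"
    "\<And>f x. continuous_map X euclideanreal f \<Longrightarrow> x \<in> topspace X \<Longrightarrow> S (T f) x = f x"
    "\<And>g y. continuous_map Y euclideanreal g \<Longrightarrow> y \<in> topspace Y \<Longrightarrow> T (S g) y = g y"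
proof -
  obtain T where T: "C_linear X Y T"
    "homeomorphic_map (mtopology_of (C_space X)) (mtopology_of (C_space Y)) T"
    using iso unfolding C_isomorphic_def by blast
  obtain S where TS: "homeomorphic_maps (mtopology_of (C_space X)) (mtopology_of (C_space Y)) T S"
    using T(2) homeomorphic_map_maps by blast
  then have cT: "continuous_map (mtopology_of (C_space X)) (mtopology_of (C_space Y)) T"
    and cS: "continuous_map (mtopology_of (C_space Y)) (mtopology_of (C_space X)) S"
    and ST: "\<And>f. f \<in> mspace (C_space X) \<Longrightarrow> S (T f) = f"
    and TS': "\<And>g. g \<in> mspace (C_space Y) \<Longrightarrow> T (S g) = g"
    by (auto simp: homeomorphic_maps_def)
  have TC: "T f \<in> mspace (C_space Y)" if "f \<in> mspace (C_space X)" for f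
    using continuous_map_image_subset_topspace[OF cT] that by auto
  have SC: "S g \<in> mspace (C_space X)" if "g \<in> mspace (C_space Y)" for g
    using continuous_map_image_subset_topspace[OF cS] that by auto
  have S: "C_linear Y X S"
    unfolding C_linear_def
  proof (intro ballI allI)
    fix f g a b assume fg: "f \<in> mspace (C_space Y)" "g \<in> mspace (C_space Y)"
    have "continuous_map X euclideanreal (\<lambda>x. a * S f x + b * S g x)"
      using SC[OF fg(1)] SC[OF fg(2)] X
      by (intro continuous_map_add continuous_map_real_mult) (auto simp: mspace_C_space)
    then have in_X: "(\<lambda>x\<in>topspace X. a * S f x + b * S g x) \<in> mspace (C_space X)"
      by (rule restrict_in_C_space[OF X])
    have "T (\<lambda>x\<in>topspace X. a * S f x + b * S g x) = (\<lambda>y\<in>topspace Y. a * f y + b * g y)"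
      using T(1)[unfolded C_linear_def, rule_format, OF SC[OF fg(1)] SC[OF fg(2)]]
        TS'[OF fg(1)] TS'[OF fg(2)] by simp
    then show "S (\<lambda>y\<in>topspace Y. a * f y + b * g y) = (\<lambda>x\<in>topspace X. a * S f x + b * S g x)"
      using ST[OF in_X] by simp
  qed
  obtain c where c: "\<And>y. y \<in> topspace Y \<Longrightarrow> bounded_functional X c (\<lambda>f. T (restrict f (topspace X)) y)"
    using C_linear_continuous_bounded[OF X Y T(1) cT] by blast
  obtain d where d: "\<And>x. x \<in> topspace X \<Longrightarrow> bounded_functional Y d (\<lambda>g. S (restrict g (topspace Y)) x)"
    using C_linear_continuous_bounded[OF Y X S cS] by blast
  show thesis
  proof (rule that)
    show "bounded_functional X (max c d) (\<lambda>f. T (restrict f (topspace X)) y)" if "y \<in> topspace Y" for y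
      using c[OF that] by (rule bounded_functional_mono) simp
    show "bounded_functional Y (max c d) (\<lambda>g. S (restrict g (topspace Y)) x)" if "x \<in> topspace X" for x
      using d[OF that] by (rule bounded_functional_mono) simp
    show cTf: "continuous_map Y euclideanreal (T (restrict f (topspace X)))" if "continuous_map X euclideanreal f" for f
      using TC[OF restrict_in_C_space[OF X that]] Y by (simp add: mspace_C_space)
    show cSg: "continuous_map X euclideanreal (S (restrict g (topspace Y)))" if "continuous_map Y euclideanreal g" for g
      using SC[OF restrict_in_C_space[OF Y that]] X by (simp add: mspace_C_space)
    show "S (restrict (T (restrict f (topspace X))) (topspace Y)) x = f x"
      if f: "continuous_map X euclideanreal f" and x: "x \<in> topspace X" for f x
    proof -
      have "restrict (T (restrict f (topspace X))) (topspace Y) = T (restrict f (topspace X))"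
        using TC[OF restrict_in_C_space[OF X f]] Y by (simp add: mspace_C_space extensional_restrict)
      then show ?thesis using ST[OF restrict_in_C_space[OF X f]] x by simp
    qed
    show "T (restrict (S (restrict g (topspace Y))) (topspace X)) y = g y"
      if g: "continuous_map Y euclideanreal g" and y: "y \<in> topspace Y" for g y
    proof -
      have "restrict (S (restrict g (topspace Y))) (topspace X) = S (restrict g (topspace Y))"
        using SC[OF restrict_in_C_space[OF Y g]] X by (simp add: mspace_C_space extensional_restrict)
      then show ?thesis using TS'[OF restrict_in_C_space[OF Y g]] y by simp
    qed
  qed
qed

section \<open>Families of functions that are almost 0-1-valued\<close>

text \<open>Constant up to 1/3 and from 2/3 on. The margins fit an oscillation of 1/9: a value
  outside [2/9, 7/9], changed by at most 1/9, remains where \<open>clip\<close> is constant.\<close>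

definition clip :: "real \<Rightarrow> real" where
  "clip s = max 0 (min 1 (3 * s - 1))"

text \<open>Lists of factors allow powers, give the constant 1 for \<open>[]\<close>, and let the
  classes involved be read off the factors.\<close>

definition monomial :: "('a \<Rightarrow> real) list \<Rightarrow> 'a \<Rightarrow> real" where
  "monomial ks y = prod_list (map (\<lambda>k. clip (k y)) ks)"

lemma clip_range: "0 \<le> clip s" "clip s \<le> 1"
  by (auto simp: clip_def)

lemma monomial_range: "0 \<le> monomial ks y \<and> monomial ks y \<le> 1"
  unfolding monomial_def by (induction ks) (auto simp: clip_range mult_le_one)

lemma continuous_map_clip:
  "continuous_map X euclideanreal k \<Longrightarrow> continuous_map X euclideanreal (\<lambda>y. clip (k y))"
  unfolding clip_def
  by (intro continuous_map_real_max continuous_map_real_min continuous_map_diff continuous_map_real_mult) auto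

lemma continuous_map_monomial:
  assumes "\<And>k. k \<in> set ks \<Longrightarrow> continuous_map X euclideanreal k"
  shows "continuous_map X euclideanreal (monomial ks)"
  using assms
proof (induction ks)
  case Nil
  then show ?case by (simp add: monomial_def[abs_def])
next
  case (Cons k ks)
  then have "continuous_map X euclideanreal (\<lambda>y. clip (k y) * monomial ks y)"
    by (intro continuous_map_real_mult continuous_map_clip) auto
  then show ?case by (simp add: monomial_def[abs_def])
qed

text \<open>All factors lie in [0, 1], so changing the point in one factor at a time costs at most
  \<open>\<epsilon>\<close> each.\<close>

lemma monomial_diff_le:
  assumes "\<And>k. k \<in> set ks \<Longrightarrow> \<bar>clip (k x) - clip (k y)\<bar> \<le> \<epsilon>"
  shows "\<bar>monomial ks x - monomial ks y\<bar> \<le> real (length ks) * \<epsilon>"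
  using assms
proof (induction ks)
  case Nil
  then show ?case by (simp add: monomial_def)
next
  case (Cons k ks)
  have "monomial (k # ks) x - monomial (k # ks) y =
      clip (k x) * (monomial ks x - monomial ks y) + (clip (k x) - clip (k y)) * monomial ks y"
    by (simp add: monomial_def algebra_simps)
  also have "\<bar>\<dots>\<bar> \<le> \<bar>clip (k x) * (monomial ks x - monomial ks y)\<bar> + \<bar>(clip (k x) - clip (k y)) * monomial ks y\<bar>"
    by (rule abs_triangle_ineq)
  also have "\<dots> \<le> 1 * (real (length ks) * \<epsilon>) + \<epsilon> * 1"
  proof -
    have "0 \<le> \<epsilon>" using Cons.prems[of k] by simp
    then show ?thesis
      unfolding abs_mult using Cons clip_range[of "k x"] monomial_range[of ks y]
      by (intro add_mono mult_mono) auto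
  qed
  finally show ?case by (simp add: algebra_simps)
qed

text \<open>The range of each function is cut into countably many intervals of length
  \<open>\<epsilon>\<close>, and the finitely many partitions obtained are refined.\<close>

lemma countably_small_finite_index:
  assumes "finite J" "0 < \<epsilon>"
  shows "countably_small Y J F \<epsilon>"
proof -
  have "countably_small Y {i} F \<epsilon>" for i
  proof (rule countably_smallI[of "range (\<lambda>n :: int. {y. \<lfloor>F i y / \<epsilon>\<rfloor> = n})"])
    fix V x y j assume "V \<in> range (\<lambda>n :: int. {y. \<lfloor>F i y / \<epsilon>\<rfloor> = n})" "x \<in> V" "y \<in> V" "j \<in> {i}"
    then have "\<lfloor>F j x / \<epsilon>\<rfloor> = \<lfloor>F j y / \<epsilon>\<rfloor>" by auto
    then have "\<bar>F j x / \<epsilon> - F j y / \<epsilon>\<bar> \<le> 1" by linarith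
    then have "\<bar>F j x - F j y\<bar> / \<epsilon> \<le> 1" using assms(2) by (simp flip: diff_divide_distrib)
    then show "\<bar>F j x - F j y\<bar> \<le> \<epsilon>" using assms(2) by simp
  qed auto
  then have "countably_small Y (\<Union>i\<in>J. {i}) F \<epsilon>"
    using assms by (intro countably_small_index_finite_UN) auto
  then show ?thesis by simp
qed

text \<open>The passage from the tolerance 1/9 to every tolerance. Fix a point \<open>p\<close> of a
  piece: a function that is outside the middle range at \<open>p\<close> becomes constant on the
  piece after clipping, and for the finitely many others the piece can be cut as finely as
  desired.\<close>

lemma countably_small_clip:
  assumes small: "countably_small Y J (\<lambda>k. k) (1 / 9)"
    and fin: "\<And>y. y \<in> Y \<Longrightarrow> finite {k \<in> J. k y \<in> {2 * (1 / 9)..1 - 2 * (1 / 9)}}"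
    and "0 < \<epsilon>"
  shows "countably_small Y J (\<lambda>k y. clip (k y)) \<epsilon>"
proof (rule countably_smallE[OF small])
  fix W :: "nat \<Rightarrow> 'a set"
  assume W: "Y \<subseteq> (\<Union>n. W n)"
    "\<And>n x y k. x \<in> W n \<Longrightarrow> y \<in> W n \<Longrightarrow> x \<in> Y \<Longrightarrow> y \<in> Y \<Longrightarrow> k \<in> J \<Longrightarrow> \<bar>k x - k y\<bar> \<le> 1 / 9"
  have "countably_small (W n \<inter> Y) J (\<lambda>k y. clip (k y)) \<epsilon>" for n
  proof (cases "W n \<inter> Y = {}")
    case True
    then show ?thesis by (auto simp: countably_small_def)
  next
    case False
    then obtain p where p: "p \<in> W n" "p \<in> Y" by blast
    define J' where "J' = {k \<in> J. k p \<in> {2 * (1 / 9)..1 - 2 * (1 / 9)}}"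
    have "countably_small (W n \<inter> Y) (J - J') (\<lambda>k y. clip (k y)) \<epsilon>"
    proof (rule countably_smallI[of "{W n}"])
      fix V x y k assume V: "V \<in> {W n}" "x \<in> V" "y \<in> V" "x \<in> W n \<inter> Y" "y \<in> W n \<inter> Y" "k \<in> J - J'"
      then have "\<bar>k x - k p\<bar> \<le> 1 / 9" "\<bar>k y - k p\<bar> \<le> 1 / 9" using W(2) p by auto
      moreover have "k p < 2 / 9 \<or> k p > 7 / 9" using V(6) by (auto simp: J'_def)
      ultimately have "k x \<le> 1 / 3 \<and> k y \<le> 1 / 3 \<or> k x \<ge> 2 / 3 \<and> k y \<ge> 2 / 3" by linarith
      then have "clip (k x) = clip (k y)" by (auto simp: clip_def)
      then show "\<bar>clip (k x) - clip (k y)\<bar> \<le> \<epsilon>" using \<open>0 < \<epsilon>\<close> by simp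
    qed auto
    moreover have "countably_small (W n \<inter> Y) J' (\<lambda>k y. clip (k y)) \<epsilon>"
      using fin[OF p(2)] \<open>0 < \<epsilon>\<close> by (intro countably_small_finite_index) (simp_all add: J'_def)
    ultimately have "countably_small (W n \<inter> Y) ((J - J') \<union> J') (\<lambda>k y. clip (k y)) \<epsilon>"
      by (rule countably_small_index_Un)
    moreover have "(J - J') \<union> J' = J" by (auto simp: J'_def)
    ultimately show ?thesis by simp
  qed
  then have each: "countably_small Z J (\<lambda>k y. clip (k y)) \<epsilon>" if "Z \<in> range (\<lambda>n. W n \<inter> Y)" for Z
    using that by blast
  show ?thesis
    by (rule countably_small_Union[OF _ _ each]) (use W(1) in auto)
qed

text \<open>The length is bounded along with the classes because the oscillation of a product grows
  with the number of factors. The sets increase with \<open>n\<close> and exhaust all lists, so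
  \<open>n\<close> can later be matched with the length of \<open>t\<close>.\<close>

definition monomials_upto :: "('a \<Rightarrow> real) set \<Rightarrow> (('a \<Rightarrow> real) \<Rightarrow> nat) \<Rightarrow> nat \<Rightarrow> ('a \<Rightarrow> real) list set" where
  "monomials_upto \<K> cls n = {ks \<in> lists \<K>. length ks \<le> n \<and> (\<forall>k\<in>set ks. cls k \<le> n)}"

lemma monomials_upto_exhaust:
  assumes "ks \<in> lists \<K>"
  obtains n where "\<And>m. n \<le> m \<Longrightarrow> ks \<in> monomials_upto \<K> cls m"
proof -
  obtain b where "\<And>k. k \<in> set ks \<Longrightarrow> cls k \<le> b"
    using finite_nat_set_iff_bounded_le[of "cls ` set ks"] by auto
  then have "ks \<in> monomials_upto \<K> cls m" if "max b (length ks) \<le> m" for m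
    using assms that by (fastforce simp: monomials_upto_def)
  then show thesis using that by blast
qed

lemma countably_small_monomials:
  assumes small: "\<And>n J \<epsilon>. countable J \<Longrightarrow> J \<subseteq> {k \<in> \<K>. cls k = n} \<Longrightarrow> 0 < \<epsilon> \<Longrightarrow>
      countably_small Y J (\<lambda>k y. clip (k y)) \<epsilon>"
    and J: "countable J" "J \<subseteq> monomials_upto \<K> cls n" and "0 < \<epsilon>"
  shows "countably_small Y J monomial \<epsilon>"
proof -
  define J' where "J' = (\<Union>ks\<in>J. set ks)"
  have J': "countable J'" "J' \<subseteq> {k \<in> \<K>. cls k \<le> n}"
    using J by (auto simp: J'_def monomials_upto_def intro: countable_finite)
  define \<eta> where "\<eta> = \<epsilon> / (real n + 1)"
  have \<eta>: "0 < \<eta>" using \<open>0 < \<epsilon>\<close> by (simp add: \<eta>_def)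
  have "countably_small Y (\<Union>m\<in>{..n}. {k \<in> J'. cls k = m}) (\<lambda>k y. clip (k y)) \<eta>"
    using J' \<eta> by (intro countably_small_index_finite_UN small) (auto intro: countable_subset[of _ J'])
  then have cs: "countably_small Y J' (\<lambda>k y. clip (k y)) \<eta>"
    by (rule countably_small_mono) (use J'(2) in auto)
  show ?thesis
  proof (rule countably_smallE[OF cs])
    fix W :: "nat \<Rightarrow> 'a set"
    assume W: "Y \<subseteq> (\<Union>n. W n)"
      "\<And>n x y k. x \<in> W n \<Longrightarrow> y \<in> W n \<Longrightarrow> x \<in> Y \<Longrightarrow> y \<in> Y \<Longrightarrow> k \<in> J' \<Longrightarrow> \<bar>clip (k x) - clip (k y)\<bar> \<le> \<eta>"
    show ?thesis
    proof (rule countably_smallI[of "range W"])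
      fix V x y ks assume V: "V \<in> range W" "x \<in> V" "y \<in> V" "x \<in> Y" "y \<in> Y" and ks: "ks \<in> J"
      have "\<bar>monomial ks x - monomial ks y\<bar> \<le> real (length ks) * \<eta>"
      proof (rule monomial_diff_le)
        fix k assume "k \<in> set ks"
        then have "k \<in> J'" using ks by (auto simp: J'_def)
        then show "\<bar>clip (k x) - clip (k y)\<bar> \<le> \<eta>" using V W(2) by blast
      qed
      also have "\<dots> \<le> (real n + 1) * \<eta>"
        using ks J(2) \<eta> by (intro mult_right_mono) (auto simp: monomials_upto_def)
      also have "\<dots> = \<epsilon>" by (simp add: \<eta>_def)
      finally show "\<bar>monomial ks x - monomial ks y\<bar> \<le> \<epsilon>" .
    qed (use W(1) in auto)
  qed
qed

section \<open>Polynomials in the coordinates, for Stone-Weierstrass\<close>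

definition poly_eval :: "(real \<times> 'k list) list \<Rightarrow> ('k \<Rightarrow> real) \<Rightarrow> real" where
  "poly_eval p v = (\<Sum>(a, ks)\<leftarrow>p. a * prod_list (map v ks))"

lemma poly_eval_simps:
  "poly_eval [] v = 0" "poly_eval ((a, ks) # p) v = a * prod_list (map v ks) + poly_eval p v"
  by (simp_all add: poly_eval_def)

lemma poly_eval_append: "poly_eval (p @ p') v = poly_eval p v + poly_eval p' v"
  by (simp add: poly_eval_def)

lemma poly_eval_mult_term:
  "poly_eval (map (\<lambda>(b, ls). (a * b, ks @ ls)) p) v = a * prod_list (map v ks) * poly_eval p v"
  by (induction p) (auto simp: poly_eval_simps algebra_simps)

lemma poly_eval_mult:
  "\<exists>q. snd ` set q \<subseteq> lists \<K> \<and> poly_eval q = (\<lambda>v. poly_eval p v * poly_eval p' v)"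
  if "snd ` set p \<subseteq> lists \<K>" "snd ` set p' \<subseteq> lists \<K>"
  using that(1)
proof (induction p)
  case Nil
  show ?case by (rule exI[of _ "[]"]) (auto simp: poly_eval_simps)
next
  case (Cons t p)
  obtain a ks where t: "t = (a, ks)" by (cases t)
  obtain q where q: "snd ` set q \<subseteq> lists \<K>" "poly_eval q = (\<lambda>v. poly_eval p v * poly_eval p' v)"
    using Cons by auto
  define q' where "q' = map (\<lambda>(b, ls). (a * b, ks @ ls)) p' @ q"
  have "snd ` set q' \<subseteq> lists \<K>"
    using Cons.prems that(2) q(1) by (force simp: q'_def t)
  moreover have "poly_eval q' = (\<lambda>v. poly_eval (t # p) v * poly_eval p' v)"
    by (rule ext) (simp add: q'_def t poly_eval_append poly_eval_mult_term poly_eval_simps q(2) distrib_right)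
  ultimately show ?case by blast
qed

lemma continuous_on_poly_eval: "continuous_on S (poly_eval p)"
proof (induction p)
  case Nil
  then show ?case by (simp add: poly_eval_simps)
next
  case (Cons t p)
  obtain a ks where t: "t = (a, ks)" by (cases t)
  have "continuous_on S (\<lambda>v :: 'a \<Rightarrow> real. prod_list (map v ks))"
  proof (induction ks)
    case (Cons k ks)
    have "continuous_on S (\<lambda>v :: 'a \<Rightarrow> real. v k)"
      by (rule continuous_on_subset[OF continuous_on_product_coordinates]) simp
    from continuous_on_mult[OF this Cons]
    have "continuous_on S (\<lambda>v. v k * prod_list (map v ks))" .
    then show ?case by simp
  qed simp
  from continuous_on_add[OF continuous_on_mult_left[OF this, of a] Cons]
  have "continuous_on S (\<lambda>v. a * prod_list (map v ks) + poly_eval p v)" .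
  moreover have "poly_eval (t # p) = (\<lambda>v. a * prod_list (map v ks) + poly_eval p v)"
    by (simp add: fun_eq_iff t poly_eval_simps)
  ultimately show ?case by simp
qed

section \<open>Hausdorff separation for function types\<close>

lemma open_coordinate_vimage:
  fixes W :: "'b :: topological_space set"
  assumes "open W"
  shows "open {h :: 'a \<Rightarrow> 'b. h i \<in> W}"
  using open_vimage[OF assms continuous_on_product_coordinates[of i]] by (simp add: vimage_def)

text \<open>The instances lead to \<open>t2_space\<close>, the class over which
  \<open>function_ring_on\<close> is formulated; it will be used on an image of \<open>K\<close> in
  a type of real-valued functions.\<close>

instance "fun" :: (type, t0_space) t0_space
proof
  fix f g :: "'a \<Rightarrow> 'b"
  assume "f \<noteq> g"
  then obtain i where "f i \<noteq> g i" by auto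
  then have "\<exists>U. open U \<and> \<not> (f i \<in> U \<longleftrightarrow> g i \<in> U)"
    by (rule separation_t0[THEN iffD1])
  then obtain U where "open U \<and> \<not> (f i \<in> U \<longleftrightarrow> g i \<in> U)" ..
  then show "\<exists>U. open U \<and> \<not> (f \<in> U \<longleftrightarrow> g \<in> U)"
    by (intro exI[of _ "{h. h i \<in> U}"]) (auto intro: open_coordinate_vimage)
qed

instance "fun" :: (type, t1_space) t1_space
proof
  fix f g :: "'a \<Rightarrow> 'b"
  assume "f \<noteq> g"
  then obtain i where "f i \<noteq> g i" by auto
  then have "\<exists>U. open U \<and> f i \<in> U \<and> g i \<notin> U"
    by (rule separation_t1[THEN iffD1])
  then obtain U where "open U \<and> f i \<in> U \<and> g i \<notin> U" ..
  then show "\<exists>U. open U \<and> f \<in> U \<and> g \<notin> U"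
    by (intro exI[of _ "{h. h i \<in> U}"]) (auto intro: open_coordinate_vimage)
qed

instance "fun" :: (type, t2_space) t2_space
proof
  fix f g :: "'a \<Rightarrow> 'b"
  assume "f \<noteq> g"
  then obtain i where "f i \<noteq> g i" by auto
  then have "\<exists>U V. open U \<and> open V \<and> f i \<in> U \<and> g i \<in> V \<and> U \<inter> V = {}"
    by (rule hausdorff)
  then obtain U V where "open U \<and> open V \<and> f i \<in> U \<and> g i \<in> V \<and> U \<inter> V = {}" by (elim exE)
  then show "\<exists>U V. open U \<and> open V \<and> f \<in> U \<and> g \<in> V \<and> U \<inter> V = {}"
    by (intro exI[of _ "{h. h i \<in> U}"] exI[of _ "{h. h i \<in> V}"]) (auto intro: open_coordinate_vimage)
qed

lemma Hausdorff_space_euclidean_t2: "Hausdorff_space (euclidean :: 'a :: t2_space topology)"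
  unfolding Hausdorff_space_def using hausdorff by (auto simp: disjnt_def)

text \<open>Agreement on monomials gives agreement on all polynomials in the clipped coordinates,
  and these are dense in C(\<open>K\<close>) by Stone-Weierstrass. For this \<open>K\<close> is
  replaced by its homeomorphic image under all clipped coordinates together.\<close>

lemma functionals_eq_of_monomials_eq:
  assumes K: "compact_space K"
    and \<K>: "\<And>k. k \<in> \<K> \<Longrightarrow> continuous_map K euclideanreal k"
    and sep: "\<And>y y'. y \<in> topspace K \<Longrightarrow> y' \<in> topspace K \<Longrightarrow> y \<noteq> y' \<Longrightarrow> \<exists>k\<in>\<K>. clip (k y) \<noteq> clip (k y')"
    and \<mu>: "bounded_functional K c \<mu>" and \<nu>: "bounded_functional K c \<nu>"
    and eq: "\<And>ks. ks \<in> lists \<K> \<Longrightarrow> \<mu> (monomial ks) = \<nu> (monomial ks)"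
    and g: "continuous_map K euclideanreal g"
  shows "\<mu> g = \<nu> g"
proof -
  interpret \<mu>: bounded_functional K c \<mu> by fact
  interpret \<nu>: bounded_functional K c \<nu> by fact
  \<comment> \<open>The value 0 outside \<open>\<K>\<close> ensures that a coordinate separating two
    points of the image belongs to \<open>\<K>\<close>.\<close>
  define \<Phi> where "\<Phi> y k = (if k \<in> \<K> then clip (k y) else 0)" for y k
  define S where "S = \<Phi> ` topspace K"
  have c\<Phi>: "continuous_map K euclidean \<Phi>"
    unfolding euclidean_product_topology[symmetric] continuous_map_componentwise_UNIV
    by (auto simp: \<Phi>_def \<K> intro: continuous_map_clip)
  have inj: "inj_on \<Phi> (topspace K)"
  proof (rule inj_onI, rule ccontr)
    fix y y' assume "y \<in> topspace K" "y' \<in> topspace K" "\<Phi> y = \<Phi> y'" "y \<noteq> y'"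
    then obtain k where "k \<in> \<K>" "clip (k y) \<noteq> clip (k y')" using sep by blast
    with \<open>\<Phi> y = \<Phi> y'\<close> show False by (metis \<Phi>_def)
  qed
  have "homeomorphic_map K (top_of_set S) \<Phi>"
  proof (rule continuous_imp_homeomorphic_map[OF _ K])
    show "Hausdorff_space (top_of_set S)" by (intro Hausdorff_space_subtopology Hausdorff_space_euclidean_t2)
    show "continuous_map K (top_of_set S) \<Phi>"
      using c\<Phi> by (auto simp: continuous_map_in_subtopology S_def)
  qed (use inj in \<open>simp_all add: S_def\<close>)
  then obtain \<Psi> where \<Psi>: "homeomorphic_maps K (top_of_set S) \<Phi> \<Psi>"
    using homeomorphic_map_maps by blast
  then have "continuous_map (top_of_set S) K \<Psi>" by (simp add: homeomorphic_maps_def)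
  from continuous_map_compose[OF this g]
  have gS: "continuous_on S (g \<circ> \<Psi>)" by simp
  have cS: "compact S"
    using image_compactin[OF _ c\<Phi>, of "topspace K"] K by (simp add: S_def compact_space_def)
  define R where "R = {f. \<exists>p. snd ` set p \<subseteq> lists \<K> \<and> f = poly_eval p}"
  interpret function_ring_on R S
  proof
    show "continuous_on S f" if "f \<in> R" for f
      using that continuous_on_poly_eval by (auto simp: R_def)
    show "(\<lambda>x. f x + h x) \<in> R" if fh: "f \<in> R" "h \<in> R" for f h
    proof -
      obtain p q where pq: "snd ` set p \<subseteq> lists \<K>" "snd ` set q \<subseteq> lists \<K>" "f = poly_eval p" "h = poly_eval q"
        using fh by (auto simp: R_def)
      then show ?thesis unfolding R_def
        by (intro CollectI exI[of _ "p @ q"]) (auto simp: poly_eval_append)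
    qed
    show "(\<lambda>x. f x * h x) \<in> R" if fh: "f \<in> R" "h \<in> R" for f h
    proof -
      obtain p q where pq: "snd ` set p \<subseteq> lists \<K>" "snd ` set q \<subseteq> lists \<K>" "f = poly_eval p" "h = poly_eval q"
        using fh by (auto simp: R_def)
      obtain r where "snd ` set r \<subseteq> lists \<K>" "poly_eval r = (\<lambda>v. poly_eval p v * poly_eval q v)"
        using poly_eval_mult[OF pq(1,2)] by blast
      then show ?thesis unfolding R_def pq(3,4) by (metis (mono_tags, lifting) mem_Collect_eq)
    qed
    show "(\<lambda>_. c) \<in> R" for c
      unfolding R_def by (intro CollectI exI[of _ "[(c, [])]"]) (auto simp: poly_eval_simps)
    show "\<exists>f\<in>R. f x \<noteq> f y" if xy: "x \<in> S" "y \<in> S" "x \<noteq> y" for x y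
    proof -
      obtain k where k: "x k \<noteq> y k" using xy(3) by auto
      then have "k \<in> \<K>" using xy by (auto simp: S_def \<Phi>_def split: if_splits)
      then have "poly_eval [(1, [k])] \<in> R" unfolding R_def by (intro CollectI exI[of _ "[(1, [k])]"]) simp
      then show ?thesis using k by (intro bexI[of _ "poly_eval [(1, [k])]"]) (auto simp: poly_eval_simps)
    qed
  qed (rule cS)
  have poly: "continuous_map K euclideanreal (\<lambda>y. poly_eval p (\<Phi> y)) \<and>
      \<mu> (\<lambda>y. poly_eval p (\<Phi> y)) = \<nu> (\<lambda>y. poly_eval p (\<Phi> y))" if "snd ` set p \<subseteq> lists \<K>" for p
    using that
  proof (induction p)
    case Nil
    then show ?case by (simp add: poly_eval_simps \<mu>.zero \<nu>.zero)
  next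
    case (Cons t p)
    obtain a ks where t: "t = (a, ks)" by (cases t)
    have ks: "ks \<in> lists \<K>" using Cons.prems t by auto
    then have mk: "map (\<Phi> y) ks = map (\<lambda>k. clip (k y)) ks" for y
      by (auto simp: \<Phi>_def in_lists_conv_set)
    have e: "(\<lambda>y. poly_eval (t # p) (\<Phi> y)) = (\<lambda>y. a * monomial ks y + 1 * poly_eval p (\<Phi> y))"
      by (rule ext) (simp only: t poly_eval_simps monomial_def mk mult_1)
    have m: "continuous_map K euclideanreal (monomial ks)"
      using ks \<K> by (intro continuous_map_monomial) auto
    have IH: "continuous_map K euclideanreal (\<lambda>y. poly_eval p (\<Phi> y))"
      "\<mu> (\<lambda>y. poly_eval p (\<Phi> y)) = \<nu> (\<lambda>y. poly_eval p (\<Phi> y))"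
      using Cons by auto
    show ?case
      unfolding e \<mu>.linear[OF m IH(1)] \<nu>.linear[OF m IH(1)]
      using IH eq[OF ks] m by (auto intro!: continuous_map_add continuous_map_real_mult)
  qed
  \<comment> \<open>The added 1 keeps the factor positive when \<open>c\<close> is 0, for the
    division that follows.\<close>
  have "\<bar>\<mu> g - \<nu> g\<bar> \<le> (2 * c + 1) * e" if "0 < e" for e
  proof -
    obtain f where f: "f \<in> R" "\<And>x. x \<in> S \<Longrightarrow> \<bar>(g \<circ> \<Psi>) x - f x\<bar> < e"
      using Stone_Weierstrass_basic[OF gS \<open>0 < e\<close>] by blast
    then obtain p where p: "snd ` set p \<subseteq> lists \<K>" "f = poly_eval p" by (auto simp: R_def)
    define h where "h y = poly_eval p (\<Phi> y)" for y
    have h: "continuous_map K euclideanreal h" "\<mu> h = \<nu> h"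
      using poly[OF p(1)] by (auto simp: h_def[abs_def])
    have close: "\<bar>g y - h y\<bar> \<le> e" if "y \<in> topspace K" for y
    proof -
      have "\<Psi> (\<Phi> y) = y" "\<Phi> y \<in> S" using \<Psi> that by (auto simp: homeomorphic_maps_def S_def)
      then show ?thesis using f(2)[of "\<Phi> y"] p(2) by (simp add: h_def)
    qed
    have d: "continuous_map K euclideanreal (\<lambda>y. g y - h y)"
      using g h(1) by (rule continuous_map_diff)
    have "\<bar>\<mu> (\<lambda>y. g y - h y)\<bar> \<le> c * e" "\<bar>\<nu> (\<lambda>y. g y - h y)\<bar> \<le> c * e"
      using \<mu>.bounded[OF d _ close] \<nu>.bounded[OF d _ close] \<open>0 < e\<close> by auto
    then have "\<bar>\<mu> g - \<nu> g\<bar> \<le> c * e + c * e"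
      using \<mu>.diff[OF g h(1)] \<nu>.diff[OF g h(1)] h(2) by linarith
    also have "\<dots> \<le> (2 * c + 1) * e" using \<open>0 < e\<close> by (simp add: algebra_simps)
    finally show ?thesis .
  qed
  then have "\<bar>\<mu> g - \<nu> g\<bar> \<le> e" if "0 < e" for e
  proof -
    have pos: "0 < 2 * c + 1" using \<mu>.bound_nonneg by simp
    have "\<bar>\<mu> g - \<nu> g\<bar> \<le> (2 * c + 1) * (e / (2 * c + 1))"
      using \<open>\<And>e. 0 < e \<Longrightarrow> \<bar>\<mu> g - \<nu> g\<bar> \<le> (2 * c + 1) * e\<close>[of "e / (2 * c + 1)"] pos that by simp
    then show ?thesis using pos by simp
  qed
  then show ?thesis by (metis abs_le_zero_iff dense_ge eq_iff_diff_eq_0)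
qed

section \<open>The Cantor set\<close>

lemma topspace_cantor [simp]: "topspace cantor_topology = UNIV"
  by (simp add: cantor_topology_def)

lemma openin_cantor:
  "openin cantor_topology U \<longleftrightarrow> (\<forall>z\<in>U. \<exists>n. \<forall>z'. (\<forall>i<n. z' i = z i) \<longrightarrow> z' \<in> U)"
proof
  assume U: "openin cantor_topology U"
  show "\<forall>z\<in>U. \<exists>n. \<forall>z'. (\<forall>i<n. z' i = z i) \<longrightarrow> z' \<in> U"
  proof
    fix z assume "z \<in> U"
    then obtain V :: "nat \<Rightarrow> bool set" where V: "finite {i. V i \<noteq> UNIV}" "z \<in> Pi\<^sub>E UNIV V" "Pi\<^sub>E UNIV V \<subseteq> U"
      using U unfolding cantor_topology_def openin_product_topology_alt by auto
    obtain n where n: "\<forall>i\<in>{i. V i \<noteq> UNIV}. i < n"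
      using V(1) finite_nat_set_iff_bounded by blast
    have "z' \<in> U" if z': "\<forall>i<n. z' i = z i" for z'
    proof -
      have "z' i \<in> V i" for i
      proof (cases "V i = UNIV")
        case False
        then show ?thesis using n z' V(2) by (auto simp: PiE_iff)
      qed simp
      then show ?thesis using V(3) by auto
    qed
    then show "\<exists>n. \<forall>z'. (\<forall>i<n. z' i = z i) \<longrightarrow> z' \<in> U" by blast
  qed
next
  assume U: "\<forall>z\<in>U. \<exists>n. \<forall>z'. (\<forall>i<n. z' i = z i) \<longrightarrow> z' \<in> U"
  show "openin cantor_topology U"
    unfolding cantor_topology_def openin_product_topology_alt
  proof
    fix z assume "z \<in> U"
    then obtain n where n: "\<And>z'. (\<forall>i<n. z' i = z i) \<Longrightarrow> z' \<in> U" using U by blast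
    define V where "V i = (if i < n then {z i} else UNIV)" for i
    have "finite {i. V i \<noteq> UNIV}" by (rule finite_subset[of _ "{..<n}"]) (auto simp: V_def split: if_splits)
    moreover have "Pi\<^sub>E UNIV V \<subseteq> U"
    proof
      fix z' assume "z' \<in> Pi\<^sub>E UNIV V"
      then have "z' i \<in> V i" for i by auto
      then have "z' i = z i" if "i < n" for i using that by (metis V_def singletonD)
      then show "z' \<in> U" using n by blast
    qed
    moreover have "z \<in> Pi\<^sub>E UNIV V" by (auto simp: V_def)
    ultimately show "\<exists>V. finite {i \<in> UNIV. V i \<noteq> topspace (discrete_topology UNIV)} \<and>
        (\<forall>i\<in>UNIV. openin (discrete_topology UNIV) (V i)) \<and> z \<in> Pi\<^sub>E UNIV V \<and> Pi\<^sub>E UNIV V \<subseteq> U"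
      by (intro exI[of _ V]) auto
  qed
qed

lemma compact_space_cantor: "compact_space cantor_topology"
  unfolding cantor_topology_def
  by (simp add: compact_space_product_topology compact_space_discrete_topology)

lemma openin_cylinder: "openin cantor_topology {z'. \<forall>i<n. z' i = z i}"
  by (auto simp: openin_cantor)

lemma cantor_uniformly_continuous:
  assumes g: "continuous_map cantor_topology euclideanreal g" and "0 < \<epsilon>"
  obtains N where "\<And>z z'. (\<forall>i<N. z i = z' i) \<Longrightarrow> \<bar>g z - g z'\<bar> \<le> \<epsilon>"
proof -
  have "\<exists>n. \<forall>z'. (\<forall>i<n. z' i = z i) \<longrightarrow> \<bar>g z' - g z\<bar> < \<epsilon> / 2" for z
  proof -
    have "openin cantor_topology {z' \<in> topspace cantor_topology. g z' \<in> ball (g z) (\<epsilon> / 2)}"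
      by (rule openin_continuous_map_preimage[OF g]) simp
    then have "\<forall>y\<in>{z'. g z' \<in> ball (g z) (\<epsilon> / 2)}. \<exists>n. \<forall>z'. (\<forall>i<n. z' i = y i) \<longrightarrow> z' \<in> {z'. g z' \<in> ball (g z) (\<epsilon> / 2)}"
      by (simp only: openin_cantor) simp
    from bspec[OF this, of z] show ?thesis using \<open>0 < \<epsilon>\<close> by (auto simp: dist_real_def abs_minus_commute)
  qed
  then obtain n where n: "\<And>z z'. (\<forall>i<n z. z' i = z i) \<Longrightarrow> \<bar>g z' - g z\<bar> < \<epsilon> / 2" by metis
  define V where "V z = {z'. \<forall>i<n z. z' i = z i}" for z
  have "\<exists>\<F>. finite \<F> \<and> \<F> \<subseteq> range V \<and> topspace cantor_topology \<subseteq> \<Union>\<F>"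
    by (rule compact_space_cantor[unfolded compact_space_alt, rule_format])
       (auto simp: V_def openin_cylinder)
  then obtain S where S: "finite S" "UNIV \<subseteq> \<Union>(V ` S)"
    by (metis finite_subset_image topspace_cantor)
  obtain N where N: "\<And>z. z \<in> S \<Longrightarrow> n z \<le> N"
    using S(1) finite_nat_set_iff_bounded_le[of "n ` S"] by auto
  have "\<bar>g z - g z'\<bar> \<le> \<epsilon>" if eq: "\<forall>i<N. z i = z' i" for z z'
  proof -
    obtain y where y: "y \<in> S" "z \<in> V y" using S(2) by blast
    then have "\<bar>g z - g y\<bar> < \<epsilon> / 2" "\<bar>g z' - g y\<bar> < \<epsilon> / 2"
      using n[of y z] n[of y z'] N[OF y(1)] eq by (auto simp: V_def)
    then show ?thesis by linarith
  qed
  then show thesis using that by blast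
qed

section \<open>Binary expansions and their behaviour under \<open>Gamma\<close>\<close>

lemma summable_dyadic: "summable (\<lambda>k. of_bool (z k) * (1 / 2 :: real) ^ Suc k)"
  by (rule summable_comparison_test'[of "\<lambda>k. (1 / 2 :: real) ^ k" 0]) (auto simp: summable_geometric)

lemma dyadic_Suc: "dyadic z = of_bool (z 0) / 2 + dyadic (\<lambda>n. z (Suc n)) / 2"
proof -
  have "dyadic z = (\<Sum>k. of_bool (z (Suc k)) * (1 / 2) ^ Suc (Suc k)) + of_bool (z 0) * (1 / 2)"
    unfolding dyadic_def using suminf_split_head[OF summable_dyadic[of z]] by simp
  also have "(\<Sum>k. of_bool (z (Suc k)) * (1 / 2 :: real) ^ Suc (Suc k)) =
      (\<Sum>k. 1 / 2 * (of_bool (z (Suc k)) * (1 / 2) ^ Suc k))"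
    by (rule suminf_cong) simp
  also have "\<dots> = 1 / 2 * dyadic (\<lambda>n. z (Suc n))"
    unfolding dyadic_def by (rule suminf_mult) (rule summable_dyadic)
  finally show ?thesis by simp
qed

lemma dyadic_False: "dyadic (\<lambda>_. False) = 0"
  by (simp add: dyadic_def)

lemma dyadic_True: "dyadic (\<lambda>_. True) = 1"
  using dyadic_Suc[of "\<lambda>_. True"] by simp

lemma dyadic_range: "0 \<le> dyadic z" "dyadic z \<le> 1"
proof -
  show "0 \<le> dyadic z"
    unfolding dyadic_def by (rule suminf_nonneg[OF summable_dyadic]) simp
  have "dyadic z \<le> dyadic (\<lambda>_. True)"
    unfolding dyadic_def by (rule suminf_le[OF _ summable_dyadic summable_dyadic]) simp
  then show "dyadic z \<le> 1" by (simp add: dyadic_True)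
qed

lemma dyadic_close:
  assumes "\<forall>i<n. z i = z' i"
  shows "\<bar>dyadic z - dyadic z'\<bar> \<le> (1 / 2) ^ n"
  using assms
proof (induction n arbitrary: z z')
  case 0
  show ?case using dyadic_range[of z] dyadic_range[of z'] by auto
next
  case (Suc n)
  have "\<bar>dyadic (\<lambda>n. z (Suc n)) - dyadic (\<lambda>n. z' (Suc n))\<bar> \<le> (1 / 2) ^ n"
    by (rule Suc.IH) (use Suc.prems in auto)
  moreover have "z 0 = z' 0" using Suc.prems by auto
  ultimately show ?case unfolding dyadic_Suc[of z] dyadic_Suc[of z'] by (simp add: abs_if split: if_splits)
qed

lemma concat_seq_append: "concat_seq (s @ t) z = concat_seq s (concat_seq t z)"
  by (auto simp: concat_seq_def fun_eq_iff nth_append)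

lemma dyadic_concat_Cons: "dyadic (concat_seq (b # t) z) = of_bool b / 2 + dyadic (concat_seq t z) / 2"
  by (subst dyadic_Suc) (simp add: concat_seq_def)

lemma concat_seq_Nil [simp]: "concat_seq [] z = z"
  by (simp add: concat_seq_def)

lemma dyadic_concat_cong:
  assumes "dyadic z = dyadic z'"
  shows "dyadic (concat_seq t z) = dyadic (concat_seq t z')"
  by (induction t) (simp_all add: dyadic_concat_Cons assms)

lemma concat_seq_append_const: "concat_seq (t @ [b]) (\<lambda>_. b) = concat_seq t (\<lambda>_. b)"
proof -
  have "concat_seq [b] (\<lambda>_. b) = (\<lambda>_. b)" by (auto simp: concat_seq_def fun_eq_iff)
  then show ?thesis by (simp add: concat_seq_append)
qed

text \<open>The two expansions 0111... and 1000... of one number. This makes neighbouring dyadic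
  intervals share an endpoint; in the Cantor set the corresponding cylinders are disjoint and the
  final summation would break down.\<close>

lemma dyadic_midpoint:
  "dyadic (concat_seq (t @ [False]) (\<lambda>_. True)) = dyadic (concat_seq (t @ [True]) (\<lambda>_. False))"
  unfolding concat_seq_append
  by (rule dyadic_concat_cong) (simp add: dyadic_concat_Cons dyadic_True dyadic_False)

lemma Gamma_eq_concat: "\<exists>w. Gamma s t z = concat_seq t w"
  by (auto simp: Gamma_def)

lemma dyadic_Gamma_close: "\<bar>dyadic (Gamma s t z) - dyadic (Gamma s t z')\<bar> \<le> (1 / 2) ^ length t"
proof -
  obtain w w' where "Gamma s t z = concat_seq t w" "Gamma s t z' = concat_seq t w'"
    using Gamma_eq_concat by metis
  then show ?thesis by (intro dyadic_close) (simp add: concat_seq_def)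
qed

text \<open>The first \<open>length s\<close> digits decide which case of \<open>Gamma\<close>
  applies, and \<open>k\<close> further digits then fix the first \<open>k\<close> digits of the
  value.\<close>

lemma dyadic_Gamma_close':
  assumes "\<forall>i<length s + k. z i = z' i"
  shows "\<bar>dyadic (Gamma s t z) - dyadic (Gamma s t z')\<bar> \<le> (1 / 2) ^ k"
proof (rule dyadic_close)
  have less: "cantor_less_fin y' s" if "cantor_less_fin y s" "\<forall>i<length s. y i = y' i" for y y'
  proof -
    obtain k where "k < length s" "y k < s ! k" "\<forall>i<k. y i = s ! i"
      using \<open>cantor_less_fin y s\<close> unfolding cantor_less_fin_def by blast
    then show ?thesis
      unfolding cantor_less_fin_def using that(2) by (intro exI[of _ k]) simp
  qed
  have gt: "fin_less_cantor s y'" if "fin_less_cantor s y" "\<forall>i<length s. y i = y' i" for y y'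
  proof -
    obtain k where "k < length s" "s ! k < y k" "\<forall>i<k. s ! i = y i"
      using \<open>fin_less_cantor s y\<close> unfolding fin_less_cantor_def by blast
    then show ?thesis
      unfolding fin_less_cantor_def using that(2) by (intro exI[of _ k]) simp
  qed
  have "cantor_less_fin z s \<longleftrightarrow> cantor_less_fin z' s" "fin_less_cantor s z \<longleftrightarrow> fin_less_cantor s z'"
    using less[of z z'] less[of z' z] gt[of z z'] gt[of z' z] assms by auto
  then show "\<forall>i<k. Gamma s t z i = Gamma s t z' i"
    using assms by (auto simp: Gamma_def concat_seq_def)
qed

section \<open>The fibres of \<open>\<bbbL>\<^sub>1\<close> over \<open>M\<close>\<close>

context basic_space
begin

abbreviation AA where "AA \<equiv> \<Union>t. A t"
abbreviation LL where "LL \<equiv> L_topology M AA (B \<union> C)"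
abbreviation XX where "XX \<equiv> L1_space M A B C Cx \<psi>"
abbreviation ff where "ff \<equiv> f_map A Cx \<psi>"

lemma B_not_AA: "y \<in> B \<Longrightarrow> y \<notin> A t" and C_not_AA: "y \<in> C \<Longrightarrow> y \<notin> A t"
  using disjoint_AB disjoint_AC by auto

lemma topspace_LL: "topspace LL = L_points AA (B \<union> C)"
  using points disjoint_AB disjoint_AC by (intro topspace_L_topology) auto

text \<open>The part of \<open>L\<close> over \<open>U\<close>; for open \<open>U\<close> these sets
  are the basic neighbourhoods of the points \<open>Inr y\<close>.\<close>

definition tube :: "'m set \<Rightarrow> 'm lpoint set" where
  "tube U = Inl ` ((U \<inter> AA) \<times> UNIV) \<union> Inr ` (U - AA)"

lemma Inl_in_tube [simp]: "Inl (a, z) \<in> tube U \<longleftrightarrow> a \<in> U \<and> a \<in> AA"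
  and Inr_in_tube [simp]: "Inr y \<in> tube U \<longleftrightarrow> y \<in> U \<and> y \<notin> AA"
  by (auto simp: tube_def)

lemma openin_tube:
  assumes "openin M U"
  shows "openin LL (tube U)"
proof -
  have "tube U \<subseteq> L_points AA (B \<union> C)"
    using openin_subset[OF assms] points by (auto simp: tube_def L_points_def)
  moreover have "openin cantor_topology UNIV"
    using openin_topspace[of cantor_topology] by simp
  ultimately show ?thesis
    unfolding openin_L_topology L_open_def using assms by (fastforce simp: tube_def)
qed

lemma openin_LL_fibre:
  assumes "a \<in> AA" "openin cantor_topology U"
  shows "openin LL (Inl ` ({a} \<times> U))"
  unfolding openin_L_topology L_open_def using assms by (auto simp: L_points_def)

lemma continuous_map_Inl:
  assumes "a \<in> AA"
  shows "continuous_map cantor_topology LL (\<lambda>z. Inl (a, z))"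
  unfolding continuous_map_def topspace_LL
proof (intro conjI allI impI)
  show "(\<lambda>z. Inl (a, z)) \<in> topspace cantor_topology \<rightarrow> L_points AA (B \<union> C)"
    using assms by (auto simp: L_points_def)
  fix W assume "openin LL W"
  then have W: "L_open M AA (B \<union> C) W" by (simp add: openin_L_topology)
  have "\<exists>n. \<forall>z'. (\<forall>i<n. z' i = z i) \<longrightarrow> Inl (a, z') \<in> W" if "Inl (a, z) \<in> W" for z
  proof -
    obtain U where U: "openin cantor_topology U" "z \<in> U" "Inl ` ({a} \<times> U) \<subseteq> W"
      using W \<open>Inl (a, z) \<in> W\<close> unfolding L_open_def by blast
    then obtain n where "\<forall>z'. (\<forall>i<n. z' i = z i) \<longrightarrow> z' \<in> U" unfolding openin_cantor by blast
    then show ?thesis using U(3) by blast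
  qed
  then show "openin cantor_topology {z \<in> topspace cantor_topology. Inl (a, z) \<in> W}"
    unfolding openin_cantor by auto
qed

text \<open>A finite subfamily that covers the fibre over a point \<open>p\<close> of
  \<open>M\<close> already covers a tube around it: over \<open>{p}\<close> if \<open>p\<close> is
  in \<open>AA\<close>, and by the choice of neighbourhoods otherwise. Compactness of
  \<open>M\<close> does the rest.\<close>

lemma compact_LL: "compact_space LL"
  unfolding compact_space_alt
proof (intro allI impI)
  fix \<U> assume \<U>: "(\<forall>U\<in>\<U>. openin LL U) \<and> topspace LL \<subseteq> \<Union>\<U>"
  have "\<exists>V \<F>. openin M V \<and> p \<in> V \<and> finite \<F> \<and> \<F> \<subseteq> \<U> \<and> tube V \<subseteq> \<Union>\<F>" if p: "p \<in> topspace M" for p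
  proof (cases "p \<in> AA")
    case True
    have cpt: "compactin LL ((\<lambda>z. Inl (p, z)) ` UNIV)"
      using image_compactin[OF _ continuous_map_Inl[OF True], of UNIV] compact_space_cantor
      by (simp add: compact_space_def)
    have "(\<lambda>z. Inl (p, z)) ` UNIV \<subseteq> topspace LL"
      using True by (auto simp: topspace_LL L_points_def)
    then have "(\<lambda>z. Inl (p, z)) ` UNIV \<subseteq> \<Union>\<U>"
      by (rule order_trans[OF _ \<U>[THEN conjunct2]])
    then have "\<exists>\<F>. finite \<F> \<and> \<F> \<subseteq> \<U> \<and> (\<lambda>z. Inl (p, z)) ` UNIV \<subseteq> \<Union>\<F>"
      by (intro compactinD[OF cpt]) (use \<U> in auto)
    then obtain \<F> where "finite \<F>" "\<F> \<subseteq> \<U>" "(\<lambda>z. Inl (p, z)) ` UNIV \<subseteq> \<Union>\<F>"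
      by blast
    moreover have "tube {p} = (\<lambda>z. Inl (p, z)) ` UNIV" using True by (auto simp: tube_def)
    ultimately show ?thesis
      by (intro exI[of _ "{p}"] exI[of _ \<F>]) (simp add: isolated[OF True])
  next
    case False
    then have "Inr p \<in> topspace LL" using p points by (auto simp: topspace_LL L_points_def)
    then obtain W where W: "W \<in> \<U>" "Inr p \<in> W" using \<U> by blast
    then have "L_open M AA (B \<union> C) W" using \<U> by (simp add: openin_L_topology)
    then obtain V where "openin M V" "p \<in> V" "tube V \<subseteq> W"
      using W(2) unfolding L_open_def tube_def by blast
    then show ?thesis using W(1) by (intro exI[of _ V] exI[of _ "{W}"]) auto
  qed
  then obtain V \<F> where V: "\<And>p. p \<in> topspace M \<Longrightarrow> openin M (V p) \<and> p \<in> V p \<and> finite (\<F> p) \<and>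
      \<F> p \<subseteq> \<U> \<and> tube (V p) \<subseteq> \<Union>(\<F> p)"
    by metis
  have "\<exists>\<G>. finite \<G> \<and> \<G> \<subseteq> V ` topspace M \<and> topspace M \<subseteq> \<Union>\<G>"
    by (rule compact[unfolded compact_space_alt, rule_format]) (use V in blast)
  then obtain S where S: "finite S" "S \<subseteq> topspace M" "topspace M \<subseteq> \<Union>(V ` S)"
    by (metis finite_subset_image)
  have "topspace LL \<subseteq> \<Union>(\<Union>p\<in>S. \<F> p)"
  proof
    fix u assume u: "u \<in> topspace LL"
    have "\<exists>q\<in>topspace M. \<forall>U. q \<in> U \<longrightarrow> u \<in> tube U"
    proof (cases u)
      case (Inl q)
      then show ?thesis using u points
        by (intro bexI[of _ "fst q"]) (auto simp: topspace_LL L_points_def)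
    next
      case (Inr y)
      then show ?thesis using u points
        by (intro bexI[of _ y]) (auto simp: topspace_LL L_points_def dest: B_not_AA C_not_AA)
    qed
    then obtain q where q: "q \<in> topspace M" "\<And>U. q \<in> U \<Longrightarrow> u \<in> tube U" by blast
    then obtain p where "p \<in> S" "q \<in> V p" using S(3) by blast
    then show "u \<in> \<Union>(\<Union>p\<in>S. \<F> p)" using q(2)[of "V p"] V[of p] S(2) by blast
  qed
  moreover have "finite (\<Union>p\<in>S. \<F> p)" "(\<Union>p\<in>S. \<F> p) \<subseteq> \<U>" using S V by blast+
  ultimately show "\<exists>\<F>. finite \<F> \<and> \<F> \<subseteq> \<U> \<and> topspace LL \<subseteq> \<Union>\<F>" by blast
qed

lemma ff_Inr [simp]: "ff x (Inr y) = 0"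
  by (simp add: f_map_def g_map_def dyadic_False)

lemma ff_outside: "a \<notin> Cx x \<Longrightarrow> ff x (Inl (a, z)) = 0"
  by (simp add: f_map_def g_map_def dyadic_False)

lemma ff_inside:
  assumes "a \<in> Cx x" "a \<in> A t"
  shows "ff x (Inl (a, z)) = dyadic (Gamma (\<psi> x t) t z)"
proof -
  have "(THE t. a \<in> A t) = t"
  proof (rule the_equality)
    fix s assume "a \<in> A s"
    then show "s = t" using disjoint_A assms(2) by (auto simp: disjoint_family_on_def)
  qed (rule assms(2))
  then show ?thesis using assms(1) by (simp add: f_map_def g_map_def)
qed

lemma ff_range: "0 \<le> ff x u \<and> ff x u \<le> 1"
  by (simp add: f_map_def dyadic_range)

lemma continuous_map_ff_fibre:
  assumes "a \<in> AA"
  shows "continuous_map cantor_topology euclideanreal (\<lambda>z. ff x (Inl (a, z)))"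
proof (cases "a \<in> Cx x")
  case False
  then show ?thesis by (simp add: ff_outside)
next
  case True
  obtain t where t: "a \<in> A t" using assms by blast
  have "openin cantor_topology {z. ff x (Inl (a, z)) \<in> U}" if U: "open U" for U
    unfolding openin_cantor
  proof
    fix z assume "z \<in> {z. ff x (Inl (a, z)) \<in> U}"
    then obtain e where e: "0 < e" "\<And>r. \<bar>r - ff x (Inl (a, z))\<bar> < e \<Longrightarrow> r \<in> U"
      using U by (auto simp: open_dist dist_real_def)
    obtain k where k: "(1 / 2 :: real) ^ k < e" using real_arch_pow_inv[OF e(1), of "1 / 2"] by auto
    have "z' \<in> {z. ff x (Inl (a, z)) \<in> U}" if "\<forall>i<length (\<psi> x t) + k. z' i = z i" for z'
      using dyadic_Gamma_close'[OF that, of t] k e(2) by (simp add: ff_inside[OF True t])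
    then show "\<exists>n. \<forall>z'. (\<forall>i<n. z' i = z i) \<longrightarrow> z' \<in> {z. ff x (Inl (a, z)) \<in> U}" by blast
  qed
  then show ?thesis by (simp add: continuous_map_def)
qed

section \<open>Points of \<open>XX\<close>, fibre by fibre over \<open>M\<close>\<close>

definition on_fibre :: "'m \<Rightarrow> cantor \<Rightarrow> 'm lpoint \<times> ('m \<Rightarrow> real)" where
  "on_fibre a z = (Inl (a, z), \<lambda>x\<in>B. ff x (Inl (a, z)))"

text \<open>Over \<open>y\<close> in \<open>B\<close> only the coordinate at \<open>y\<close> is
  free, the others being 0 since \<open>ff x\<close> vanishes at \<open>Inr y\<close>. For
  \<open>y\<close> in \<open>C\<close> no index equals \<open>y\<close>, and the fibre is a single
  point.\<close>

definition on_interval :: "'m \<Rightarrow> real \<Rightarrow> 'm lpoint \<times> ('m \<Rightarrow> real)" where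
  "on_interval y r = (Inr y, \<lambda>x\<in>B. if x = y then r else 0)"

definition proj :: "'m lpoint \<times> ('m \<Rightarrow> real) \<Rightarrow> 'm" where
  "proj w = (case fst w of Inl (a, z) \<Rightarrow> a | Inr y \<Rightarrow> y)"

lemma proj_simps [simp]: "proj (on_fibre a z) = a" "proj (on_interval y r) = y"
  by (simp_all add: proj_def on_fibre_def on_interval_def)

lemma snd_on_fibre [simp]: "x \<in> B \<Longrightarrow> snd (on_fibre a z) x = ff x (Inl (a, z))"
  by (simp add: on_fibre_def)

lemma snd_on_interval [simp]: "x \<in> B \<Longrightarrow> snd (on_interval x r) x = r"
  by (simp add: on_interval_def)

abbreviation PP where "PP \<equiv> product_topology (\<lambda>_ :: 'm. top_of_set {0..1 :: real}) B"

lemma topspace_PP: "topspace PP = (\<Pi>\<^sub>E x\<in>B. {0..1})"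
  by simp

lemma topspace_XX: "topspace XX = {(u, v). u \<in> L_points AA (B \<union> C) \<and> v \<in> (\<Pi>\<^sub>E x\<in>B. {0..1}) \<and>
    (\<forall>x\<in>B. u \<noteq> Inr x \<longrightarrow> ff x u = v x)}"
  unfolding L1_space_def topspace_subtopology topspace_prod_topology topspace_LL topspace_PP by auto

lemma on_fibre_in_XX: "a \<in> AA \<Longrightarrow> on_fibre a z \<in> topspace XX"
  using ff_range by (auto simp: topspace_XX on_fibre_def L_points_def)

lemma on_interval_in_XX: "y \<in> B \<Longrightarrow> r \<in> {0..1} \<Longrightarrow> on_interval y r \<in> topspace XX"
  by (auto simp: topspace_XX on_interval_def L_points_def)

lemma on_interval_C: "y \<in> C \<Longrightarrow> on_interval y r = on_interval y 0"
  using disjoint_BC unfolding on_interval_def prod.inject by (intro conjI restrict_ext) auto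

lemma on_interval_in_XX_C: "y \<in> C \<Longrightarrow> on_interval y r \<in> topspace XX"
  using disjoint_BC by (auto simp: topspace_XX on_interval_def L_points_def)

lemma XX_fibre:
  assumes w: "w \<in> topspace XX" and "proj w = a" "a \<in> AA"
  obtains z where "w = on_fibre a z"
proof -
  obtain u v where uv: "w = (u, v)" by (cases w)
  have u: "u \<in> L_points AA (B \<union> C)" and v: "v \<in> (\<Pi>\<^sub>E x\<in>B. {0..1})"
    and f: "\<And>x. x \<in> B \<Longrightarrow> u \<noteq> Inr x \<Longrightarrow> ff x u = v x"
    using w by (auto simp: topspace_XX uv)
  obtain z where "u = Inl (a, z)"
    using u assms(2,3) uv by (auto simp: L_points_def proj_def dest: B_not_AA C_not_AA)
  moreover then have "v = (\<lambda>x\<in>B. ff x (Inl (a, z)))"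
    using f v by (auto simp: fun_eq_iff PiE_iff extensional_def)
  ultimately show thesis using that uv by (simp add: on_fibre_def)
qed

lemma XX_interval:
  assumes w: "w \<in> topspace XX" and "proj w = y" "y \<in> B \<union> C"
  shows "w = on_interval y (snd w y)"
proof -
  obtain u v where uv: "w = (u, v)" by (cases w)
  have u: "u \<in> L_points AA (B \<union> C)" and v: "v \<in> (\<Pi>\<^sub>E x\<in>B. {0..1})"
    and f: "\<And>x. x \<in> B \<Longrightarrow> u \<noteq> Inr x \<Longrightarrow> ff x u = v x"
    using w by (auto simp: topspace_XX uv)
  have u: "u = Inr y"
    using u assms(2,3) uv disjoint_AB disjoint_AC by (auto simp: L_points_def proj_def)
  then have "v = (\<lambda>x\<in>B. if x = y then v y else 0)"
    using f v by (auto simp: fun_eq_iff PiE_iff extensional_def)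
  then show ?thesis using u uv by (simp add: on_interval_def)
qed

lemma proj_XX: "w \<in> topspace XX \<Longrightarrow> proj w \<in> topspace M"
  using points by (auto simp: topspace_XX L_points_def proj_def)

lemma openin_complement_Cx: "x \<in> B \<Longrightarrow> openin M (topspace M - (Cx x \<union> {x}))"
  using closedin_closure_of[of M "Cx x"] Cx_closure by (auto simp: closedin_def)

text \<open>At \<open>Inr x\<close> the condition is void. At any other \<open>Inr y\<close>,
  \<open>ff x\<close> vanishes on a whole tube because the complement of
  \<open>Cx x \<union> {x}\<close> is open, and over a point of \<open>AA\<close> it is continuous
  on an open fibre. So a violated condition stays violated nearby.\<close>

lemma closedin_XX_condition:
  assumes x: "x \<in> B"
  shows "closedin (prod_topology LL PP) {w \<in> topspace (prod_topology LL PP). fst w \<noteq> Inr x \<longrightarrow> ff x (fst w) = snd w x}"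
    (is "closedin ?P ?D")
proof -
  have cv: "continuous_map ?P euclideanreal (\<lambda>w. snd w x)"
    using continuous_map_compose[OF continuous_map_snd, of PP "top_of_set {0..1}" "\<lambda>v. v x" LL]
      continuous_map_product_projection[of x B "\<lambda>_. top_of_set {0..1 :: real}"] x
    by (simp add: o_def continuous_map_into_fulltopology)
  have "openin ?P (topspace ?P - ?D)"
  proof (subst openin_subopen, intro ballI)
    fix w assume w: "w \<in> topspace ?P - ?D"
    have fw: "fst w \<in> topspace LL" using w by auto
    have ne: "fst w \<noteq> Inr x" "ff x (fst w) \<noteq> snd w x" using w by auto
    show "\<exists>T. openin ?P T \<and> w \<in> T \<and> T \<subseteq> topspace ?P - ?D"
    proof (cases "fst w")
      case (Inr y)
      have "y \<in> B \<union> C" using fw Inr by (auto simp: topspace_LL L_points_def)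
      then have y: "y \<in> topspace M - (Cx x \<union> {x})"
        using ne(1) Inr points Cx_subset[OF x] disjoint_AB disjoint_AC by blast
      define T where "T = {w \<in> topspace ?P. fst w \<in> tube (topspace M - (Cx x \<union> {x}))} \<inter>
        {w \<in> topspace ?P. snd w x \<in> - {0}}"
      have "openin ?P T"
        unfolding T_def
        by (intro openin_Int openin_continuous_map_preimage[OF continuous_map_fst]
            openin_continuous_map_preimage[OF cv] openin_tube openin_complement_Cx x) auto
      moreover have "w \<in> T"
        using w y ne(2) Inr \<open>y \<in> B \<union> C\<close> disjoint_AB disjoint_AC by (auto simp: T_def)
      moreover have "T \<subseteq> topspace ?P - ?D"
      proof
        fix w' assume w': "w' \<in> T"
        then have "ff x (fst w') = 0" "fst w' \<noteq> Inr x"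
          by (cases "fst w'"; auto simp: T_def ff_outside)+
        then show "w' \<in> topspace ?P - ?D" using w' by (auto simp: T_def)
      qed
      ultimately show ?thesis by blast
    next
      case (Inl q)
      obtain a z where q: "q = (a, z)" by (cases q)
      have a: "a \<in> AA" using fw Inl q by (auto simp: topspace_LL L_points_def)
      define e where "e = \<bar>ff x (fst w) - snd w x\<bar> / 2"
      have e: "0 < e" "2 * e = \<bar>ff x (fst w) - snd w x\<bar>" using ne(2) by (simp_all add: e_def)
      define U where "U = {z' \<in> topspace cantor_topology. ff x (Inl (a, z')) \<in> ball (ff x (fst w)) e}"
      have U: "openin cantor_topology U"
        unfolding U_def by (rule openin_continuous_map_preimage[OF continuous_map_ff_fibre[OF a]]) simp
      define T where "T = {w \<in> topspace ?P. fst w \<in> Inl ` ({a} \<times> U)} \<inter>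
        {w' \<in> topspace ?P. snd w' x \<in> ball (snd w x) e}"
      have "openin ?P T"
        unfolding T_def
        by (intro openin_Int openin_continuous_map_preimage[OF continuous_map_fst]
            openin_continuous_map_preimage[OF cv] openin_LL_fibre a U) auto
      moreover have "w \<in> T" using w Inl q e by (auto simp: T_def U_def)
      moreover have "T \<subseteq> topspace ?P - ?D"
      proof
        fix w' assume w': "w' \<in> T"
        then have "\<bar>ff x (fst w') - ff x (fst w)\<bar> < e" "\<bar>snd w' x - snd w x\<bar> < e" "fst w' \<noteq> Inr x"
          by (auto simp: T_def U_def dist_real_def abs_minus_commute)
        then have "ff x (fst w') \<noteq> snd w' x" using e(2) by (smt (verit))
        then show "w' \<in> topspace ?P - ?D" using w' \<open>fst w' \<noteq> Inr x\<close> by (auto simp: T_def)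
      qed
      ultimately show ?thesis by blast
    qed
  qed
  then show ?thesis by (auto simp: closedin_def)
qed

lemma compact_XX: "compact_space XX"
proof -
  let ?P = "prod_topology LL PP"
  have "compact_space ?P"
    using compact_LL by (simp add: compact_space_prod_topology compact_space_product_topology compact_space_subtopology)
  moreover have "closedin ?P (topspace XX)"
  proof (cases "B = {}")
    case True
    then have "topspace XX = topspace ?P"
      unfolding topspace_XX topspace_prod_topology topspace_LL topspace_PP by auto
    then show ?thesis using closedin_topspace by metis
  next
    case False
    have "topspace XX = (\<Inter>x\<in>B. {w \<in> topspace ?P. fst w \<noteq> Inr x \<longrightarrow> ff x (fst w) = snd w x})"
      using False unfolding topspace_XX topspace_prod_topology topspace_LL topspace_PP by auto
    then show ?thesis using closedin_XX_condition False by (auto intro!: closedin_Inter)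
  qed
  ultimately have "compactin ?P (topspace XX)" by (rule closedin_compact_space)
  then have "compact_space (subtopology ?P (topspace XX))" by (rule compact_space_subtopology)
  moreover have "XX = subtopology ?P (topspace XX)"
    unfolding L1_space_def topspace_subtopology by (rule subtopology_restrict[symmetric])
  ultimately show ?thesis by (rule ssubst[rotated])
qed

lemma continuous_map_into_XX:
  assumes "continuous_map Y LL (fst \<circ> g)"
    and "\<And>x. x \<in> B \<Longrightarrow> continuous_map Y euclideanreal (\<lambda>y. snd (g y) x)"
    and g: "\<And>y. y \<in> topspace Y \<Longrightarrow> g y \<in> topspace XX"
  shows "continuous_map Y XX g"
proof -
  have r: "snd (g y) \<in> (\<Pi>\<^sub>E x\<in>B. {0..1})" if "y \<in> topspace Y" for y
    using g[OF that] by (auto simp: topspace_XX)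
  have "continuous_map Y PP (snd \<circ> g)"
    unfolding continuous_map_componentwise
    using r assms(2) by (auto simp: PiE_iff continuous_map_in_subtopology)
  then have "continuous_map Y (prod_topology LL PP) g"
    using assms(1) by (simp add: continuous_map_pairwise)
  then show ?thesis
    using g unfolding L1_space_def by (auto simp: continuous_map_in_subtopology)
qed

lemma continuous_map_on_fibre: "a \<in> AA \<Longrightarrow> continuous_map cantor_topology XX (on_fibre a)"
  by (rule continuous_map_into_XX)
     (auto simp: o_def on_fibre_def continuous_map_Inl continuous_map_ff_fibre intro: on_fibre_in_XX[unfolded on_fibre_def])

lemma continuous_map_on_interval: "x \<in> B \<Longrightarrow> continuous_map (top_of_set {0..1}) XX (on_interval x)"
  by (rule continuous_map_into_XX)
     (auto simp: o_def on_interval_def topspace_LL L_points_def intro: on_interval_in_XX[unfolded on_interval_def])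

lemma continuous_map_snd_XX:
  assumes "x \<in> B"
  shows "continuous_map XX euclideanreal (\<lambda>w. snd w x)"
proof -
  have "continuous_map (prod_topology LL PP) euclideanreal (\<lambda>w. snd w x)"
    using continuous_map_compose[OF continuous_map_snd, of PP "top_of_set {0..1}" "\<lambda>v. v x" LL]
      continuous_map_product_projection[of x B "\<lambda>_. top_of_set {0..1 :: real}"] assms
    by (simp add: o_def continuous_map_into_fulltopology)
  then show ?thesis unfolding L1_space_def by (rule continuous_map_from_subtopology)
qed

lemma continuous_map_proj: "continuous_map XX M proj"
proof -
  have "continuous_map LL M (\<lambda>u. case u of Inl (a, z) \<Rightarrow> a | Inr y \<Rightarrow> y)"
    unfolding continuous_map_def
  proof (intro conjI allI impI)
    show "(\<lambda>u. case u of Inl (a, z) \<Rightarrow> a | Inr y \<Rightarrow> y) \<in> topspace LL \<rightarrow> topspace M"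
      using points by (auto simp: topspace_LL L_points_def)
    fix U assume U: "openin M U"
    have "{u \<in> topspace LL. (case u of Inl (a, z) \<Rightarrow> a | Inr y \<Rightarrow> y) \<in> U} = tube U"
    proof (rule set_eqI)
      fix u
      show "u \<in> {u \<in> topspace LL. (case u of Inl (a, z) \<Rightarrow> a | Inr y \<Rightarrow> y) \<in> U} \<longleftrightarrow> u \<in> tube U"
        using openin_subset[OF U] points
        by (cases u) (auto simp: topspace_LL L_points_def dest: B_not_AA C_not_AA)
    qed
    then show "openin LL {u \<in> topspace LL. (case u of Inl (a, z) \<Rightarrow> a | Inr y \<Rightarrow> y) \<in> U}"
      using openin_tube[OF U] by simp
  qed
  from continuous_map_compose[OF continuous_map_fst this, of PP]
  have "continuous_map (prod_topology LL PP) M proj" by (simp add: o_def proj_def[abs_def])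
  then show ?thesis unfolding L1_space_def by (rule continuous_map_from_subtopology)
qed

text \<open>\<open>proj\<close> is a closed map, being continuous from a compact space to a
  Hausdorff space.\<close>

lemma open_nbhd_of_fibre:
  assumes W: "openin XX W" and p: "p \<in> topspace M" and "\<And>w. w \<in> topspace XX \<Longrightarrow> proj w = p \<Longrightarrow> w \<in> W"
  obtains U where "openin M U" "p \<in> U" "\<And>w. w \<in> topspace XX \<Longrightarrow> proj w \<in> U \<Longrightarrow> w \<in> W"
proof -
  have "closed_map XX M proj"
    by (rule continuous_imp_closed_map[OF continuous_map_proj compact_XX Hausdorff])
  then have "closedin M (proj ` (topspace XX - W))"
    using W unfolding closed_map_def by blast
  then have "openin M (topspace M - proj ` (topspace XX - W))" by blast
  moreover have "p \<in> topspace M - proj ` (topspace XX - W)" using p assms(3) by blast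
  ultimately show thesis by (rule that) blast
qed

text \<open>Retraction of \<open>XX\<close> onto the fibre over \<open>y\<close>, possible because
  the coordinate at \<open>y\<close> is available on all of \<open>XX\<close>. For \<open>y\<close>
  in \<open>C\<close> the entry \<open>snd w y\<close> is a dummy that \<open>on_interval y\<close>
  ignores.\<close>

definition retract :: "'m \<Rightarrow> 'm lpoint \<times> ('m \<Rightarrow> real) \<Rightarrow> 'm lpoint \<times> ('m \<Rightarrow> real)" where
  "retract y w = on_interval y (snd w y)"

lemma retract_XX:
  assumes "y \<in> B \<union> C"
  shows "continuous_map XX XX (retract y)"
    and "\<And>w. w \<in> topspace XX \<Longrightarrow> proj w = y \<Longrightarrow> retract y w = w"
proof -
  have snd_range: "snd w x \<in> {0..1}" if "w \<in> topspace XX" "x \<in> B" for w x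
    using that by (auto simp: topspace_XX PiE_iff)
  show "continuous_map XX XX (retract y)"
  proof (rule continuous_map_into_XX)
    have "Inr y \<in> topspace LL" using assms by (auto simp: topspace_LL L_points_def)
    then show "continuous_map XX LL (fst \<circ> retract y)"
      by (simp add: o_def retract_def on_interval_def)
    show "continuous_map XX euclideanreal (\<lambda>w. snd (retract y w) x)" if "x \<in> B" for x
      using that continuous_map_snd_XX by (cases "x = y") (simp_all add: retract_def on_interval_def)
    show "retract y w \<in> topspace XX" if "w \<in> topspace XX" for w
      using assms on_interval_in_XX on_interval_in_XX_C snd_range[OF that] by (auto simp: retract_def)
  qed
  show "retract y w = w" if "w \<in> topspace XX" "proj w = y" for w
    using XX_interval[OF that assms] by (simp add: retract_def)
qed

text \<open>The difference vanishes on the fibre over \<open>y\<close>. Thus near \<open>y\<close>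
  in \<open>B\<close> a continuous function almost depends on the coordinate at \<open>y\<close>
  alone, and near \<open>y\<close> in \<open>C\<close> it is almost constant.\<close>

lemma close_to_retract:
  assumes h: "continuous_map XX euclideanreal h" and y: "y \<in> B \<union> C" and "0 < \<epsilon>"
  obtains U where "openin M U" "y \<in> U"
    "\<And>w. w \<in> topspace XX \<Longrightarrow> proj w \<in> U \<Longrightarrow> \<bar>h w - h (retract y w)\<bar> < \<epsilon>"
proof -
  have c: "continuous_map XX euclideanreal (\<lambda>w. h w - h (retract y w))"
    using continuous_map_compose[OF retract_XX(1)[OF y] h] h by (simp add: o_def continuous_map_diff)
  have "openin XX {w \<in> topspace XX. h w - h (retract y w) \<in> ball 0 \<epsilon>}"
    by (rule openin_continuous_map_preimage[OF c]) simp
  moreover have "y \<in> topspace M" using y points by blast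
  ultimately obtain U where U: "openin M U" "y \<in> U"
    "\<And>w. w \<in> topspace XX \<Longrightarrow> proj w \<in> U \<Longrightarrow> w \<in> {w \<in> topspace XX. h w - h (retract y w) \<in> ball 0 \<epsilon>}"
    by (rule open_nbhd_of_fibre) (use retract_XX(2)[OF y] \<open>0 < \<epsilon>\<close> in auto)
  show thesis
  proof (rule that[OF U(1,2)])
    fix w assume "w \<in> topspace XX" "proj w \<in> U"
    from U(3)[OF this] show "\<bar>h w - h (retract y w)\<bar> < \<epsilon>" by (simp add: dist_real_def abs_minus_commute)
  qed
qed

text \<open>One \<open>N\<close> serves both kinds of fibres, counting digits on the Cantor sets and
  measuring distance on the intervals; over \<open>C\<close> there is nothing to control. For fixed
  \<open>\<epsilon>\<close>, an \<open>N\<close> valid over all of \<open>M\<close> will be the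
  class of \<open>h\<close>.\<close>

definition modulus_on :: "'m set \<Rightarrow> nat \<Rightarrow> ('m lpoint \<times> ('m \<Rightarrow> real) \<Rightarrow> real) \<Rightarrow> real \<Rightarrow> bool" where
  "modulus_on U N h \<epsilon> \<longleftrightarrow>
     (\<forall>a\<in>U \<inter> AA. \<forall>z z'. (\<forall>i<N. z i = z' i) \<longrightarrow> \<bar>h (on_fibre a z) - h (on_fibre a z')\<bar> \<le> \<epsilon>) \<and>
     (\<forall>x\<in>U \<inter> B. \<forall>r\<in>{0..1}. \<forall>r'\<in>{0..1}. \<bar>r - r'\<bar> \<le> (1 / 2) ^ N \<longrightarrow>
        \<bar>h (on_interval x r) - h (on_interval x r')\<bar> \<le> \<epsilon>)"

lemma modulus_on_mono:
  assumes "modulus_on U N h \<epsilon>" "N \<le> N'"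
  shows "modulus_on U N' h \<epsilon>"
proof -
  have "(1 / 2 :: real) ^ N' \<le> (1 / 2) ^ N" using assms(2) by (rule power_decreasing) auto
  note p = this
  show ?thesis
    unfolding modulus_on_def
  proof (intro conjI ballI allI impI)
    fix a and z z' :: cantor assume "a \<in> U \<inter> AA" "\<forall>i<N'. z i = z' i"
    then show "\<bar>h (on_fibre a z) - h (on_fibre a z')\<bar> \<le> \<epsilon>"
      using assms unfolding modulus_on_def by simp
  next
    fix x and r r' :: real
    assume r: "x \<in> U \<inter> B" "r \<in> {0..1}" "r' \<in> {0..1}" "\<bar>r - r'\<bar> \<le> (1 / 2) ^ N'"
    from r(4) p have "\<bar>r - r'\<bar> \<le> (1 / 2) ^ N" by (rule order_trans)
    then show "\<bar>h (on_interval x r) - h (on_interval x r')\<bar> \<le> \<epsilon>"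
      using assms(1) r(1-3) unfolding modulus_on_def by blast
  qed
qed

lemma modulus_on_UN:
  assumes "\<And>i. i \<in> I \<Longrightarrow> modulus_on (U i) N h \<epsilon>"
  shows "modulus_on (\<Union>i\<in>I. U i) N h \<epsilon>"
  unfolding modulus_on_def
proof (intro conjI ballI allI impI)
  fix a and z z' :: cantor assume "a \<in> (\<Union>i\<in>I. U i) \<inter> AA" "\<forall>i<N. z i = z' i"
  then show "\<bar>h (on_fibre a z) - h (on_fibre a z')\<bar> \<le> \<epsilon>"
    using assms unfolding modulus_on_def by blast
next
  fix x and r r' :: real assume "x \<in> (\<Union>i\<in>I. U i) \<inter> B" "r \<in> {0..1}" "r' \<in> {0..1}" "\<bar>r - r'\<bar> \<le> (1 / 2) ^ N"
  then show "\<bar>h (on_interval x r) - h (on_interval x r')\<bar> \<le> \<epsilon>"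
    using assms unfolding modulus_on_def by blast
qed

text \<open>For \<open>p\<close> in \<open>B\<close>, finitely many digits have to suffice on all
  nearby Cantor fibres. There \<open>h\<close> is almost a function of \<open>ff p\<close>, which
  over \<open>a\<close> in \<open>A t\<close> is given by \<open>Gamma (\<psi> p t) t\<close>. For
  long \<open>t\<close> its values fill a short interval anyway; the short \<open>t\<close> are
  finitely many, so the lengths of \<open>\<psi> p t\<close> are bounded for them.\<close>

lemma modulus_on_local:
  assumes h: "continuous_map XX euclideanreal h" and "0 < \<epsilon>" and p: "p \<in> topspace M"
  shows "\<exists>U N. openin M U \<and> p \<in> U \<and> modulus_on U N h \<epsilon>"
proof -
  consider "p \<in> AA" | "p \<in> B" | "p \<in> C" using p points by blast
  then show ?thesis
  proof cases
    case 1
    have "continuous_map cantor_topology euclideanreal (\<lambda>z. h (on_fibre p z))"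
      using continuous_map_compose[OF continuous_map_on_fibre[OF 1] h] by (simp add: o_def)
    then obtain N where "\<And>z z'. (\<forall>i<N. z i = z' i) \<Longrightarrow> \<bar>h (on_fibre p z) - h (on_fibre p z')\<bar> \<le> \<epsilon>"
      using cantor_uniformly_continuous \<open>0 < \<epsilon>\<close> by blast
    then have "modulus_on {p} N h \<epsilon>"
      using 1 B_not_AA by (auto simp: modulus_on_def)
    then show ?thesis using isolated[OF 1] by blast
  next
    case 3
    then obtain U where U: "openin M U" "p \<in> U"
      "\<And>w. w \<in> topspace XX \<Longrightarrow> proj w \<in> U \<Longrightarrow> \<bar>h w - h (retract p w)\<bar> < \<epsilon> / 2"
      using close_to_retract[OF h, of p "\<epsilon> / 2"] \<open>0 < \<epsilon>\<close> by auto
    have close: "\<bar>h w - h w'\<bar> \<le> \<epsilon>" if "w \<in> topspace XX" "w' \<in> topspace XX" "proj w \<in> U" "proj w' \<in> U" for w w'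
    proof -
      have "retract p w = retract p w'"
        unfolding retract_def using on_interval_C[OF 3] by metis
      then show ?thesis using U(3)[of w] U(3)[of w'] that by (smt (verit) field_sum_of_halves)
    qed
    have "modulus_on U 0 h \<epsilon>"
      unfolding modulus_on_def
      by (auto intro!: close on_fibre_in_XX on_interval_in_XX)
    then show ?thesis using U by blast
  next
    case 2
    obtain V where V: "openin M V" "p \<in> V"
      "\<And>w. w \<in> topspace XX \<Longrightarrow> proj w \<in> V \<Longrightarrow> \<bar>h w - h (retract p w)\<bar> < \<epsilon> / 3"
      using close_to_retract[OF h, of p "\<epsilon> / 3"] 2 \<open>0 < \<epsilon>\<close> by auto
    define g where "g r = h (on_interval p r)" for r
    have "continuous_map (top_of_set {0..1}) euclideanreal g"
      using continuous_map_compose[OF continuous_map_on_interval[OF 2] h] by (simp add: o_def g_def[abs_def])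
    then have "uniformly_continuous_on {0..1} g"
      by (intro compact_uniformly_continuous) auto
    then obtain d where d: "0 < d" "\<And>r r'. r \<in> {0..1} \<Longrightarrow> r' \<in> {0..1} \<Longrightarrow> \<bar>r - r'\<bar> < d \<Longrightarrow> \<bar>g r - g r'\<bar> < \<epsilon> / 3"
      using \<open>0 < \<epsilon>\<close> unfolding uniformly_continuous_on_def dist_real_def
      by (metis divide_pos_pos zero_less_numeral)
    obtain k where k: "(1 / 2 :: real) ^ k < d" using real_arch_pow_inv[OF d(1), of "1 / 2"] by auto
    obtain m where m: "\<And>t. t \<in> {t :: bool list. length t < k} \<Longrightarrow> length (\<psi> p t) \<le> m"
    proof -
      have "finite {t :: bool list. length t < k}"
        using finite_lists_length_le[of "UNIV :: bool set" k] by (rule finite_subset[rotated]) auto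
      then have "finite ((\<lambda>t. length (\<psi> p t)) ` {t :: bool list. length t < k})" by simp
      then show thesis using that finite_nat_set_iff_bounded_le by auto
    qed
    \<comment> \<open>Excludes all other points of \<open>B\<close> and \<open>C\<close>, and all
      points of \<open>AA\<close> over which \<open>ff p\<close> is not given by
      \<open>Gamma\<close>.\<close>
    define U where "U = V \<inter> (Cx p \<union> {p})"
    have "openin M U" using V(1) Cx_clopen[OF 2] Cx_closure[OF 2] by (auto simp: U_def)
    moreover have "p \<in> U" using V(2) by (simp add: U_def)
    moreover have "modulus_on U (m + k) h \<epsilon>"
      unfolding modulus_on_def
    proof (intro conjI ballI allI impI)
      fix a and z z' :: cantor assume a: "a \<in> U \<inter> AA" and eq: "\<forall>i<m + k. z i = z' i"
      then have aC: "a \<in> Cx p" using 2 B_not_AA by (auto simp: U_def)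
      obtain t where t: "a \<in> A t" using a by blast
      have "\<bar>ff p (Inl (a, z)) - ff p (Inl (a, z'))\<bar> \<le> (1 / 2) ^ k"
      proof (cases "length t < k")
        case True
        then have "\<forall>i<length (\<psi> p t) + k. z i = z' i" using m[of t] eq by auto
        then show ?thesis unfolding ff_inside[OF aC t] by (rule dyadic_Gamma_close')
      next
        case False
        then have "(1 / 2 :: real) ^ length t \<le> (1 / 2) ^ k" by (intro power_decreasing) auto
        then show ?thesis unfolding ff_inside[OF aC t] using dyadic_Gamma_close order_trans by blast
      qed
      then have gg: "\<bar>g (ff p (Inl (a, z))) - g (ff p (Inl (a, z')))\<bar> < \<epsilon> / 3"
        using k ff_range by (intro d(2)) auto
      have "\<bar>h (on_fibre a y) - g (ff p (Inl (a, y)))\<bar> < \<epsilon> / 3" for y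
      proof -
        have "\<bar>h (on_fibre a y) - h (retract p (on_fibre a y))\<bar> < \<epsilon> / 3"
          using a by (intro V(3) on_fibre_in_XX) (auto simp: U_def)
        then show ?thesis using 2 by (simp add: retract_def g_def)
      qed
      from this[of z] this[of z'] gg show "\<bar>h (on_fibre a z) - h (on_fibre a z')\<bar> \<le> \<epsilon>"
        by linarith
    next
      fix x and r r' :: real assume x: "x \<in> U \<inter> B" and r: "r \<in> {0..1}" "r' \<in> {0..1}" "\<bar>r - r'\<bar> \<le> (1 / 2) ^ (m + k)"
      then have "x = p" using Cx_subset[OF 2] B_not_AA by (auto simp: U_def)
      have "(1 / 2 :: real) ^ (m + k) \<le> (1 / 2) ^ k" by (rule power_decreasing) auto
      then have "\<bar>r - r'\<bar> < d" using r(3) k by linarith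
      then have "\<bar>g r - g r'\<bar> < \<epsilon> / 3" using r by (intro d(2)) auto
      then show "\<bar>h (on_interval x r) - h (on_interval x r')\<bar> \<le> \<epsilon>"
        using \<open>0 < \<epsilon>\<close> by (simp add: g_def \<open>x = p\<close>)
    qed
    ultimately show ?thesis by blast
  qed
qed

lemma modulus_exists:
  assumes h: "continuous_map XX euclideanreal h" and "0 < \<epsilon>"
  obtains N where "modulus_on (topspace M) N h \<epsilon>"
proof -
  obtain U N where UN: "\<And>p. p \<in> topspace M \<Longrightarrow> openin M (U p) \<and> p \<in> U p \<and> modulus_on (U p) (N p) h \<epsilon>"
    using modulus_on_local[OF assms] by metis
  have "\<exists>\<F>. finite \<F> \<and> \<F> \<subseteq> U ` topspace M \<and> topspace M \<subseteq> \<Union>\<F>"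
    by (rule compact[unfolded compact_space_alt, rule_format]) (use UN in blast)
  then obtain S where S: "finite S" "S \<subseteq> topspace M" "topspace M \<subseteq> \<Union>(U ` S)"
    by (metis finite_subset_image)
  obtain n where n: "\<And>p. p \<in> S \<Longrightarrow> N p \<le> n"
    using S(1) finite_nat_set_iff_bounded_le[of "N ` S"] by auto
  have "modulus_on (\<Union>p\<in>S. U p) n h \<epsilon>"
    by (rule modulus_on_UN) (use UN S(2) n modulus_on_mono in blast)
  moreover have "modulus_on (topspace M) n h \<epsilon>" if "modulus_on V n h \<epsilon>" "topspace M \<subseteq> V" for V
    using that unfolding modulus_on_def by blast
  ultimately show thesis using S(3) that by blast
qed

text \<open>
  This is where \<open>M\<close> has to be scattered: an isolated point of the complement of the
  union of all open sets with the property would have a neighbourhood with the property.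
\<close>

lemma countably_small_XX:
  fixes F :: "'j \<Rightarrow> 'm lpoint \<times> ('m \<Rightarrow> real) \<Rightarrow> real"
  assumes J: "countable J" and F: "\<And>i. i \<in> J \<Longrightarrow> continuous_map XX euclideanreal (F i)"
    and N: "\<And>i. i \<in> J \<Longrightarrow> modulus_on (topspace M) N (F i) \<epsilon>" 
  shows "countably_small (topspace XX) J F \<epsilon>"
proof -
  define good where "good U \<longleftrightarrow> countably_small {w \<in> topspace XX. proj w \<in> U} J F \<epsilon>" for U
  have good_mono: "good U" if "good V" "U \<subseteq> V" for U V
    using that(1) unfolding good_def by (rule countably_small_mono) (use that(2) in auto)
  have good_Union: "good (\<Union>\<F>)" if "countable \<F>" "\<And>U. U \<in> \<F> \<Longrightarrow> good U" for \<F>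
    unfolding good_def
  proof (rule countably_small_Union)
    show "countable ((\<lambda>U. {w \<in> topspace XX. proj w \<in> U}) ` \<F>)" using that(1) by simp
  qed (use that(2) in \<open>auto simp: good_def\<close>)
  define O' where "O' = \<Union>{U. openin M U \<and> good U}"
  have opO: "openin M O'" by (auto simp: O'_def)
  have good_compact: "good K" if K: "compactin M K" "K \<subseteq> O'" for K
  proof -
    have "\<exists>\<F>. finite \<F> \<and> \<F> \<subseteq> {U. openin M U \<and> good U} \<and> K \<subseteq> \<Union>\<F>"
      by (rule compactinD[OF K(1)]) (use K(2) in \<open>auto simp: O'_def\<close>)
    then obtain \<F> where \<F>: "finite \<F>" "\<F> \<subseteq> {U. openin M U \<and> good U}" "K \<subseteq> \<Union>\<F>" by blast
    then have "good (\<Union>\<F>)" by (intro good_Union) (auto intro: countable_finite)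
    then show ?thesis using \<F>(3) by (rule good_mono)
  qed
  have "topspace M - O' = {}"
  proof (rule ccontr)
    assume ne: "topspace M - O' \<noteq> {}"
    then obtain p where p: "p \<in> topspace M - O'" "openin (subtopology M (topspace M - O')) {p}"
      using scattered unfolding scattered_space_def by (meson Diff_subset)
    then obtain V where V: "openin M V" "{p} = V \<inter> (topspace M - O')"
      unfolding openin_subtopology by blast
    show False
    proof (cases "p \<in> AA")
      case True
      \<comment> \<open>The fibre over \<open>p\<close> is cut into cylinders by the first
        \<open>N\<close> digits.\<close>
      have "good {p}"
        unfolding good_def
      proof (rule countably_smallI)
        show "countable (range (\<lambda>s :: bool list. {on_fibre p z | z. map z [0..<N] = s}))" by simp
        show "{w \<in> topspace XX. proj w \<in> {p}} \<subseteq> \<Union>(range (\<lambda>s :: bool list. {on_fibre p z | z. map z [0..<N] = s}))"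
        proof
          fix w assume "w \<in> {w \<in> topspace XX. proj w \<in> {p}}"
          then have "w \<in> topspace XX" "proj w = p" by auto
          then obtain z where "w = on_fibre p z" using True by (rule XX_fibre)
          then show "w \<in> \<Union>(range (\<lambda>s :: bool list. {on_fibre p z | z. map z [0..<N] = s}))" by blast
        qed
        fix W w w' i assume W: "W \<in> range (\<lambda>s :: bool list. {on_fibre p z | z. map z [0..<N] = s})"
          "w \<in> W" "w' \<in> W" and i: "i \<in> J"
        then obtain z z' where z: "w = on_fibre p z" "w' = on_fibre p z'" "map z [0..<N] = map z' [0..<N]"
          by auto
        then have "\<forall>i<N. z i = z' i" by (auto simp: list_eq_iff_nth_eq)
        then show "\<bar>F i w - F i w'\<bar> \<le> \<epsilon>"
          using N[OF i] True p(1) z(1,2) unfolding modulus_on_def by blast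
      qed
      then have "{p} \<subseteq> O'" using isolated[OF True] unfolding O'_def by blast
      then show False using p(1) by blast
    next
      case False
      then have pBC: "p \<in> B \<union> C" using p(1) points by blast
      have "neighbourhood_base_of (closedin M) M"
        using compact_Hausdorff_imp_regular_space[OF compact Hausdorff] by (simp add: neighbourhood_base_of_closedin)
      then have "\<forall>W x. openin M W \<and> x \<in> W \<longrightarrow> (\<exists>U V. openin M U \<and> closedin M V \<and> x \<in> U \<and> U \<subseteq> V \<and> V \<subseteq> W)"
        unfolding neighbourhood_base_of .
      from this[rule_format, of V p] obtain U' E
        where E: "openin M U'" "closedin M E" "p \<in> U'" "U' \<subseteq> E" "E \<subseteq> V"
        using V by blast
      define XE where "XE = {w \<in> topspace XX. proj w \<in> E}"
      have clXE: "closedin XX XE"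
        unfolding XE_def by (rule closedin_continuous_map_preimage[OF continuous_map_proj E(2)])
      \<comment> \<open>Where \<open>F i\<close> differs from its retracted version. Each
        \<open>Q i n\<close> is compact and misses the fibre over \<open>p\<close>, so it lies over
        a compact subset of \<open>O'\<close>. Countability of \<open>J\<close> keeps the number of
        these sets countable.\<close>
      define Q where "Q i n = {w \<in> topspace XX. F i w - F i (retract p w) \<in> - ball 0 (1 / (real n + 1))} \<inter> XE" for i n
      \<comment> \<open>On the rest all \<open>F i\<close> depend only on the coordinate at
        \<open>p\<close>, which is cut into intervals of length \<open>(1 / 2) ^ N\<close> so that
        the modulus over \<open>p\<close> applies.\<close>
      define R where "R j = {w \<in> XE. (\<forall>i\<in>J. F i w = F i (retract p w)) \<and> \<lfloor>snd w p * 2 ^ N\<rfloor> = j}" for j :: int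
      have smallQ: "countably_small (Q i n) J F \<epsilon>" if i: "i \<in> J" for i n
      proof -
        have c: "continuous_map XX euclideanreal (\<lambda>w. F i w - F i (retract p w))"
          using continuous_map_compose[OF retract_XX(1)[OF pBC] F[OF i]] F[OF i]
          by (simp add: o_def continuous_map_diff)
        have "closedin XX {w \<in> topspace XX. F i w - F i (retract p w) \<in> - ball 0 (1 / (real n + 1))}"
          by (rule closedin_continuous_map_preimage[OF c]) (simp add: closed_Compl)
        then have "closedin XX (Q i n)"
          unfolding Q_def using clXE by (rule closedin_Int)
        then have "compactin XX (Q i n)" by (rule closedin_compact_space[OF compact_XX])
        then have "compactin M (proj ` Q i n)" using continuous_map_proj by (rule image_compactin)
        moreover have "proj ` Q i n \<subseteq> O'"
        proof
          fix q assume "q \<in> proj ` Q i n"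
          then obtain w where w: "w \<in> Q i n" "q = proj w" by blast
          have "q \<noteq> p"
          proof
            assume "q = p"
            then have "retract p w = w" using w by (intro retract_XX(2)[OF pBC]) (auto simp: Q_def)
            then show False using w(1) by (simp add: Q_def)
          qed
          moreover have "q \<in> V" "q \<in> topspace M"
            using w E(5) proj_XX by (auto simp: Q_def XE_def)
          ultimately show "q \<in> O'" using V(2) by blast
        qed
        ultimately have "good (proj ` Q i n)" by (rule good_compact)
        then show ?thesis
          unfolding good_def by (rule countably_small_mono) (auto simp: Q_def)
      qed
      have smallR: "countably_small (R j) J F \<epsilon>" for j
      proof (rule countably_smallI[of "{R j}"])
        fix W w w' i assume "W \<in> {R j}" "w \<in> W" "w' \<in> W" and i: "i \<in> J"
        then have w: "w \<in> R j" "w' \<in> R j" by auto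
        then have "F i w = F i (retract p w)" "F i w' = F i (retract p w')"
          using i by (auto simp: R_def)
        moreover have "\<bar>F i (retract p w) - F i (retract p w')\<bar> \<le> \<epsilon>"
        proof (cases "p \<in> B")
          case True
          have wX: "w \<in> topspace XX" "w' \<in> topspace XX" using w by (auto simp: R_def XE_def)
          then have r: "snd w p \<in> {0..1}" "snd w' p \<in> {0..1}"
            using True by (auto simp: topspace_XX PiE_iff)
          have "\<lfloor>snd w p * 2 ^ N\<rfloor> = \<lfloor>snd w' p * 2 ^ N\<rfloor>" using w by (simp add: R_def)
          then have "\<bar>snd w p * 2 ^ N - snd w' p * 2 ^ N\<bar> \<le> 1" by linarith
          then have "\<bar>snd w p - snd w' p\<bar> * 2 ^ N \<le> 1" by (simp add: abs_mult flip: left_diff_distrib)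
          then have "\<bar>snd w p - snd w' p\<bar> \<le> (1 / 2) ^ N" by (simp add: power_divide pos_le_divide_eq)
          then show ?thesis
            using N[OF i] True p(1) r unfolding modulus_on_def retract_def by blast
        next
          case False
          then have "retract p w = retract p w'"
            unfolding retract_def using on_interval_C pBC by (metis UnE)
          moreover have "0 \<le> \<epsilon>"
          proof -
            \<comment> \<open>\<open>B\<close> is nonempty by the guessing property for a trivial
              family.\<close>
            obtain x where "x \<in> B" using guess[of "\<lambda>s t. A t"] by blast
            then have "\<bar>F i (on_interval x 0) - F i (on_interval x 0)\<bar> \<le> \<epsilon>"
              using N[OF i] points unfolding modulus_on_def by (metis (no_types, lifting) IntI UnI1 UnI2 abs_zero atLeastAtMost_iff diff_self order_refl zero_le_one zero_le_power zero_le_divide_1_iff zero_le_numeral)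
            then show ?thesis by simp
          qed
          ultimately show ?thesis by simp
        qed
        ultimately show "\<bar>F i w - F i w'\<bar> \<le> \<epsilon>" by simp
      qed auto
      have "good U'"
        unfolding good_def
      proof (rule countably_small_Union)
        show "countable ((\<lambda>(i, n). Q i n) ` (J \<times> UNIV) \<union> range R)" using J by simp
        show "{w \<in> topspace XX. proj w \<in> U'} \<subseteq> \<Union>((\<lambda>(i, n). Q i n) ` (J \<times> UNIV) \<union> range R)"
        proof
          fix w assume "w \<in> {w \<in> topspace XX. proj w \<in> U'}"
          then have w: "w \<in> topspace XX" "w \<in> XE" using E(4) by (auto simp: XE_def)
          show "w \<in> \<Union>((\<lambda>(i, n). Q i n) ` (J \<times> UNIV) \<union> range R)"
          proof (cases "\<forall>i\<in>J. F i w = F i (retract p w)")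
            case True
            then have "w \<in> R \<lfloor>snd w p * 2 ^ N\<rfloor>" using w by (simp add: R_def)
            then show ?thesis by blast
          next
            case False
            then obtain i where i: "i \<in> J" "F i w \<noteq> F i (retract p w)" by blast
            then obtain n where "inverse (real (Suc n)) < \<bar>F i w - F i (retract p w)\<bar>"
              using reals_Archimedean[of "\<bar>F i w - F i (retract p w)\<bar>"] by auto
            then have "w \<in> Q i n" using w by (simp add: Q_def dist_real_def inverse_eq_divide add.commute)
            then show ?thesis using i(1) by blast
          qed
        qed
      qed (use smallQ smallR in auto)
      then have "U' \<subseteq> O'" using E(1) unfolding O'_def by blast
      then show False using p(1) E(3) by blast
    qed
  qed
  then have "topspace M \<subseteq> O'" by blast
  then have "good (topspace M)" using compact by (intro good_compact) (simp_all add: compact_space_def)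
  then show ?thesis
    unfolding good_def by (rule countably_small_mono) (use proj_XX in auto)
qed

end

section \<open>Almost totally disconnected spaces\<close>

text \<open>
  The coordinates are rescaled with rational breakpoints, so that even after applying
  \<^const>\<open>clip\<close> they separate points.
\<close>

lemma almost_totally_disconnected_family:
  assumes "almost_totally_disconnected TYPE('i) (K :: 'k topology)"
  obtains \<K> :: "('k \<Rightarrow> real) set" where "compact_space K" "Hausdorff_space K"
    "\<And>k. k \<in> \<K> \<Longrightarrow> continuous_map K euclideanreal k"
    "\<And>k y. k \<in> \<K> \<Longrightarrow> 0 \<le> k y \<and> k y \<le> 1"
    "\<And>y. y \<in> topspace K \<Longrightarrow> countable {k \<in> \<K>. k y \<notin> {0, 1}}"
    "\<And>y y'. y \<in> topspace K \<Longrightarrow> y' \<in> topspace K \<Longrightarrow> y \<noteq> y' \<Longrightarrow> \<exists>k\<in>\<K>. clip (k y) \<noteq> clip (k y')"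
proof -
  obtain I :: "'i set" and E where E: "compactin (product_topology (\<lambda>_. top_of_set {0..1 :: real}) I) E"
    "K homeomorphic_space subtopology (product_topology (\<lambda>_. top_of_set {0..1}) I) E"
    "\<forall>x\<in>E. countable {i \<in> I. x i \<in> {0<..<1}}"
    using assms unfolding almost_totally_disconnected_def by (elim exE conjE)
  define P where "P = product_topology (\<lambda>_ :: 'i. top_of_set {0..1 :: real}) I"
  have EP: "E \<subseteq> (\<Pi>\<^sub>E i\<in>I. {0..1})"
    using compactin_subset_topspace[OF E(1)] by simp
  have cK: "compact_space K"
    using E(1) homeomorphic_compact_space[OF E(2)] compact_space_subtopology by blast
  have "Hausdorff_space P"
    by (auto simp: P_def Hausdorff_space_product_topology intro: Hausdorff_space_subtopology)
  then have hK: "Hausdorff_space K"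
    using homeomorphic_Hausdorff_space[OF E(2)] by (simp add: P_def Hausdorff_space_subtopology)
  obtain \<phi> where \<phi>: "homeomorphic_map K (subtopology P E) \<phi>"
    using E(2) unfolding P_def homeomorphic_space by (rule exE)
  have \<phi>E: "\<phi> y \<in> E" if "y \<in> topspace K" for y
    using homeomorphic_imp_surjective_map[OF \<phi>] that by auto
  have \<phi>i: "continuous_map K euclideanreal (\<lambda>y. \<phi> y i)" if "i \<in> I" for i
  proof -
    have "continuous_map K P \<phi>"
      using homeomorphic_imp_continuous_map[OF \<phi>] by (simp add: continuous_map_in_subtopology)
    then have "continuous_map K (top_of_set {0..1}) (\<lambda>y. \<phi> y i)"
      using that unfolding P_def continuous_map_componentwise by auto
    then show ?thesis by (rule continuous_map_into_fulltopology)
  qed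
  \<comment> \<open>Coordinate \<open>i\<close> with the interval from \<open>r\<close> to
    \<open>s\<close> stretched linearly onto [0, 1] and truncated.\<close>
  define k where "k = (\<lambda>(i, r :: rat, s :: rat) y. max 0 (min 1 ((\<phi> y i - of_rat r) / (of_rat s - of_rat r) :: real)))"
  define Q where "Q = {(i, r :: rat, s :: rat) | i r s. i \<in> I \<and> 0 \<le> r \<and> r < s \<and> s \<le> 1}"
  show thesis
  proof (rule that[of "k ` Q"])
    fix f assume "f \<in> k ` Q"
    then obtain i r s where q: "f = k (i, r, s)" "i \<in> I" "r < s" by (auto simp: Q_def)
    have "continuous_map K euclideanreal (\<lambda>y. (\<phi> y i - of_rat r) * (1 / (of_rat s - of_rat r)))"
      using \<phi>i[OF q(2)] by (intro continuous_map_real_mult continuous_map_diff) auto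
    then show "continuous_map K euclideanreal f"
      unfolding q(1) k_def by (auto intro!: continuous_map_real_max continuous_map_real_min)
    show "0 \<le> f y \<and> f y \<le> 1" for y unfolding q(1) k_def by simp
  next
    fix y assume y: "y \<in> topspace K"
    \<comment> \<open>A value strictly between 0 and 1 forces coordinate \<open>i\<close> between
      \<open>r\<close> and \<open>s\<close>, hence into (0, 1): countably many \<open>i\<close>,
      each with countably many pairs of rationals.\<close>
    have "{f \<in> k ` Q. f y \<notin> {0, 1}} \<subseteq> k ` ({i \<in> I. \<phi> y i \<in> {0<..<1}} \<times> UNIV)"
    proof
      fix f assume "f \<in> {f \<in> k ` Q. f y \<notin> {0, 1}}"
      then obtain i r s where q: "f = k (i, r, s)" "i \<in> I" "0 \<le> r" "r < s" "s \<le> 1" "k (i, r, s) y \<notin> {0, 1}"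
        by (auto simp: Q_def)
      have rs: "(0 :: real) \<le> of_rat r" "(of_rat r :: real) < of_rat s" "(of_rat s :: real) \<le> 1"
        using q(3-5) by (simp_all add: of_rat_less)
      have "of_rat r < \<phi> y i" "\<phi> y i < of_rat s"
        using q(6) rs by (auto simp: k_def field_simps max_def min_def split: if_splits)
      then have "0 < \<phi> y i" "\<phi> y i < 1" using rs by linarith+
      then have "(i, r, s) \<in> {i \<in> I. \<phi> y i \<in> {0<..<1}} \<times> UNIV" using q(2) by simp
      then show "f \<in> k ` ({i \<in> I. \<phi> y i \<in> {0<..<1}} \<times> UNIV)" unfolding q(1) by (rule imageI)
    qed
    moreover have "countable ({i \<in> I. \<phi> y i \<in> {0<..<1}} \<times> (UNIV :: (rat \<times> rat) set))"
      using bspec[OF E(3) \<phi>E[OF y]] by simp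
    ultimately show "countable {f \<in> k ` Q. f y \<notin> {0, 1}}"
      by (rule countable_subset[OF _ countable_image])
  next
    have key: "\<exists>f\<in>k ` Q. f y = 0 \<and> f y' = 1"
      if yy': "y \<in> topspace K" "y' \<in> topspace K" "i \<in> I" "\<phi> y i < \<phi> y' i" for y y' i
    proof -
      obtain r where r: "\<phi> y i < of_rat r" "of_rat r < \<phi> y' i" using of_rat_dense[OF yy'(4)] by blast
      obtain s where s: "of_rat r < (of_rat s :: real)" "of_rat s < \<phi> y' i" using of_rat_dense[OF r(2)] by blast
      have "0 \<le> \<phi> y i" "\<phi> y' i \<le> 1" using \<phi>E[OF yy'(1)] \<phi>E[OF yy'(2)] EP yy'(3) by (auto simp: PiE_iff)
      then have "(0 :: real) \<le> of_rat r" "(of_rat s :: real) \<le> 1" using r s by linarith+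
      then have "(i, r, s) \<in> Q" using yy'(3) s(1) by (simp add: Q_def of_rat_less)
      moreover have "k (i, r, s) y = 0" "k (i, r, s) y' = 1"
        using r s by (auto simp: k_def divide_le_0_iff max_def min_def field_simps)
      ultimately show ?thesis by blast
    qed
    fix y y' assume yy': "y \<in> topspace K" "y' \<in> topspace K" "y \<noteq> y'"
    have "\<phi> y \<noteq> \<phi> y'"
      using homeomorphic_imp_injective_map[OF \<phi>] yy' by (auto simp: inj_on_def)
    moreover have "\<phi> y \<in> extensional I" "\<phi> y' \<in> extensional I"
      using \<phi>E[OF yy'(1)] \<phi>E[OF yy'(2)] EP by (auto simp: PiE_iff)
    ultimately obtain i where i: "i \<in> I" "\<phi> y i \<noteq> \<phi> y' i"
      by (metis extensionalityI)
    have clip01: "clip 0 \<noteq> clip 1" by (simp add: clip_def)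
    show "\<exists>f\<in>k ` Q. clip (f y) \<noteq> clip (f y')"
    proof (cases "\<phi> y i < \<phi> y' i")
      case True
      then show ?thesis using key[OF yy'(1,2) i(1)] clip01 by metis
    next
      case False
      then have "\<phi> y' i < \<phi> y i" using i(2) by simp
      then show ?thesis using key[OF yy'(2,1) i(1)] clip01 by metis
    qed
  qed (rule cK hK)+
qed

section \<open>Oscillation on dyadic intervals\<close>

lemma exists_concat_seq:
  assumes "openin cantor_topology U" "U \<noteq> {}"
  obtains s where "\<And>w. concat_seq s w \<in> U"
proof -
  obtain z n where "z \<in> U" and n: "\<And>z'. (\<forall>i<n. z' i = z i) \<Longrightarrow> z' \<in> U"
    using assms unfolding openin_cantor by blast
  show thesis
    by (rule that[of "map z [0..<n]"]) (auto simp: concat_seq_def intro: n)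
qed

text \<open>The intervals of \<open>t @ [False]\<close> and \<open>t @ [True]\<close> share the
  midpoint of that of \<open>t\<close>, so the bound doubles with every step up from level
  \<open>m\<close>.\<close>

lemma dyadic_chain:
  fixes \<phi> :: "real \<Rightarrow> real"
  assumes "\<And>t w w'. length t = m \<Longrightarrow> \<bar>\<phi> (dyadic (concat_seq t w)) - \<phi> (dyadic (concat_seq t w'))\<bar> \<le> e"
    and "length t + j = m"
  shows "\<bar>\<phi> (dyadic (concat_seq t (\<lambda>_. False))) - \<phi> (dyadic (concat_seq t (\<lambda>_. True)))\<bar> \<le> 2 ^ j * e"
  using assms(2)
proof (induction j arbitrary: t)
  case 0
  then show ?case using assms(1)[of t] by simp
next
  case (Suc j)
  have "\<bar>\<phi> (dyadic (concat_seq t (\<lambda>_. False))) - \<phi> (dyadic (concat_seq (t @ [False]) (\<lambda>_. True)))\<bar> \<le> 2 ^ j * e"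
    using Suc.IH[of "t @ [False]"] Suc.prems by (simp add: concat_seq_append_const)
  moreover have "\<bar>\<phi> (dyadic (concat_seq (t @ [True]) (\<lambda>_. False))) - \<phi> (dyadic (concat_seq t (\<lambda>_. True)))\<bar> \<le> 2 ^ j * e"
    using Suc.IH[of "t @ [True]"] Suc.prems by (simp add: concat_seq_append_const)
  ultimately show ?case unfolding dyadic_midpoint by simp
qed

section \<open>Convergence along \<open>Cx x\<close> and the contradiction\<close>

context basic_space
begin

text \<open>\<open>Cx x\<close> converges to \<open>x\<close>: the set \<open>Cx x - U\<close> is
  closed, hence compact, and consists of isolated points of \<open>M\<close>.\<close>

lemma finite_Cx_diff:
  assumes "x \<in> B" "openin M U" "x \<in> U"
  shows "finite (Cx x - U)"
proof -
  have "closedin M (Cx x \<union> {x})" using Cx_closure[OF assms(1)] closedin_closure_of by metis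
  then have "closedin M ((Cx x \<union> {x}) - U)" using assms(2) by (rule closedin_diff)
  moreover have "(Cx x \<union> {x}) - U = Cx x - U" using assms(3) by auto
  ultimately have "compactin M (Cx x - U)" using closedin_compact_space[OF compact] by simp
  then have "\<exists>\<F>. finite \<F> \<and> \<F> \<subseteq> (\<lambda>a. {a}) ` (Cx x - U) \<and> Cx x - U \<subseteq> \<Union>\<F>"
    by (rule compactinD) (use Cx_subset[OF assms(1)] isolated in auto)
  then obtain \<F> where \<F>: "finite \<F>" "\<F> \<subseteq> (\<lambda>a. {a}) ` (Cx x - U)" "Cx x - U \<subseteq> \<Union>\<F>" by blast
  have "finite (\<Union>\<F>)" using \<F>(1,2) by auto
  then show ?thesis using \<F>(3) by (rule finite_subset[rotated])
qed

text \<open>\<open>Gamma (\<psi> x t) t\<close> maps the cylinder of \<open>\<psi> x t\<close> onto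
  that of \<open>t\<close>, so over points \<open>a\<close> of \<open>Cx x \<inter> S\<close> near
  \<open>x\<close> the values of \<open>h\<close> on this cylinder approximate those on the dyadic
  interval of \<open>t\<close>. Infinity of \<open>Cx x \<inter> S\<close> provides such
  \<open>a\<close> in every neighbourhood of \<open>x\<close>.\<close>

lemma limit_interval:
  assumes h: "continuous_map XX euclideanreal h" and x: "x \<in> B"
    and S: "S \<subseteq> A t" "infinite (Cx x \<inter> S)"
    and e: "\<And>a w w'. a \<in> S \<Longrightarrow>
      \<bar>h (on_fibre a (concat_seq (\<psi> x t) w)) - h (on_fibre a (concat_seq (\<psi> x t) w'))\<bar> \<le> e"
  shows "\<bar>h (on_interval x (dyadic (concat_seq t w))) - h (on_interval x (dyadic (concat_seq t w')))\<bar> \<le> e"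
proof (rule field_le_epsilon)
  fix \<eta> :: real assume \<eta>: "0 < \<eta>"
  obtain U where U: "openin M U" "x \<in> U"
    "\<And>w. w \<in> topspace XX \<Longrightarrow> proj w \<in> U \<Longrightarrow> \<bar>h w - h (retract x w)\<bar> < \<eta> / 2"
    using close_to_retract[OF h, of x "\<eta> / 2"] x \<eta> by auto
  have "infinite (Cx x \<inter> S - (Cx x - U))"
    using S(2) finite_Cx_diff[OF x U(1,2)] by (rule Diff_infinite_finite[rotated])
  then obtain a where "a \<in> Cx x \<inter> S - (Cx x - U)" using infinite_imp_nonempty by blast
  then have a: "a \<in> Cx x" "a \<in> S" "a \<in> U" "a \<in> A t" using S(1) by auto
  have "\<bar>h (on_fibre a (concat_seq (\<psi> x t) w)) - h (on_interval x (dyadic (concat_seq t w)))\<bar> < \<eta> / 2" for w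
  proof -
    have "retract x (on_fibre a (concat_seq (\<psi> x t) w)) = on_interval x (dyadic (concat_seq t w))"
      using x by (simp add: retract_def ff_inside[OF a(1,4)] Gamma_concat)
    moreover have "\<bar>h (on_fibre a (concat_seq (\<psi> x t) w)) - h (retract x (on_fibre a (concat_seq (\<psi> x t) w)))\<bar> < \<eta> / 2"
      by (intro U(3) on_fibre_in_XX) (use a in auto)
    ultimately show ?thesis by simp
  qed
  from this[of w] this[of w'] e[OF a(2), of w w']
  show "\<bar>h (on_interval x (dyadic (concat_seq t w))) - h (on_interval x (dyadic (concat_seq t w')))\<bar> \<le> e + \<eta>"
    by linarith
qed

lemma not_C_isomorphic:
  assumes atd: "almost_totally_disconnected TYPE('i) (K :: 'k topology)"
  shows "\<not> C_isomorphic XX K"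
proof
  assume iso: "C_isomorphic XX K"
  obtain \<K> :: "('k \<Rightarrow> real) set" where K: "compact_space K" "Hausdorff_space K"
    and \<K>1: "\<And>k. k \<in> \<K> \<Longrightarrow> continuous_map K euclideanreal k"
    and \<K>2: "\<And>k y. k \<in> \<K> \<Longrightarrow> 0 \<le> k y \<and> k y \<le> 1"
    and \<K>3: "\<And>y. y \<in> topspace K \<Longrightarrow> countable {k \<in> \<K>. k y \<notin> {0, 1}}"
    and \<K>4: "\<And>y y'. y \<in> topspace K \<Longrightarrow> y' \<in> topspace K \<Longrightarrow> y \<noteq> y' \<Longrightarrow> \<exists>k\<in>\<K>. clip (k y) \<noteq> clip (k y')"
    using almost_totally_disconnected_family[OF atd] by blast
  show False
  proof (rule C_isomorphicE[OF iso compact_XX K(1)])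
    fix T :: "('m lpoint \<times> ('m \<Rightarrow> real) \<Rightarrow> real) \<Rightarrow> 'k \<Rightarrow> real" and S c
    assume T: "\<And>y. y \<in> topspace K \<Longrightarrow> bounded_functional XX c (\<lambda>f. T f y)"
      and S: "\<And>x. x \<in> topspace XX \<Longrightarrow> bounded_functional K c (\<lambda>g. S g x)"
      and contS: "\<And>g. continuous_map K euclideanreal g \<Longrightarrow> continuous_map XX euclideanreal (S g)"
      and contT: "\<And>f. continuous_map XX euclideanreal f \<Longrightarrow> continuous_map K euclideanreal (T f)"
      and ST: "\<And>f x. continuous_map XX euclideanreal f \<Longrightarrow> x \<in> topspace XX \<Longrightarrow> S (T f) x = f x"
      and TS: "\<And>g y. continuous_map K euclideanreal g \<Longrightarrow> y \<in> topspace K \<Longrightarrow> T (S g) y = g y"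
    obtain x0 where "x0 \<in> B" using guess[of "\<lambda>s t. A t"] by blast
    then have "0 \<le> c" using S[OF on_interval_in_XX[of x0 0]] bounded_functional.bound_nonneg by auto
    \<comment> \<open>Passing to functionals multiplies the oscillation by
      \<open>2 * (c + 2)\<close>; the result 1/9 is the one that \<open>clip\<close> is made
      for.\<close>
    define \<epsilon>0 where "\<epsilon>0 = 1 / (9 * (2 * (c + 2)))"
    have \<epsilon>0: "0 < \<epsilon>0" "2 * (c + 2) * \<epsilon>0 = 1 / 9" using \<open>0 \<le> c\<close> by (simp_all add: \<epsilon>0_def)
    have "\<exists>N. modulus_on (topspace M) N (S k) \<epsilon>0" if "k \<in> \<K>" for k
      using modulus_exists[OF contS[OF \<K>1[OF that]] \<epsilon>0(1)] by blast
    then obtain N where N: "\<And>k. k \<in> \<K> \<Longrightarrow> modulus_on (topspace M) (N k) (S k) \<epsilon>0" by metis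
    have small: "countably_small (topspace K) J (\<lambda>k. k) (1 / 9)"
      if J: "countable J" "J \<subseteq> {k \<in> \<K>. N k = n}" for J n
    proof -
      have sX: "countably_small (topspace XX) J S \<epsilon>0"
        by (rule countably_small_XX[of J S n, OF J(1)]) (use J(2) N contS \<K>1 in auto)
      have "countably_small (topspace K) J (\<lambda>k y. T (S k) y) (2 * (c + 2) * \<epsilon>0)"
      proof (rule countably_small_functionals[OF compact_XX T sX \<epsilon>0(1)])
        show "continuous_map XX euclideanreal (S k)" if "k \<in> J" for k
          using that J(2) by (intro contS \<K>1) auto
        show "\<bar>S k x\<bar> \<le> c * 1" if "k \<in> J" "x \<in> topspace XX" for k x
        proof (rule bounded_functional.bounded[OF S])
          have k: "k \<in> \<K>" using that J(2) by auto
          then show "continuous_map K euclideanreal k" by (rule \<K>1)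
          show "\<bar>k y\<bar> \<le> 1" for y using \<K>2[OF k, of y] by simp
        qed (use that in auto)
      qed auto
      then show ?thesis
        unfolding \<epsilon>0(2) by (rule countably_small_cong[THEN iffD1, rotated]) (use J(2) \<K>1 TS in auto)
    qed
    have "\<exists>\<kappa> :: ('k \<Rightarrow> real) \<Rightarrow> nat. \<forall>y\<in>topspace K. \<forall>m.
        finite {k \<in> {k \<in> \<K>. N k = n}. \<kappa> k = m \<and> k y \<in> {2 * (1 / 9)..1 - 2 * (1 / 9)}}" for n
    proof (rule fragmented_colouring[OF K, of "{k \<in> \<K>. N k = n}" "\<lambda>k. k" "1 / 9"])
      show "\<exists>U. openin K U \<and> U \<inter> Y \<noteq> {} \<and> (\<forall>k\<in>{k \<in> \<K>. N k = n}. \<forall>x\<in>U \<inter> Y. \<forall>y\<in>U \<inter> Y. \<bar>k x - k y\<bar> \<le> 1 / 9)"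
        if "closedin K Y" "Y \<noteq> {}" for Y
        by (rule countably_small_imp_fragmented[OF K(1) that]) (use \<K>1 small in auto)
      show "countable {k \<in> {k \<in> \<K>. N k = n}. k y \<notin> {0, 1}}" if "y \<in> topspace K" for y
        by (rule countable_subset[OF _ \<K>3[OF that]]) auto
    qed (use \<K>1 in auto)
    then have "\<exists>\<kappa> :: nat \<Rightarrow> ('k \<Rightarrow> real) \<Rightarrow> nat. \<forall>n. \<forall>y\<in>topspace K. \<forall>m.
        finite {k \<in> {k \<in> \<K>. N k = n}. \<kappa> n k = m \<and> k y \<in> {2 * (1 / 9)..1 - 2 * (1 / 9)}}"
      by (intro choice allI)
    then obtain \<kappa> :: "nat \<Rightarrow> ('k \<Rightarrow> real) \<Rightarrow> nat" where \<kappa>: "\<forall>n. \<forall>y\<in>topspace K. \<forall>m.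
        finite {k \<in> {k \<in> \<K>. N k = n}. \<kappa> n k = m \<and> k y \<in> {2 * (1 / 9)..1 - 2 * (1 / 9)}}" ..
    \<comment> \<open>Modulus and colour are coded in one number, so that
      \<open>monomials_upto\<close> meets finitely many pairs of them at each level.\<close>
    define cls where "cls k = prod_encode (N k, \<kappa> (N k) k)" for k
    have small_clip: "countably_small (topspace K) J (\<lambda>k y. clip (k y)) \<epsilon>"
      if J: "countable J" "J \<subseteq> {k \<in> \<K>. cls k = q}" and "0 < \<epsilon>" for J q \<epsilon>
    proof -
      obtain n m where nm: "q = prod_encode (n, m)" by (metis prod_decode_inverse surj_pair)
      then have J': "J \<subseteq> {k \<in> \<K>. N k = n \<and> \<kappa> n k = m}" using J(2) by (auto simp: cls_def)
      show ?thesis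
      proof (rule countably_small_clip[OF _ _ \<open>0 < \<epsilon>\<close>])
        show "countably_small (topspace K) J (\<lambda>k. k) (1 / 9)"
          by (rule small[OF J(1), of n]) (use J' in auto)
        show "finite {k \<in> J. k y \<in> {2 * (1 / 9)..1 - 2 * (1 / 9)}}" if "y \<in> topspace K" for y
          by (rule finite_subset[OF _ \<kappa>[rule_format, OF that, of n m]]) (use J' in auto)
      qed
    qed
    define \<P> where "\<P> n = monomials_upto \<K> cls n" for n
    have contP: "continuous_map K euclideanreal (monomial ks)" if "ks \<in> \<P> n" for ks n
      using that \<K>1 by (intro continuous_map_monomial) (auto simp: \<P>_def monomials_upto_def)
    \<comment> \<open>The way back to \<open>XX\<close>: evaluating \<open>S g\<close> on the fibre
      over \<open>a\<close> gives bounded functionals on C(\<open>K\<close>), indexed by the points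
      \<open>z\<close> of the Cantor set.\<close>
    have small_fibre: "countably_small UNIV J (\<lambda>ks z. S (monomial ks) (on_fibre a z)) \<epsilon>"
      if a: "a \<in> AA" and J: "countable J" "J \<subseteq> \<P> n" and "0 < \<epsilon>" for a J n \<epsilon>
    proof -
      define \<epsilon>' where "\<epsilon>' = \<epsilon> / (2 * (c + 2))"
      have \<epsilon>': "0 < \<epsilon>'" "2 * (c + 2) * \<epsilon>' = \<epsilon>" using \<open>0 \<le> c\<close> \<open>0 < \<epsilon>\<close> by (simp_all add: \<epsilon>'_def)
      have sK: "countably_small (topspace K) J monomial \<epsilon>'"
        by (rule countably_small_monomials[OF small_clip J(1) J(2)[unfolded \<P>_def] \<epsilon>'(1)])
      have "countably_small UNIV J (\<lambda>ks z. S (monomial ks) (on_fibre a z)) (2 * (c + 2) * \<epsilon>')"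
      proof (rule countably_small_functionals[OF K(1) _ sK \<epsilon>'(1)])
        show "bounded_functional K c (\<lambda>g. S g (on_fibre a z))" for z
          by (rule S[OF on_fibre_in_XX[OF a]])
        show "continuous_map K euclideanreal (monomial ks)" if "ks \<in> J" for ks
          using contP that J(2) by blast
        show "\<bar>monomial ks y\<bar> \<le> 1" for ks y using monomial_range[of ks y] by simp
      qed
      then show ?thesis by (simp only: \<epsilon>'(2))
    qed
    \<comment> \<open>Small oscillation is known for countable subfamilies only; fragmentability of
      the Cantor fibre yields one cylinder for all of \<open>\<P> n\<close>.\<close>
    have cyl: "\<exists>s. \<forall>ks\<in>\<P> n. \<forall>w w'. \<bar>S (monomial ks) (on_fibre a (concat_seq s w)) -
        S (monomial ks) (on_fibre a (concat_seq s w'))\<bar> \<le> \<epsilon>" if a: "a \<in> AA" and "0 < \<epsilon>" for a n \<epsilon>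
    proof -
      have "\<exists>U. openin cantor_topology U \<and> U \<inter> UNIV \<noteq> {} \<and> (\<forall>ks\<in>\<P> n. \<forall>z\<in>U \<inter> UNIV. \<forall>z'\<in>U \<inter> UNIV.
          \<bar>S (monomial ks) (on_fibre a z) - S (monomial ks) (on_fibre a z')\<bar> \<le> \<epsilon>)"
      proof (rule countably_small_imp_fragmented[OF compact_space_cantor])
        show "closedin cantor_topology UNIV" using closedin_topspace[of cantor_topology] by simp
        show "continuous_map cantor_topology euclideanreal (\<lambda>z. S (monomial ks) (on_fibre a z))" if "ks \<in> \<P> n" for ks
          using continuous_map_compose[OF continuous_map_on_fibre[OF a] contS[OF contP[OF that]]] by (simp add: o_def)
      qed (use small_fibre[OF a _ _ \<open>0 < \<epsilon>\<close>] in auto)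
      then obtain U where U: "openin cantor_topology U" "U \<noteq> {}" "\<And>ks z z'. ks \<in> \<P> n \<Longrightarrow> z \<in> U \<Longrightarrow> z' \<in> U \<Longrightarrow>
          \<bar>S (monomial ks) (on_fibre a z) - S (monomial ks) (on_fibre a z')\<bar> \<le> \<epsilon>"
        by auto
      obtain s where s: "\<And>w. concat_seq s w \<in> U" using exists_concat_seq[OF U(1,2)] by blast
      show ?thesis by (intro exI[of _ s] ballI allI) (auto intro: U(3) s)
    qed
    \<comment> \<open>At level \<open>m\<close> there are \<open>2 ^ m\<close> dyadic intervals;
      with \<open>(1 / 4) ^ m\<close> on each, \<open>(1 / 2) ^ m\<close> is left for the two ends
      of the whole interval.\<close>
    define X where "X s t = {a \<in> A t. \<forall>ks\<in>\<P> (length t). \<forall>w w'. \<bar>S (monomial ks) (on_fibre a (concat_seq s w)) -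
        S (monomial ks) (on_fibre a (concat_seq s w'))\<bar> \<le> (1 / 4) ^ length t}" for s t
    have XA: "X s t \<subseteq> A t" for s t by (auto simp: X_def)
    have "A t = (\<Union>s. X s t)" for t
    proof
      show "A t \<subseteq> (\<Union>s. X s t)"
      proof
        fix a assume a: "a \<in> A t"
        then obtain s where "\<forall>ks\<in>\<P> (length t). \<forall>w w'. \<bar>S (monomial ks) (on_fibre a (concat_seq s w)) -
            S (monomial ks) (on_fibre a (concat_seq s w'))\<bar> \<le> (1 / 4) ^ length t"
          using cyl[of a "(1 / 4) ^ length t" "length t"] by auto
        then show "a \<in> (\<Union>s. X s t)" using a by (auto simp: X_def)
      qed
    qed (use XA in auto)
    moreover have "X s t \<subseteq> AA" for s t using XA by blast
    ultimately obtain x where x: "x \<in> B" "\<And>t. infinite (Cx x \<inter> X (\<psi> x t) t)"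
      using guess[of X] by blast
    have eq: "S (monomial ks) (on_interval x 0) = S (monomial ks) (on_interval x 1)" if ks: "ks \<in> lists \<K>" for ks
    proof -
      define h where "h = S (monomial ks)"
      \<comment> \<open>A given product is controlled from some level on, and only these levels are
        used for it.\<close>
      obtain n0 where n0: "\<And>m. n0 \<le> m \<Longrightarrow> ks \<in> \<P> m"
        unfolding \<P>_def using monomials_upto_exhaust[OF ks] by blast
      have h: "continuous_map XX euclideanreal h"
        unfolding h_def using contS contP n0 by blast
      have bound: "\<bar>h (on_interval x 0) - h (on_interval x 1)\<bar> \<le> (1 / 2) ^ m" if m: "n0 \<le> m" for m
      proof -
        have step: "\<bar>h (on_interval x (dyadic (concat_seq t w))) - h (on_interval x (dyadic (concat_seq t w')))\<bar> \<le> (1 / 4) ^ m"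
          if t: "length t = m" for t w w'
        proof (rule limit_interval[OF h x(1) XA x(2)])
          fix a w w' assume "a \<in> X (\<psi> x t) t"
          then show "\<bar>h (on_fibre a (concat_seq (\<psi> x t) w)) - h (on_fibre a (concat_seq (\<psi> x t) w'))\<bar> \<le> (1 / 4) ^ m"
            using n0[OF m] t by (auto simp: X_def h_def)
        qed
        have "\<bar>h (on_interval x (dyadic (concat_seq [] (\<lambda>_. False)))) - h (on_interval x (dyadic (concat_seq [] (\<lambda>_. True))))\<bar>
            \<le> 2 ^ m * (1 / 4) ^ m"
          by (rule dyadic_chain[where \<phi> = "\<lambda>r. h (on_interval x r)" and m = m]) (use step in auto)
        also have "(2 :: real) ^ m * (1 / 4) ^ m = (1 / 2) ^ m" by (simp flip: power_mult_distrib)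
        finally show ?thesis by (simp add: dyadic_False dyadic_True)
      qed
      have "\<bar>h (on_interval x 0) - h (on_interval x 1)\<bar> \<le> e" if "0 < e" for e
      proof -
        obtain m where "(1 / 2 :: real) ^ m < e" using real_arch_pow_inv[OF \<open>0 < e\<close>, of "1 / 2"] by auto
        moreover have "(1 / 2 :: real) ^ max m n0 \<le> (1 / 2) ^ m" by (rule power_decreasing) auto
        moreover have "\<bar>h (on_interval x 0) - h (on_interval x 1)\<bar> \<le> (1 / 2) ^ max m n0"
          by (rule bound) simp
        ultimately show ?thesis by linarith
      qed
      then have "\<bar>h (on_interval x 0) - h (on_interval x 1)\<bar> \<le> 0" by (rule dense_ge)
      then show ?thesis by (simp add: h_def)
    qed
    \<comment> \<open>Every continuous function on \<open>XX\<close> agrees there with some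
      \<open>S g\<close>, in particular the coordinate at \<open>x\<close>, which is 0 at one of
      these two points and 1 at the other.\<close>
    have "S g (on_interval x 0) = S g (on_interval x 1)" if "continuous_map K euclideanreal g" for g
      by (rule functionals_eq_of_monomials_eq[OF K(1) \<K>1 \<K>4 S S eq that])
         (use x(1) in \<open>auto intro: on_interval_in_XX\<close>)
    from this[OF contT[OF continuous_map_snd_XX[OF x(1)]]]
    have "snd (on_interval x 0) x = snd (on_interval x 1) x"
      using ST[OF continuous_map_snd_XX[OF x(1)]] on_interval_in_XX[OF x(1)] by auto
    then show False using x(1) by simp
  qed
qed

end

theorem corollary1p2:
  fixes M :: "'m topology"
    and A :: "bool list \<Rightarrow> 'm set"
    and B C :: "'m set"
    and Cx :: "'m \<Rightarrow> 'm set"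
    and \<psi> :: "'m \<Rightarrow> bool list \<Rightarrow> bool list"
  assumes "basic_space M A B C Cx \<psi>"
  shows "\<not> (\<exists>K :: 'k topology. almost_totally_disconnected TYPE('i) K \<and>
              C_isomorphic (L1_space M A B C Cx \<psi>) K)"
  using basic_space.not_C_isomorphic[OF assms] by blast

end
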